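(* For every signed permutation $w$ and every $n\in\mathbb{N}$, $$|\mathcal{H}_n(w)|=\sum_{\lambda\ \text{strict},\ |\lambda|\le n} a^C_w(\lambda)\cdot|\mathrm{ShSet}_n(\lambda)|.$$
   Context: $\mathbb{N}=\{0,1,2,\dots\}$. $W_m$ is the group of bijections $w$ of $\{-m,\dots,-1,1,\dots,m\}$ with $w(-i)=-w(i)$ (signed permutations), with Coxeter generators $s_0=(-1\ 1)$ and $s_i=(-i{-}1\ \,{-}i)(i\ \,i{+}1)$, $1\le i\le m-1$; $W_m\subset W_{m+1}$ naturally. The 0-Hecke product $\circ$ is the monoid structure on $W_m$ generated by the $s_i$ with relations $s_i\circ s_i=s_i$, $s_i\circ s_j=s_j\circ s_i$ ($|i-j|\ge2$), $s_i\circ s_{i+1}\circ s_i=s_{i+1}\circ s_i\circ s_{i+1}$ ($i>0$), $s_1\circ s_0\circ s_1\circ s_0=s_0\circ s_1\circ s_0\circ s_1$. $\mathcal{H}_n(w)$ is the set of words $(a_1,\dots,a_n)\in\mathbb{N}^n$ with $w=s_{a_1}\circ\cdots\circ s_{a_n}$ (0-Hecke expressions of length $n$). A strict partition is $\lambda=(\lambda_1>\dots>\lambda_k>0)$, $|\lambda|=\sum\lambda_i$, with shifted diagram $D_\lambda=\{(i,j):1\le i\le k,\ i\le j\le\lambda_i+i-1\}$ (row $i$, column $j$, rows numbered downward). $\mathrm{ShSet}_n(\lambda)$ is the set of fillings $T$ of $D_\lambda$ by nonempty sets that partition $\{1,\dots,n\}$ with $\max T_{ij}<\min T_{i+1,j}$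 and $\max T_{ij}<\min T_{i,j+1}$ whenever those cells exist. A sequence $r_1\dots r_k$ in $\mathbb{N}$ is unimodal if $r_1>\dots>r_j<\dots<r_k$ for some $j$. A strict decomposition tableau of shape $\lambda$ is a filling $T:D_\lambda\to\mathbb{N}$ with every row unimodal such that for any two consecutive rows $i,i+1$, writing $r_j=T_{i,j}$, $s_j=T_{i+1,j}$, none of the following occurs (for cells that exist): (i) $s_j\ge r_i$ for some $j$ ($r_i$ is the first entry of row $i$); (ii) $r_j\le s_{j'}<s_j$ with $j<j'$; (iii) $r_{j-1}<r_j$ and $s_j<s_{j'}\le r_j$ with $j<j'$; (iv)/(v) $s_j<r_{j'}\le r_j$ with $j'<j$. The reading word of a tableau with rows $R_1,\dots,R_k$ (top to bottom, each read left to right) is the concatenation $R_kR_{k-1}\cdots R_1$. $a^C_w(\lambda)$ is the number of strict decomposition tableaux of shape $\lambda$ whose reading word is a 0-Hecke expression for $w$.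
   Formalization: The definition of strict decomposition tableau also forbids s_j ≤ r_{j-1} < r_j in consecutive rows; with only the listed patterns the identity fails (w the class of 0312, n=5: the tableau with rows 312 and 01 makes the sum 19 instead of 17). *)

theory Defs
  imports
    Main
    "HOL-Combinatorics.Permutations"
    "HOL-Library.FuncSet"
    "HOL-Library.Disjoint_Sets"
begin

section \<open>Signed permutations and the 0-Hecke product\<close>

text \<open>
  Elements of \<open>W\<^sub>m\<close> are functions on all integers that are the identity outside
  \<open>{-m,\<dots>,-1,1,\<dots>,m}\<close>; thus \<open>W\<^sub>m \<subseteq> W\<^sub>m\<^sub>+\<^sub>1\<close> holds literally.
\<close>

definition signed_perms :: "nat \<Rightarrow> (int \<Rightarrow> int) set" where
  "signed_perms m =
     {w. w permutes ({- int m..-1} \<union> {1..int m}) \<and> (\<forall>i. w (- i) = - w i)}"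

definition cox_gen :: "nat \<Rightarrow> int \<Rightarrow> int" where
  "cox_gen i =
     (if i = 0 then Transposition.transpose (-1) 1
      else Transposition.transpose (- int i - 1) (- int i)
           \<circ> Transposition.transpose (int i) (int i + 1))"

definition group_word :: "nat list \<Rightarrow> int \<Rightarrow> int" where
  "group_word a = foldr (\<circ>) (map cox_gen a) id"

definition reduced_word :: "nat list \<Rightarrow> (int \<Rightarrow> int) \<Rightarrow> bool" where
  "reduced_word a w \<longleftrightarrow>
     group_word a = w \<and> (\<forall>b. group_word b = w \<longrightarrow> length a \<le> length b)"

text \<open>
  The congruence on the free monoid of words whose quotient is the 0-Hecke monoid
  (with all generators \<open>s\<^sub>0, s\<^sub>1, \<dots>\<close>; the relations preserve the set of letters, so each
  submonoid generated by \<open>s\<^sub>0, \<dots>, s\<^sub>m\<^sub>-\<^sub>1\<close> has the presentation of the rank \<open>m\<close> monoid).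
\<close>

inductive hecke_cong :: "nat list \<Rightarrow> nat list \<Rightarrow> bool" where
  refl: "hecke_cong a a"
| sym: "hecke_cong a b \<Longrightarrow> hecke_cong b a"
| trans: "hecke_cong a b \<Longrightarrow> hecke_cong b c \<Longrightarrow> hecke_cong a c"
| idem: "hecke_cong (a @ [i, i] @ b) (a @ [i] @ b)"
| comm: "i + 2 \<le> j \<Longrightarrow> hecke_cong (a @ [i, j] @ b) (a @ [j, i] @ b)"
| braid: "i > 0 \<Longrightarrow> hecke_cong (a @ [i, i + 1, i] @ b) (a @ [i + 1, i, i + 1] @ b)"
| braid0: "hecke_cong (a @ [1, 0, 1, 0] @ b) (a @ [0, 1, 0, 1] @ b)"

text \<open>
  The 0-Hecke monoid is carried by the set of signed permutations: \<open>w\<close> corresponds to the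
  class of its reduced words, and the product is transported along this bijection.
\<close>

definition hecke_prod :: "(int \<Rightarrow> int) \<Rightarrow> (int \<Rightarrow> int) \<Rightarrow> int \<Rightarrow> int" where
  "hecke_prod u v =
     (THE w. \<exists>a b c. reduced_word a u \<and> reduced_word b v \<and> reduced_word c w
                      \<and> hecke_cong (a @ b) c)"

definition hecke_expr :: "nat list \<Rightarrow> (int \<Rightarrow> int) \<Rightarrow> bool" where
  "hecke_expr a w \<longleftrightarrow> w = foldr hecke_prod (map cox_gen a) id"

definition hecke_words :: "nat \<Rightarrow> (int \<Rightarrow> int) \<Rightarrow> nat list set" where
  "hecke_words n w = {a. length a = n \<and> hecke_expr a w}"


section \<open>Strict partitions and shifted set-valued tableaux\<close>

definition strict_partition :: "nat list \<Rightarrow> bool" where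
  "strict_partition lam \<longleftrightarrow> sorted_wrt (>) lam \<and> (\<forall>x\<in>set lam. x > 0)"

definition shifted_diagram :: "nat list \<Rightarrow> (nat \<times> nat) set" where
  "shifted_diagram lam =
     {(i, j). 1 \<le> i \<and> i \<le> length lam \<and> i \<le> j \<and> j \<le> lam ! (i - 1) + i - 1}"

definition ShSet :: "nat \<Rightarrow> nat list \<Rightarrow> (nat \<times> nat \<Rightarrow> nat set) set" where
  "ShSet n lam =
     {T \<in> extensional (shifted_diagram lam).
        (\<forall>c\<in>shifted_diagram lam. T c \<noteq> {}) \<and>
        disjoint_family_on T (shifted_diagram lam) \<and>
        (\<Union>c\<in>shifted_diagram lam. T c) = {1..n} \<and>
        (\<forall>i j. (i, j) \<in> shifted_diagram lam \<longrightarrow> (i + 1, j) \<in> shifted_diagram lam \<longrightarrow>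
           Max (T (i, j)) < Min (T (i + 1, j))) \<and>
        (\<forall>i j. (i, j) \<in> shifted_diagram lam \<longrightarrow> (i, j + 1) \<in> shifted_diagram lam \<longrightarrow>
           Max (T (i, j)) < Min (T (i, j + 1)))}"


section \<open>Strict decomposition tableaux\<close>

definition unimodal :: "nat list \<Rightarrow> bool" where
  "unimodal r \<longleftrightarrow>
     (\<exists>j<length r. sorted_wrt (>) (take (j + 1) r) \<and> sorted_wrt (<) (drop j r))"

definition tab_row :: "nat list \<Rightarrow> (nat \<times> nat \<Rightarrow> nat) \<Rightarrow> nat \<Rightarrow> nat list" where
  "tab_row lam T i = map (\<lambda>j. T (i, j)) [i..<lam ! (i - 1) + i]"

text \<open>
  Forbidden patterns in rows \<open>i\<close>, \<open>i + 1\<close> of \<open>T\<close>, with \<open>r\<^sub>j = T (i, j)\<close> and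
  \<open>s\<^sub>j = T (i + 1, j)\<close>. The last two disjuncts overlap in the case \<open>s\<^sub>j < r\<^sub>j\<^sub>-\<^sub>1 < r\<^sub>j\<close>;
  the last one only adds the case \<open>s\<^sub>j = r\<^sub>j\<^sub>-\<^sub>1 < r\<^sub>j\<close>, without which the tableau with
  rows \<open>3 1 2\<close> and \<open>0 1\<close> would be admitted and the enumeration of 0-Hecke
  expressions of length 5 for the class of \<open>0 3 1 2\<close> would fail (19 instead of 17).
\<close>

definition forbidden_pattern ::
  "nat list \<Rightarrow> (nat \<times> nat \<Rightarrow> nat) \<Rightarrow> nat \<Rightarrow> bool" where
  "forbidden_pattern lam T i \<longleftrightarrow>
     (let D = shifted_diagram lam; r = (\<lambda>j. T (i, j)); s = (\<lambda>j. T (i + 1, j)) in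
       (\<exists>j. (i + 1, j) \<in> D \<and> s j \<ge> r i) \<or>
       (\<exists>j j'. j < j' \<and> (i, j) \<in> D \<and> (i + 1, j) \<in> D \<and> (i + 1, j') \<in> D \<and>
          r j \<le> s j' \<and> s j' < s j) \<or>
       (\<exists>j j'. j < j' \<and> (i, j - 1) \<in> D \<and> (i, j) \<in> D \<and> (i + 1, j) \<in> D \<and> (i + 1, j') \<in> D \<and>
          r (j - 1) < r j \<and> s j < s j' \<and> s j' \<le> r j) \<or>
       (\<exists>j j'. j' < j \<and> (i, j') \<in> D \<and> (i, j) \<in> D \<and> (i + 1, j) \<in> D \<and>
          s j < r j' \<and> r j' \<le> r j) \<or>
       (\<exists>j. (i, j - 1) \<in> D \<and> (i, j) \<in> D \<and> (i + 1, j) \<in> D \<and>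
          s j \<le> r (j - 1) \<and> r (j - 1) < r j))"

definition strict_decomp_tableaux :: "nat list \<Rightarrow> (nat \<times> nat \<Rightarrow> nat) set" where
  "strict_decomp_tableaux lam =
     {T \<in> extensional (shifted_diagram lam).
        (\<forall>i\<in>{1..length lam}. unimodal (tab_row lam T i)) \<and>
        (\<forall>i. 1 \<le> i \<and> i + 1 \<le> length lam \<longrightarrow> \<not> forbidden_pattern lam T i)}"

definition reading_word :: "nat list \<Rightarrow> (nat \<times> nat \<Rightarrow> nat) \<Rightarrow> nat list" where
  "reading_word lam T = concat (map (tab_row lam T) (rev [1..<length lam + 1]))"

definition aC :: "(int \<Rightarrow> int) \<Rightarrow> nat list \<Rightarrow> nat" where
  "aC w lam = card {T \<in> strict_decomp_tableaux lam. hecke_expr (reading_word lam T) w}"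

end

theory Submission
  imports Defs
begin

text \<open>
  A letter \<open>x\<close> is inserted into a strict decomposition tableau from the top row downwards.  It either
  extends the row, or is absorbed by an equal last entry, or replaces entries of the row and bumps a
  letter \<open>y\<close> into the next row.  For a fixed lower row the bumping step is a bijection from the
  bumpable pairs (row, letter) onto the pairs (letter, row) for which \<open>y\<close> can be inserted below the
  new row, and it preserves the 0-Hecke class.  Hence tableaux of shape \<open>\<mu>\<close> together with a letter
  correspond to tableaux of shape \<open>\<mu>\<close> with a marked removable corner and to tableaux with one more
  cell.  Deleting the largest entry gives the same recursion for shifted set-valued tableaux, so
  words of length \<open>n\<close> correspond to pairs of a strict decomposition tableau and a shifted set-valued
  tableau with entries \<open>1, \<dots>, n\<close> of equal shape, the reading word of the former being in the class of
  the word.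
\<close>

section \<open>Compatible rows and bumping\<close>

text \<open>Below, (i), (ii), (iv), (v) are the first, second, fourth and fifth disjunct of
  \<open>forbidden_pattern\<close>. For a row \<open>R\<close> above \<open>S\<close>, (iv) forces
  \<open>R!i <= S!j\<close> whenever \<open>i <= j\<close> and \<open>R!i <= R!Suc j\<close>, and
  (v) forces \<open>R!j < S!j\<close> whenever \<open>R!j < R!Suc j\<close>. Two obstacles shape the
  proof. A letter passed on to the next row need not have left a cell: a 0-Hecke relation may have
  created it, and the old row then shows no trace of it. Steps are therefore described from their
  result; for given rows and positions at most one letter can have been created. Secondly, the new
  upper row has to fit above a lower row that is still to be changed. This is expressed by
  \<open>y\<close> and the unchanged lower row: the bracket in \<open>upper_cond\<close> lists what
  keeps \<open>y\<close> from standing at position \<open>i\<close>, namely (v), a missing cell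
  above, or (iv), so that \<open>y\<close> must not exceed \<open>S!(i - 1)\<close>;
  \<open>lower_cond\<close> guards against (ii) with \<open>y\<close> as the smaller of the two
  lower entries.\<close>

definition vee :: "nat list \<Rightarrow> nat \<Rightarrow> bool" where
  "vee R v \<longleftrightarrow> v < length R \<and> (\<forall>i j. i < j \<and> j \<le> v \<longrightarrow> R!j < R!i)
     \<and> (\<forall>i j. v \<le> i \<and> i < j \<and> j < length R \<longrightarrow> R!i < R!j)"

lemma veeI:
  assumes "v < length R" "\<And>i. i < v \<Longrightarrow> R!Suc i < R!i"
    "\<And>i. v \<le> i \<Longrightarrow> Suc i < length R \<Longrightarrow> R!i < R!Suc i"
  shows "vee R v"
proof -
  have 1: "j \<le> v \<longrightarrow> i < j \<longrightarrow> R!j < R!i" for i j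
  proof (induction j)
    case (Suc j)
    then show ?case using assms(2)[of j] by (cases "i = j") (auto simp: less_Suc_eq)
  qed simp
  have 2: "j < length R \<longrightarrow> v \<le> i \<longrightarrow> i < j \<longrightarrow> R!i < R!j" for i j
  proof (induction j)
    case (Suc j)
    then show ?case using assms(3)[of j] by (cases "i = j") (auto simp: less_Suc_eq)
  qed simp
  show ?thesis unfolding vee_def using assms(1) 1 2 by auto
qed

text \<open>
  Entries of the lower row \<open>S\<close> are indexed so that \<open>S!j\<close> lies below \<open>R!Suc j\<close>.  For unimodal rows the
  forbidden pattern (iii) follows from the other ones and is omitted.
\<close>

definition ok :: "nat list \<Rightarrow> nat list \<Rightarrow> bool" where
  "ok R S \<longleftrightarrow> length S < length R \<and> (\<forall>j<length S. S!j < R!0)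
    \<and> (\<forall>i j. i < j \<and> j < length S \<longrightarrow> \<not> (R!Suc i \<le> S!j \<and> S!j < S!i))
    \<and> (\<forall>j<length S. R!j < R!Suc j \<longrightarrow> R!j < S!j)
    \<and> (\<forall>i j. i \<le> j \<and> j < length S \<and> R!i \<le> R!Suc j \<longrightarrow> R!i \<le> S!j)"

text \<open>
  The next two conditions, with \<open>y < R!0\<close> and \<open>ok R S\<close>, say that after inserting the letter \<open>y\<close>
  into the row \<open>S\<close> the result still fits below \<open>R\<close>, whose valley is at \<open>v\<close>.
\<close>

definition upper_cond :: "nat list \<Rightarrow> nat \<Rightarrow> nat list \<Rightarrow> nat \<Rightarrow> bool" where
  "upper_cond R v S y \<longleftrightarrow> (\<forall>i. v \<le> i \<and> i \<le> length S \<and>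
      (y \<le> R!i \<or> Suc i = length R \<or> (\<exists>j<v. y < R!j \<and> R!j \<le> R!Suc i)) \<longrightarrow> y \<le> S!(i - 1))"

definition lower_cond :: "nat list \<Rightarrow> nat \<Rightarrow> nat list \<Rightarrow> nat \<Rightarrow> bool" where
  "lower_cond R v S y \<longleftrightarrow> (\<forall>j i. j < v \<and> (Suc j = v \<or> R!Suc j \<le> y) \<and> i < length S \<and> y < S!i \<longrightarrow>
      1 \<le> j \<and> (j < length S \<and> S!j < S!(j - 1) \<longrightarrow> S!(j - 1) \<le> S!i))"

text \<open>Says that \<open>c\<close> can stand at position \<open>q\<close>: the row still
  increases after it, and (v) is avoided at \<open>S!q\<close>, which lies below position
  \<open>Suc q\<close>.\<close>

definition below_next :: "nat list \<Rightarrow> nat list \<Rightarrow> nat \<Rightarrow> nat \<Rightarrow> bool" where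
  "below_next r S q c \<longleftrightarrow> (Suc q < length r \<longrightarrow> c < r!Suc q) \<and> (q < length S \<longrightarrow> c < S!q)"

text \<open>Says that \<open>y\<close> at position \<open>p\<close> of the upper row creates neither
  (i), the case \<open>p = 0\<close>, nor (ii) with the entry \<open>S!(p - 1)\<close>, which lies
  below position \<open>p\<close>.\<close>

definition strictB :: "nat list \<Rightarrow> nat \<Rightarrow> nat \<Rightarrow> bool" where
  "strictB S p y \<longleftrightarrow> (\<forall>i<length S. p \<le> i \<and> (p = 0 \<or> S!i < S!(p - 1)) \<longrightarrow> S!i < y)"

text \<open>Says that \<open>y\<close> can have stood at \<open>p\<close> before the step. Away from
  the valley the row must still decrease after it; next to the valley \<open>u\<close> is the entry
  that then follows \<open>y\<close>, and (v) has to be avoided.\<close>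

definition strict :: "nat list \<Rightarrow> nat \<Rightarrow> nat list \<Rightarrow> nat \<Rightarrow> nat \<Rightarrow> nat \<Rightarrow> bool" where
  "strict r v S p u y \<longleftrightarrow> (Suc p < v \<longrightarrow> r!Suc p < y)
     \<and> (Suc p = v \<longrightarrow> y \<noteq> u \<and> (y < u \<and> v \<le> length S \<longrightarrow> y < S!(v - 1))) \<and> strictB S p y"

lemma okD:
  assumes "ok R S"
  shows "length S < length R" "\<And>j. j < length S \<Longrightarrow> S!j < R!0"
    "\<And>i j. i < j \<Longrightarrow> j < length S \<Longrightarrow> R!Suc i \<le> S!j \<Longrightarrow> S!i \<le> S!j"
    "\<And>j. j < length S \<Longrightarrow> R!j < R!Suc j \<Longrightarrow> R!j < S!j"
    "\<And>i j. i \<le> j \<Longrightarrow> j < length S \<Longrightarrow> R!i \<le> R!Suc j \<Longrightarrow> R!i \<le> S!j"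
  using assms unfolding ok_def by (blast intro: leI)+

lemma okI:
  assumes "length S < length R" "\<And>j. j < length S \<Longrightarrow> S!j < R!0"
    "\<And>i j. i < j \<Longrightarrow> j < length S \<Longrightarrow> R!Suc i \<le> S!j \<Longrightarrow> S!j < S!i \<Longrightarrow> False"
    "\<And>j. j < length S \<Longrightarrow> R!j < R!Suc j \<Longrightarrow> R!j < S!j"
    "\<And>i j. i \<le> j \<Longrightarrow> j < length S \<Longrightarrow> R!i \<le> R!Suc j \<Longrightarrow> R!i \<le> S!j"
  shows "ok R S"
  using assms unfolding ok_def by blast

lemma veeD:
  assumes "vee R v"
  shows "v < length R" "\<And>i j. i < j \<Longrightarrow> j \<le> v \<Longrightarrow> R!j < R!i"
    "\<And>i j. v \<le> i \<Longrightarrow> i < j \<Longrightarrow> j < length R \<Longrightarrow> R!i < R!j"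
  using assms unfolding vee_def by auto

text \<open>A descent into \<open>j\<close> puts \<open>j\<close> at or before the valley, so the
  whole prefix decreases.\<close>

lemma vee_desc:
  assumes vs: "S = [] \<or> (\<exists>w. vee S w)" and a: "j < length S" "S!j < S!(j - 1)" "i1 < i2" "i2 \<le> j"
  shows "S!i2 < S!i1"
proof -
  obtain w where w: "vee S w" using vs a by auto
  have "j \<le> w"
  proof (rule ccontr)
    assume "\<not> j \<le> w"
    then have "S!(j-1) < S!j" using veeD(3)[OF w, of "j-1" j] a by (cases j) auto
    then show False using a by auto
  qed
  then show ?thesis using veeD(2)[OF w] a by auto
qed

text \<open>An entry with a smaller one somewhere to its right lies strictly before the
  valley.\<close>

lemma vee_desc':
  assumes vs: "S = [] \<or> (\<exists>w. vee S w)" and a: "i < j" "j < length S" "S!j < S!i"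
  shows "Suc i < length S \<and> S!Suc i < S!i"
proof -
  obtain w where w: "vee S w" using vs a by auto
  have "i < w"
  proof (rule ccontr)
    assume "\<not> i < w"
    then have "S!i < S!j" using veeD(3)[OF w, of i j] a by auto
    then show False using a by auto
  qed
  then show ?thesis using veeD(1)[OF w] veeD(2)[OF w, of i "Suc i"] by auto
qed

text \<open>For a letter that leaves position \<open>p\<close> the condition is inherited from
  \<open>ok R S\<close>: an entry of \<open>S\<close> strictly between \<open>R!p\<close> and
  \<open>S!(p - 1)\<close> at a later position would be (ii), and \<open>p = 0\<close> is excluded
  by (i).\<close>

lemma lower_cond_of_ok:
  assumes vs: "S = [] \<or> (\<exists>w. vee S w)" and okR: "ok R S"
    and pj: "\<And>j. j < v \<Longrightarrow> Suc j = v \<or> r!Suc j \<le> R!p \<Longrightarrow> p \<le> j"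
  shows "lower_cond r v S (R!p)"
  unfolding lower_cond_def
proof (intro allI impI)
  fix j i assume h: "j < v \<and> (Suc j = v \<or> r!Suc j \<le> R!p) \<and> i < length S \<and> R!p < S!i"
  then have j: "p \<le> j" using pj by auto
  have p0: "p \<noteq> 0" using okD(2)[OF okR, of i] h by (metis not_less_iff_gr_or_eq)
  have "S!(j - 1) \<le> S!i" if d: "j < length S" "S!j < S!(j - 1)"
  proof (rule ccontr)
    assume n: "\<not> S!(j - 1) \<le> S!i"
    have "p - 1 < j - 1 \<or> p = j" using j p0 by linarith
    then have "S!(j - 1) \<le> S!(p - 1)" using vee_desc[OF vs d, of "p - 1" "j - 1"] by auto
    then have lt: "S!i < S!(p - 1)" using n by auto
    have "p \<le> i"
    proof (rule ccontr)
      assume "\<not> p \<le> i"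
      then have "i < p - 1 \<or> i = p - 1" by linarith
      then have "S!(p - 1) \<le> S!i" using vee_desc[OF vs d, of i "p - 1"] j le_diff_conv by fastforce
      then show False using lt by auto
    qed
    then have "p - 1 < i" using p0 by linarith
    then show False using okD(3)[OF okR, of "p - 1" i] h lt p0 by auto
  qed
  then show "1 \<le> j \<and> (j < length S \<and> S!j < S!(j - 1) \<longrightarrow> S!(j - 1) \<le> S!i)" using p0 j by auto
qed

text \<open>By (i) for \<open>p = 0\<close>, otherwise by (ii) at \<open>S!(p - 1)\<close>.\<close>

lemma strictB_of_ok:
  assumes "ok R S"
  shows "strictB S p (R!p)"
  unfolding strictB_def
proof (intro allI impI)
  fix i assume h: "i < length S" "p \<le> i \<and> (p = 0 \<or> S!i < S!(p - 1))"
  show "S!i < R!p"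
  proof (cases "p = 0")
    case False
    then have "p - 1 < i" "Suc (p - 1) = p" using h by linarith+
    then show ?thesis using okD(3)[OF assms, of "p - 1" i] h False by (metis leD leI)
  qed (use okD(2)[OF assms, of i] h in auto)
qed

text \<open>
  A bumping step is analysed from its result: the upper row \<open>r\<close> with valley \<open>v\<close>, the unchanged
  lower row \<open>S\<close>, and a bumped letter \<open>y\<close>.  Here \<open>p\<close> is the last position of the decreasing part
  with \<open>y < r!p\<close>, and \<open>q\<close> the last position of the increasing part with \<open>r!q < r!p\<close>; the inserted
  letter was \<open>r!q\<close>.
\<close>

locale bump_frame =
  fixes r S :: "nat list" and v p q :: nat
  assumes vr: "vee r v" and vs: "S = [] \<or> (\<exists>w. vee S w)" and okr: "ok r S"
    and pv: "p < v" and vq: "v \<le> q" and qk: "q < length r" and ac: "r!q < r!p"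
    and ce: "Suc q < length r \<Longrightarrow> r!p \<le> r!Suc q"
begin

lemmas D = veeD(2)[OF vr] and U = veeD(3)[OF vr]
lemmas oL = okD(1)[OF okr] and oA = okD(2)[OF okr] and oB = okD(3)[OF okr] and oC = okD(4)[OF okr] and oD = okD(5)[OF okr]

text \<open>The entry at position \<open>v\<close> once the step has been undone: \<open>r!p\<close>
  if this value returns to \<open>q = v\<close>, otherwise the old one.\<close>

abbreviation "uu \<equiv> (if q = v \<and> below_next r S q (r!p) then r!p else r!v)"

lemma pre: "i < p \<Longrightarrow> r!p < r!i" using D pv by auto
lemma lo: "p < i \<Longrightarrow> i \<le> q \<Longrightarrow> r!i < r!p"
  using D[of p i] U[of i q] ac qk by (cases "i \<le> v") (auto, metis le_neq_implies_less less_trans nat_le_linear not_le)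
lemma lo2: "v \<le> i \<Longrightarrow> i < q \<Longrightarrow> r!i < r!q" using U qk by auto
lemma hi: "q < i \<Longrightarrow> i < length r \<Longrightarrow> r!p \<le> r!i"
  using ce U[of "Suc q" i] vq by (cases "i = Suc q") auto
text \<open>Right of \<open>q\<close> the row \<open>r\<close> is at least \<open>r!p\<close>, and
  (iv) carries this bound over to the lower row.\<close>

lemma S_hi: "q \<le> j \<Longrightarrow> j < length S \<Longrightarrow> r!p \<le> S!j"
  using oD[of p j] hi[of "Suc j"] oL pv vq by auto
lemmas S_desc = vee_desc[OF vs] and S_desc' = vee_desc'[OF vs]

context
  fixes y
  assumes yc: "y < r!p" and yk: "Suc p < v \<Longrightarrow> r!Suc p \<le> y"
begin

lemma mid: "p < i \<Longrightarrow> i < v \<Longrightarrow> r!i \<le> y"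
  using yk D[of "Suc p" i] by (cases "i = Suc p") auto

text \<open>Undoing a full bump: \<open>r!p\<close> returns to \<open>q\<close> and \<open>y\<close>
  to \<open>p\<close>. The hypotheses \<open>below_next\<close> and \<open>strict\<close> control
  the restored entries and their neighbours; \<open>upper_cond\<close> controls the comparisons of
  \<open>y\<close> with entries of \<open>S\<close> further right that (iv) demands.\<close>

lemma replace_both_ok:
  assumes quy: "upper_cond r v S y" and lt: "below_next r S q (r!p)" and st: "strict r v S p uu y"
  shows "\<exists>u. vee (r[p := y, q := r!p]) u" "ok (r[p := y, q := r!p]) S"
proof -
  let ?R = "r[p := y, q := r!p]"
  have nR: "\<And>i. i < length r \<Longrightarrow> ?R!i = (if i = q then r!p else if i = p then y else r!i)"
    by (simp add: nth_list_update)
  have e: "Suc q < length r \<Longrightarrow> r!p < r!Suc q" and es: "q < length S \<Longrightarrow> r!p < S!q" using lt by (auto simp: below_next_def)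
  have s1: "Suc p < v \<Longrightarrow> r!Suc p < y" and s2: "Suc p = v \<Longrightarrow> y \<noteq> (if q = v then r!p else r!v)"
    and s3: "Suc p = v \<Longrightarrow> v \<le> length S \<Longrightarrow> y < (if q = v then r!p else r!v) \<Longrightarrow> y < S!p"
    and sB: "strictB S p y"
    using st lt pv by (auto simp: strict_def split: if_splits)
  have mid': "p < i \<Longrightarrow> i < v \<Longrightarrow> r!i < y" for i using s1 D[of "Suc p" i] by (cases "i = Suc p") auto
  have vk: "v < length r" using vq qk by simp
  \<comment> \<open>Restoring the large \<open>r!p\<close> at \<open>q = v\<close> pushes the valley
    one place to the left; a \<open>y\<close> that is next to it and smaller than its new right
    neighbour becomes the valley itself.\<close>
  define u where "u = (if Suc p = v \<and> (q = v \<or> y < r!v) then p else if q = v then v - 1 else v)"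
  have "vee ?R u"
  proof (rule veeI)
    show "u < length ?R" using pv vk by (auto simp: u_def)
  next
    fix i assume i: "i < u"
    then have iv: "i < v" and qi: "i \<noteq> q" "Suc i \<noteq> q" using pv vq unfolding u_def by (auto split: if_splits)
    have k: "i < length r" "Suc i < length r" using iv vk by auto
    have "i = p \<Longrightarrow> r!Suc i < y" using i s1 s2 pv unfolding u_def by (cases "Suc p = v") (auto split: if_splits)
    moreover have "Suc i = p \<Longrightarrow> y < r!i" using pre[of i] yc by auto
    ultimately show "?R!Suc i < ?R!i" unfolding nR[OF k(1)] nR[OF k(2)] using qi D[of i "Suc i"] iv by auto
  next
    fix i assume i: "u \<le> i" "Suc i < length ?R"
    then have k: "i < length r" "Suc i < length r" by auto
    show "?R!i < ?R!Suc i"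
    proof (cases "v \<le> i")
      case True
      then have "i \<noteq> p" "Suc i \<noteq> p" using pv by auto
      moreover have "Suc i = q \<Longrightarrow> r!i < r!p" using lo[of i] True pv by auto
      ultimately show ?thesis unfolding nR[OF k(1)] nR[OF k(2)] using e k U[of i "Suc i"] True by auto
    next
      case False
      then have "Suc i = v" and c: "(Suc p = v \<and> (q = v \<or> y < r!v)) \<or> (Suc p \<noteq> v \<and> q = v)"
        using i(1) pv unfolding u_def by (auto split: if_splits)
      then show ?thesis unfolding nR[OF k(1)] nR[OF k(2)] using pv vq D[of p i] yc by auto
    qed
  qed
  then show "\<exists>u. vee ?R u" by blast
  \<comment> \<open>\<open>upper_cond\<close> at \<open>i = q\<close> applies: either the row ends
    there, or \<open>j = p\<close> gives \<open>y < r!p <= r!Suc q\<close>.\<close>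
  have qq: "q \<le> length S \<Longrightarrow> y \<le> S!(q - 1)"
    using quy vq pv ce yc unfolding upper_cond_def by (metis linorder_neqE_nat not_less_eq qk)
  show "ok ?R S"
  proof (rule okI)
    show "length S < length ?R" using oL by simp
    show "S!j < ?R!0" if "j < length S" for j
      using that oA[of j] sB pv vq vk by (cases "p = 0"; cases "r = []") (auto simp: strictB_def nth_list_update)
    show False if h: "i < j" "j < length S" "?R!Suc i \<le> S!j" "S!j < S!i" for i j
    proof -
      have k: "Suc i < length r" using h oL by auto
      consider "Suc i = q" | "Suc i = p" "Suc i \<noteq> q" | "Suc i \<noteq> q" "Suc i \<noteq> p" by blast
      then show False
      proof cases
        case 1 then show False using h(3,4) oB[OF h(1,2)] ac nR[OF k] by auto
      next
        case 2 then show False using h sB nR[OF k] unfolding strictB_def by fastforce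
      next
        case 3 then show False using h(3,4) oB[OF h(1,2)] nR[OF k] by auto
      qed
    qed
    show "?R!j < S!j" if h: "j < length S" "?R!j < ?R!Suc j" for j
    proof -
      have k: "j < length r" "Suc j < length r" using h oL by auto
      note h2 = h(2)[unfolded nR[OF k(1)] nR[OF k(2)]]
      consider "j = q" | "j = p" | "Suc j = p" | "Suc j = q" "j \<noteq> p" | "j \<noteq> q" "j \<noteq> p" "Suc j \<noteq> p" "Suc j \<noteq> q" by blast
      then have "(if j = q then r!p else if j = p then y else r!j) < S!j"
      proof cases
        case 1 then show ?thesis using es h by auto
      next
        case 2
        then show ?thesis
        proof (cases "Suc p < v")
          case True
          then show ?thesis using 2 h2 s1 vq pv by (auto split: if_splits)
        next
          case False
          then have "Suc p = v" using pv by simp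
          then show ?thesis using 2 h2 s3 h(1) pv vq by (auto split: if_splits)
        qed
      next
        case 3 then show ?thesis using h2 pre[of j] yc pv vq by (auto split: if_splits)
      next
        case 4
        show ?thesis
        proof (cases "v \<le> j")
          case True
          then show ?thesis using 4 lo2[of j] oC[of j] h pv by auto
        next
          case False
          then have "j = v - 1" "q = v" using 4 vq by auto
          then show ?thesis using 4 mid'[of j] qq pv vq h by force
        qed
      next
        case 5 then show ?thesis using h2 oC[OF h(1)] by auto
      qed
      then show ?thesis unfolding nR[OF k(1)] .
    qed
    show "?R!i \<le> S!j" if h: "i \<le> j" "j < length S" "?R!i \<le> ?R!Suc j" for i j
    proof -
      have k: "i < length r" "Suc j < length r" using h oL by auto
      note h2 = h(3)[unfolded nR[OF k(1)] nR[OF k(2)]]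
      have "(if i = q then r!p else if i = p then y else r!i) \<le> S!j"
      proof (cases "q \<le> j")
        case True
        then have "r!p \<le> S!j" using S_hi h by auto
        then show ?thesis using h h2 oD[of i j] True yc pv vq by (auto split: if_splits)
      next
        case False
        then have iq: "i \<noteq> q" using h by auto
        show ?thesis
        proof (cases "Suc j = q")
          case True
          have sj: "y \<le> S!j" using qq True h by auto
          have "r!i \<le> S!j" if "i \<noteq> p"
          proof (cases "i < v")
            case True
            then show ?thesis using that h2 pre[of i] mid[of i] sj iq \<open>Suc j = q\<close> by (auto split: if_splits) (metis linorder_neqE_nat not_le order.trans)
          next
            case False
            then show ?thesis using oD[of i j] lo2[of i] h \<open>Suc j = q\<close> by auto
          qed
          then show ?thesis using sj iq by auto
        next
          case nq: False
          show ?thesis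
          proof (cases "i = p")
            case True
            have "v \<le> Suc j" using h2 True h nq iq mid'[of "Suc j"] pv by (auto split: if_splits) (meson not_le not_less_eq_eq)
            moreover have "y \<le> r!Suc j" using h2 True nq iq h by (auto split: if_splits)
            ultimately show ?thesis using quy h True iq unfolding upper_cond_def by fastforce
          next
            case False
            then show ?thesis using h h2 iq nq oD[of i j] pre[of i] yc by (auto split: if_splits)
          qed
        qed
      qed
      then show ?thesis unfolding nR[OF k(1)] .
    qed
  qed
qed

text \<open>The case in which the inserted letter already stood at \<open>q\<close>, so that only
  \<open>p\<close> is restored and position \<open>v\<close> keeps its entry
  \<open>r!v\<close>.\<close>

lemma replace_left_ok:
  assumes quy: "upper_cond r v S y" and st: "strict r v S p (r!v) y"
  shows "\<exists>u. vee (r[p := y]) u" "ok (r[p := y]) S"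
proof -
  let ?R = "r[p := y]"
  have nR: "\<And>i. i < length r \<Longrightarrow> ?R!i = (if i = p then y else r!i)"
    by (simp add: nth_list_update)
  have s1: "Suc p < v \<Longrightarrow> r!Suc p < y" and s2: "Suc p = v \<Longrightarrow> y \<noteq> r!v"
    and s3: "Suc p = v \<Longrightarrow> v \<le> length S \<Longrightarrow> y < r!v \<Longrightarrow> y < S!p"
    and sB: "strictB S p y"
    using st pv by (auto simp: strict_def)
  have mid': "p < i \<Longrightarrow> i < v \<Longrightarrow> r!i < y" for i using s1 D[of "Suc p" i] by (cases "i = Suc p") auto
  have vk: "v < length r" using vq qk by simp
  define u where "u = (if Suc p = v \<and> y < r!v then p else v)"
  have "vee ?R u"
  proof (rule veeI)
    show "u < length ?R" using pv vk by (auto simp: u_def)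
  next
    fix i assume i: "i < u"
    then have iv: "i < v" using pv unfolding u_def by (auto split: if_splits)
    have k: "i < length r" "Suc i < length r" using iv vk by auto
    have "i = p \<Longrightarrow> r!Suc i < y" using i s1 s2 pv unfolding u_def by (cases "Suc p = v") (auto split: if_splits)
    moreover have "Suc i = p \<Longrightarrow> y < r!i" using pre[of i] yc by auto
    ultimately show "?R!Suc i < ?R!i" unfolding nR[OF k(1)] nR[OF k(2)] using D[of i "Suc i"] iv by auto
  next
    fix i assume i: "u \<le> i" "Suc i < length ?R"
    then have k: "i < length r" "Suc i < length r" by auto
    show "?R!i < ?R!Suc i"
    proof (cases "v \<le> i")
      case True
      then show ?thesis unfolding nR[OF k(1)] nR[OF k(2)] using k U[of i "Suc i"] pv by auto
    next
      case False
      then have "Suc i = v" and c: "Suc p = v \<and> y < r!v"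
        using i(1) pv unfolding u_def by (auto split: if_splits)
      then show ?thesis unfolding nR[OF k(1)] nR[OF k(2)] by auto
    qed
  qed
  then show "\<exists>u. vee ?R u" by blast
  show "ok ?R S"
  proof (rule okI)
    show "length S < length ?R" using oL by simp
    show "S!j < ?R!0" if "j < length S" for j
      using that oA[of j] sB pv vk by (cases "p = 0"; cases "r = []") (auto simp: strictB_def nth_list_update)
    show False if h: "i < j" "j < length S" "?R!Suc i \<le> S!j" "S!j < S!i" for i j
    proof -
      have k: "Suc i < length r" using h oL by auto
      show False
      proof (cases "Suc i = p")
        case True then show False using h sB nR[OF k] unfolding strictB_def by fastforce
      next
        case False then show False using h(3,4) oB[OF h(1,2)] nR[OF k] by auto
      qed
    qed
    show "?R!j < S!j" if h: "j < length S" "?R!j < ?R!Suc j" for j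
    proof -
      have k: "j < length r" "Suc j < length r" using h oL by auto
      note h2 = h(2)[unfolded nR[OF k(1)] nR[OF k(2)]]
      consider "j = p" "Suc p < v" | "j = p" "Suc p = v" | "Suc j = p" | "j \<noteq> p" "Suc j \<noteq> p" using pv by linarith
      then have "(if j = p then y else r!j) < S!j"
      proof cases
        case 1 then show ?thesis using h2 s1 by (auto split: if_splits)
      next
        case 2 then show ?thesis using h2 s3 h(1) by (auto split: if_splits)
      next
        case 3 then show ?thesis using h2 pre[of j] yc by (auto split: if_splits)
      next
        case 4 then show ?thesis using h2 oC[OF h(1)] by auto
      qed
      then show ?thesis unfolding nR[OF k(1)] .
    qed
    show "?R!i \<le> S!j" if h: "i \<le> j" "j < length S" "?R!i \<le> ?R!Suc j" for i j
    proof -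
      have k: "i < length r" "Suc j < length r" using h oL by auto
      note h2 = h(3)[unfolded nR[OF k(1)] nR[OF k(2)]]
      have "(if i = p then y else r!i) \<le> S!j"
      proof (cases "i = p")
        case True
        have "v \<le> Suc j" using h2 True h mid'[of "Suc j"] pv by (auto split: if_splits) (meson not_le not_less_eq_eq)
        moreover have "y \<le> r!Suc j" using h2 True h by (auto split: if_splits)
        ultimately show ?thesis using quy h True unfolding upper_cond_def by fastforce
      next
        case False
        then show ?thesis using h h2 oD[of i j] pre[of i] yc by (auto split: if_splits)
      qed
      then show ?thesis unfolding nR[OF k(1)] .
    qed
  qed
qed

end

text \<open>The case in which \<open>y\<close> left no cell. The value \<open>r!p\<close> then
  occurs on both sides of the valley, so \<open>p\<close> and \<open>q\<close> must not be adjacent,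
  and (iv) between the two copies is the bound on \<open>S!(q - 1)\<close>.\<close>

lemma replace_right_ok:
  assumes lt: "below_next r S q (r!p)" and le: "q \<le> length S \<Longrightarrow> r!p \<le> S!(q - 1)"
    and nk: "\<not> (Suc p = v \<and> q = v)"
  shows "\<exists>u. vee (r[q := r!p]) u" "ok (r[q := r!p]) S"
proof -
  let ?R = "r[q := r!p]"
  have nR: "\<And>i. i < length r \<Longrightarrow> ?R!i = (if i = q then r!p else r!i)"
    by (simp add: nth_list_update)
  have e: "Suc q < length r \<Longrightarrow> r!p < r!Suc q" and es: "q < length S \<Longrightarrow> r!p < S!q" using lt by (auto simp: below_next_def)
  have vk: "v < length r" using vq qk by simp
  define u where "u = (if q = v then v - 1 else v)"
  have "vee ?R u"
  proof (rule veeI)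
    show "u < length ?R" using vk by (auto simp: u_def)
  next
    fix i assume i: "i < u"
    then have iv: "i < v" "Suc i \<noteq> q" "i \<noteq> q" using vq unfolding u_def by (auto split: if_splits)
    have k: "i < length r" "Suc i < length r" using iv vk by auto
    show "?R!Suc i < ?R!i" unfolding nR[OF k(1)] nR[OF k(2)] using D[of i "Suc i"] iv by auto
  next
    fix i assume i: "u \<le> i" "Suc i < length ?R"
    then have k: "i < length r" "Suc i < length r" by auto
    show "?R!i < ?R!Suc i"
    proof (cases "v \<le> i")
      case True
      then show ?thesis unfolding nR[OF k(1)] nR[OF k(2)] using k U[of i "Suc i"] e lo[of i] pv by auto
    next
      case False
      then have "Suc i = v" "q = v"
        using i(1) unfolding u_def by (auto split: if_splits)
      then show ?thesis unfolding nR[OF k(1)] nR[OF k(2)] using lo[of i] nk pv by auto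
    qed
  qed
  then show "\<exists>u. vee ?R u" by blast
  show "ok ?R S"
  proof (rule okI)
    show "length S < length ?R" using oL by simp
    show "S!j < ?R!0" if "j < length S" for j
      using that oA[of j] pv vq nR[of 0] vk by auto
    show False if h: "i < j" "j < length S" "?R!Suc i \<le> S!j" "S!j < S!i" for i j
    proof -
      have k: "Suc i < length r" using h oL by auto
      show False using h(3,4) oB[OF h(1,2)] nR[OF k] ac by (auto split: if_splits)
    qed
    show "?R!j < S!j" if h: "j < length S" "?R!j < ?R!Suc j" for j
    proof -
      have k: "j < length r" "Suc j < length r" using h oL by auto
      note h2 = h(2)[unfolded nR[OF k(1)] nR[OF k(2)]]
      have "(if j = q then r!p else r!j) < S!j"
        using h2 h(1) es le oC[OF h(1)] by (cases "j = q"; cases "Suc j = q") auto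
      then show ?thesis unfolding nR[OF k(1)] .
    qed
    show "?R!i \<le> S!j" if h: "i \<le> j" "j < length S" "?R!i \<le> ?R!Suc j" for i j
    proof -
      have k: "i < length r" "Suc j < length r" using h oL by auto
      note h2 = h(3)[unfolded nR[OF k(1)] nR[OF k(2)]]
      have "(if i = q then r!p else r!i) \<le> S!j"
        using h2 h le oD[of i j] S_hi[of j] by (cases "i = q"; cases "Suc j = q") auto
      then show ?thesis unfolding nR[OF k(1)] .
    qed
  qed
qed

text \<open>For \<open>y1 < y2\<close>, \<open>lower_cond\<close> for \<open>y1\<close> leaves no
  entry of \<open>S\<close> that could violate \<open>strictB\<close> for \<open>y2\<close>. Hence
  \<open>y2\<close> is obstructed next to the valley, where \<open>upper_cond\<close> bounds it by
  \<open>S!p\<close>, and after that no obstruction is left for \<open>y1\<close>.\<close>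

lemma nonstrict_unique:
  assumes y: "y1 < r!p" "Suc p < v \<longrightarrow> r!Suc p \<le> y1" "upper_cond r v S y1" "lower_cond r v S y1" "\<not> strict r v S p uu y1"
    and y2: "y2 < r!p" "Suc p < v \<longrightarrow> r!Suc p \<le> y2" "upper_cond r v S y2" "lower_cond r v S y2" "\<not> strict r v S p uu y2"
    and lt: "y1 < y2"
  shows False
proof -
  have pb: "Suc p = v \<or> r!Suc p \<le> y1" using y(2) pv by auto
  \<comment> \<open>\<open>lower_cond\<close> at \<open>j = p\<close> would give
    \<open>S!(p - 1) <= S!i\<close>, because \<open>S\<close> has a descent into
    \<open>p\<close>.\<close>
  have nS: False if h: "i < length S" "p \<le> i" "y1 < S!i" "p = 0 \<or> S!i < S!(p - 1)" for i
  proof -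
    have *: "1 \<le> p" "p < length S \<and> S!p < S!(p - 1) \<longrightarrow> S!(p - 1) \<le> S!i"
      using y(4) pv pb h unfolding lower_cond_def by blast+
    then have "S!i < S!(p - 1)" using h by auto
    moreover have "p - 1 < i" using * h by linarith
    ultimately show False using * S_desc'[of "p - 1" i] h by auto
  qed
  have B2: "strictB S p y2"
    using nS lt unfolding strictB_def by (metis leI less_le_trans)
  have "\<not> Suc p < v" using y2(5) B2 y(2) lt unfolding strict_def by auto
  then have pv': "Suc p = v" using pv by simp
  have v1: "v - 1 = p" using pv' by simp
  have mv: "v < i \<Longrightarrow> i \<le> length S \<Longrightarrow> r!v < S!(i - 1)" for i
  proof -
    assume a: "v < i" "i \<le> length S"
    then obtain j where j: "i = Suc j" "v \<le> j" "j < length S" by (cases i) auto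
    then show ?thesis using oC[of j] U[of v j] U[of j "Suc j"] oL by (cases "j = v") auto
  qed
  have cases2: "y2 = uu \<or> (y2 < uu \<and> v \<le> length S \<and> S!p \<le> y2)"
    using y2(5) B2 pv' v1 unfolding strict_def by (auto simp: not_less)
  show False
  proof (cases "q = v \<and> below_next r S q (r!p)")
    case True
    have uu: "uu = r!p" by (rule if_P[OF True])
    then have c2: "v \<le> length S" "S!p \<le> y2" using cases2 y2(1) by auto
    have "y1 \<noteq> r!p" using y(1) by simp
    then have c1: "S!p \<le> y1 \<or> \<not> strictB S p y1"
      using y(5) pv' v1 uu unfolding strict_def by (auto simp: not_less)
    have q2: "y2 \<le> S!p"
      using y2(3) c2 True pv v1 ce y2(1) qk unfolding upper_cond_def by (metis Suc_lessI le_refl)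
    have "\<not> S!p \<le> y1" using q2 lt by simp
    then have "\<not> strictB S p y1" using c1 by simp
    then obtain i where i: "i < length S" "p \<le> i" "p = 0 \<or> S!i < S!(p - 1)" "y1 \<le> S!i" unfolding strictB_def by (auto simp: not_less)
    then have "S!i = y1" using nS[of i] by force
    then have ip: "p < i" "S!i < S!p" using i q2 lt by (auto simp: le_less)
    then have "Suc p < length S \<and> S!Suc p < S!p" using S_desc' i by auto
    then have "p = 0 \<or> S!p < S!(p - 1)" using S_desc[of "Suc p" "p - 1" p] by (cases p) auto
    then show False using nS[of p] ip i lt q2 by auto
  next
    case False
    then have uu: "uu = r!v" by auto
    have low: "y1 < r!v" using cases2 uu lt by auto
    have c1: "(v \<le> length S \<and> S!p \<le> y1) \<or> \<not> strictB S p y1"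
      using y(5) pv' v1 uu low unfolding strict_def by (auto simp: not_less)
    have q2: "v \<le> length S \<Longrightarrow> y2 \<le> S!p"
      using y2(3) cases2 uu v1 unfolding upper_cond_def by auto
    then have "\<not> strictB S p y1" using c1 lt by auto
    then obtain i where i: "i < length S" "p \<le> i" "p = 0 \<or> S!i < S!(p - 1)" "y1 \<le> S!i" unfolding strictB_def by (auto simp: not_less)
    then have "S!i = y1" using nS[of i] by force
    then show False using i q2 lt mv[of "Suc i"] low pv' by (cases "i = p") auto
  qed
qed

end

section \<open>From the row before a bump to its bump frame\<close>

lemma replace_both_conv:
  fixes R S u p q a
  defines "r \<equiv> R[p := R!q, q := a]" and "y \<equiv> R!p"
  assumes vR: "vee R u" and vs: "S = [] \<or> (\<exists>w. vee S w)" and okR: "ok R S"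
    and uq: "u < q" and qk: "q < length R" and pu: "p \<le> u" and aq: "a < R!q"
    and pc: "R!p < R!q" and pc': "0 < p \<Longrightarrow> R!q < R!(p - 1)"
    and hq: "Suc u < q \<Longrightarrow> R!(q - 1) < a" and hm: "q = Suc u \<Longrightarrow> a \<noteq> R!u \<or> p = u"
  shows "\<exists>v. bump_frame r S v p q \<and> y < r!p \<and> (Suc p < v \<longrightarrow> r!Suc p \<le> y) \<and> upper_cond r v S y \<and> lower_cond r v S y
     \<and> below_next r S q (r!p) \<and> strict r v S p (if q = v \<and> below_next r S q (r!p) then r!p else r!v) y"
proof -
  note D = veeD(2)[OF vR] and U = veeD(3)[OF vR]
  note oL = okD(1)[OF okR] and oA = okD(2)[OF okR] and oB = okD(3)[OF okR] and oC = okD(4)[OF okR] and oD = okD(5)[OF okR]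
  have pq: "p < q" using pu uq by simp
  have len: "length r = length R" by (simp add: r_def)
  have nr: "i < length R \<Longrightarrow> r!i = (if i = q then a else if i = p then R!q else R!i)" for i
    by (simp add: r_def nth_list_update)
  have rp: "r!p = R!q" and rq: "r!q = a" using nr pq qk by auto
  have low: "p < x \<Longrightarrow> x < q \<Longrightarrow> R!x < R!q" for x
    using D[of p x] U[of x q] pc qk by (cases "x \<le> u") (auto intro: less_trans)
  have pre: "i < p \<Longrightarrow> R!q < R!i" for i
    using pc' D[of i "p - 1"] pu by (cases "i = p - 1") (auto intro: less_trans)
  have hi: "q < i \<Longrightarrow> i < length R \<Longrightarrow> R!q < R!i" for i using U[of q i] uq by auto
  have Shi: "q \<le> j \<Longrightarrow> j < length S \<Longrightarrow> R!q < S!j" for j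
    using oC[of j] U[of j "Suc j"] hi[of j] uq oL by (cases "j = q") auto
  \<comment> \<open>The valley moves right if the large \<open>R!q\<close> enters at the old valley,
    or if \<open>a\<close> lands directly after the old valley and is smaller than it.\<close>
  define v where "v = (if p = u \<or> (q = Suc u \<and> a < R!u) then Suc u else u)"
  have pv: "p < v" and vq: "v \<le> q" using pu uq by (auto simp: v_def)
  have vr: "vee r v"
  proof (rule veeI)
    show "v < length r" using vq qk len by simp
  next
    fix i assume i: "i < v"
    then have iu: "i \<le> u" by (auto simp: v_def split: if_splits)
    have k: "i < length R" "Suc i < length R" using i vq qk by auto
    have q: "i \<noteq> q" using iu uq by simp
    show "r!Suc i < r!i"
    proof (cases "Suc i = q")
      case True
      then have "q = Suc u" "i = u" using iu uq by auto
      then have "p = u \<or> a < R!u" using i by (auto simp: v_def split: if_splits)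
      then show ?thesis using nr[OF k(1)] nr[OF k(2)] True q aq \<open>i = u\<close> by auto
    next
      case False
      have "Suc i \<le> u \<or> i = p" using i False iu by (auto simp: v_def split: if_splits)
      then show ?thesis
        using nr[OF k(1)] nr[OF k(2)] False q D[of i "Suc i"] low[of "Suc i"] pre[of i] iu uq by auto
    qed
  next
    fix i assume i: "v \<le> i" "Suc i < length r"
    have k: "i < length R" "Suc i < length R" using i len by auto
    have ip: "i \<noteq> p" "Suc i \<noteq> p" using i pv by auto
    have iu: "u \<le> i" using i by (auto simp: v_def split: if_splits)
    have "Suc i = q \<Longrightarrow> R!i < a" using hq hm i iu ip by (cases "i = u") (auto simp: v_def split: if_splits)
    then show "r!i < r!Suc i" using nr[OF k(1)] nr[OF k(2)] ip aq U[of i "Suc i"] iu k by auto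
  qed
  have okr: "ok r S"
  proof (rule okI)
    show "length S < length r" using oL len by simp
    show "S!j < r!0" if "j < length S" for j
      using that oA[of j] nr[of 0] pq qk pc by (cases "p = 0"; cases "R = []") auto
    show False if h: "i < j" "j < length S" "r!Suc i \<le> S!j" "S!j < S!i" for i j
    proof -
      have k: "Suc i < length R" using h oL by auto
      have "Suc i = q \<Longrightarrow> R!Suc i \<le> S!j" using Shi[of j] h by auto
      moreover have "Suc i = p \<Longrightarrow> R!Suc i \<le> S!j" using h nr[OF k] pc pq by auto
      ultimately have "R!Suc i \<le> S!j" using h nr[OF k] by (auto split: if_splits)
      then show False using oB h by fastforce
    qed
    show "r!j < S!j" if h: "j < length S" "r!j < r!Suc j" for j
    proof -
      have k: "j < length R" "Suc j < length R" using h oL by auto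
      have "j \<noteq> p" using h nr[OF k(1)] nr[OF k(2)] pq aq low[of "Suc j"] by (auto split: if_splits)
      then show ?thesis using h nr[OF k(1)] nr[OF k(2)] Shi[of j] aq oC[of j] pre[of j] by (auto split: if_splits)
    qed
    show "r!i \<le> S!j" if h: "i \<le> j" "j < length S" "r!i \<le> r!Suc j" for i j
    proof -
      have k: "i < length R" "Suc j < length R" using h oL by auto
      show ?thesis
      proof (cases "q \<le> j")
        case True
        then show ?thesis using h nr[OF k(1)] nr[OF k(2)] Shi[of j] aq oD[of i j] by (auto split: if_splits)
      next
        case False
        then have "i \<noteq> q" using h by auto
        moreover have "i \<noteq> p" using h nr[OF k(1)] nr[OF k(2)] False pq aq low[of "Suc j"] by (auto split: if_splits)
        ultimately show ?thesis using h nr[OF k(1)] nr[OF k(2)] oD[of i j] aq pre[of i] by (auto split: if_splits)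
      qed
    qed
  qed
  have midR: "p < j \<Longrightarrow> j < v \<Longrightarrow> r!j < y" for j
    using D[of p j] nr[of j] vq qk by (auto simp: v_def y_def split: if_splits)
  have fr: "bump_frame r S v p q"
    by standard (use vr vs okr pv vq qk len rp rq aq hi[of "Suc q"] nr[of "Suc q"] pq in auto)
  have ypc: "y < r!p" using rp pc by (simp add: y_def)
  have lt: "below_next r S q (r!p)" unfolding below_next_def using rp hi[of "Suc q"] nr[of "Suc q"] Shi[of q] len pq by auto
  have quy: "upper_cond r v S y" unfolding upper_cond_def
  proof (intro allI impI)
    fix i assume h: "v \<le> i \<and> i \<le> length S \<and> (y \<le> r!i \<or> Suc i = length r \<or> (\<exists>j<v. y < r!j \<and> r!j \<le> r!Suc i))"
    have i0: "p < i" "i < length R" "0 < i" using h pv oL by auto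
    have "y \<le> R!i"
    proof (cases "q \<le> i")
      case True
      then show ?thesis using hi[of i] i0 pc by (cases "i = q") (auto simp: y_def)
    next
      case False
      have "r!i = R!i" using nr[of i] i0 False by auto
      moreover have "Suc i \<noteq> length r" using False qk len by auto
      \<comment> \<open>Left of \<open>q\<close> only the first alternative of
        \<open>upper_cond\<close> can hold: entries before the valley above \<open>y\<close> are at
        least \<open>R!q\<close>, while \<open>r!Suc i\<close> is smaller.\<close>
      moreover have "\<not> (\<exists>j<v. y < r!j \<and> r!j \<le> r!Suc i)"
      proof
        assume "\<exists>j<v. y < r!j \<and> r!j \<le> r!Suc i"
        then obtain j where j: "j < v" "y < r!j" "r!j \<le> r!Suc i" by blast
        then have "j \<le> p" using midR[of j] by (meson not_le less_asym)
        then have "R!q \<le> r!j" using rp nr[of j] pre[of j] pq qk by (cases "j = p") auto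
        moreover have "r!Suc i < R!q" using nr[of "Suc i"] low[of "Suc i"] i0 False qk aq by (auto split: if_splits)
        ultimately show False using j by auto
      qed
      ultimately show ?thesis using h by auto
    qed
    then show "y \<le> S!(i - 1)" using oD[of p "i - 1"] i0 h by (auto simp: y_def)
  qed
  have qby: "lower_cond r v S y" unfolding y_def
  proof (rule lower_cond_of_ok[OF vs okR])
    fix j assume j: "j < v" "Suc j = v \<or> r!Suc j \<le> R!p"
    show "p \<le> j"
    proof (rule ccontr)
      assume "\<not> p \<le> j"
      then have "Suc j \<le> p" by simp
      then have "R!q \<le> r!Suc j" using rp nr[of "Suc j"] pre[of "Suc j"] pq qk by (cases "Suc j = p") auto
      then show False using j pc \<open>Suc j \<le> p\<close> pv by auto
    qed
  qed
  have st: "strict r v S p (if q = v \<and> below_next r S q (r!p) then r!p else r!v) y"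
    unfolding strict_def
  proof (intro conjI impI)
    show "Suc p < v \<Longrightarrow> r!Suc p < y" using midR by auto
    show "strictB S p y" unfolding y_def by (rule strictB_of_ok[OF okR])
  next
    assume s: "Suc p = v"
    have e: "(if q = v \<and> below_next r S q (r!p) then r!p else r!v) = R!Suc p"
      using s lt rp nr[of v] vq qk pv by auto
    have ne: "R!p \<noteq> R!Suc p" using D[of p "Suc p"] U[of p "Suc p"] pu pq qk by (cases "p = u") auto
    show "y \<noteq> (if q = v \<and> below_next r S q (r!p) then r!p else r!v)" using e ne by (simp add: y_def)
    assume "y < (if q = v \<and> below_next r S q (r!p) then r!p else r!v) \<and> v \<le> length S"
    then show "y < S!(v - 1)" using e oC[of p] s by (auto simp: y_def)
  qed
  show ?thesis using fr ypc midR[of "Suc p"] quy qby lt st by (intro exI[of _ v]) auto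
qed

text \<open>The letter \<open>a = R!q\<close> is in the row already and stays there. In a frame
  \<open>r!p\<close> is at most \<open>r!Suc q\<close> and, by \<open>S_hi\<close>, at most
  \<open>S!q\<close>; if \<open>below_next\<close> fails, the only value left for it is their
  minimum \<open>E\<close>.\<close>

lemma replace_left_conv:
  fixes R S u p q
  defines "E \<equiv> (if q < length S then min (R!Suc q) (S!q) else R!Suc q)"
  defines "r \<equiv> R[p := E]" and "y \<equiv> R!p"
  assumes vR: "vee R u" and vs: "S = [] \<or> (\<exists>w. vee S w)" and okR: "ok R S"
    and uq: "u \<le> q" and qk: "Suc q < length R" and pu: "p \<le> u" and pq: "p < q"
    and pc: "R!p < E" and pc': "0 < p \<Longrightarrow> R!Suc q < R!(p - 1)"
    and le: "q \<le> length S \<Longrightarrow> R!p \<le> S!(q - 1)"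
  shows "\<exists>v. bump_frame r S v p q \<and> y < r!p \<and> (Suc p < v \<longrightarrow> r!Suc p \<le> y) \<and> upper_cond r v S y \<and> lower_cond r v S y
     \<and> \<not> below_next r S q (r!p) \<and> strict r v S p (r!v) y"
proof -
  note D = veeD(2)[OF vR] and U = veeD(3)[OF vR]
  note oL = okD(1)[OF okR] and oA = okD(2)[OF okR] and oB = okD(3)[OF okR] and oC = okD(4)[OF okR] and oD = okD(5)[OF okR]
  have len: "length r = length R" by (simp add: r_def)
  have nr: "i < length R \<Longrightarrow> r!i = (if i = p then E else R!i)" for i
    by (simp add: r_def nth_list_update)
  have rp: "r!p = E" using nr pq qk by auto
  have Ee: "E \<le> R!Suc q" by (auto simp: E_def)
  have aE: "R!q < E" using oC[of q] U[of q "Suc q"] uq qk by (auto simp: E_def)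
  have low: "p < x \<Longrightarrow> x \<le> q \<Longrightarrow> R!x < E" for x
    using D[of p x] U[of x q] pc aE qk uq by (cases "x \<le> u"; cases "x = q") (auto intro: less_trans)
  have pre: "i < p \<Longrightarrow> R!Suc q < R!i" for i
    using pc' D[of i "p - 1"] pu by (cases "i = p - 1") (auto intro: less_trans)
  have hi: "q < i \<Longrightarrow> i < length R \<Longrightarrow> E \<le> R!i" for i
    using U[of "Suc q" i] uq Ee by (cases "i = Suc q") (auto intro: order_trans less_imp_le)
  have Shi: "q \<le> j \<Longrightarrow> j < length S \<Longrightarrow> E \<le> S!j" for j
    using oC[of j] U[of j "Suc j"] hi[of j] uq oL by (cases "j = q") (auto simp: E_def)
  define v where "v = (if p = u then Suc u else u)"
  have pv: "p < v" and vq: "v \<le> q" using pu uq pq by (auto simp: v_def)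
  have qk': "q < length R" using qk by simp
  have vr: "vee r v"
  proof (rule veeI)
    show "v < length r" using vq qk len by simp
  next
    fix i assume i: "i < v"
    then have iu: "i \<le> u" by (auto simp: v_def split: if_splits)
    have k: "i < length R" "Suc i < length R" using i vq qk by auto
    have "Suc i \<le> u \<or> i = p" using i iu by (auto simp: v_def split: if_splits)
    then show "r!Suc i < r!i"
      using nr[OF k(1)] nr[OF k(2)] D[of i "Suc i"] low[of "Suc i"] pre[of i] iu uq Ee pq by (auto split: if_splits)
  next
    fix i assume i: "v \<le> i" "Suc i < length r"
    have k: "i < length R" "Suc i < length R" using i len by auto
    have ip: "i \<noteq> p" "Suc i \<noteq> p" using i pv by auto
    have iu: "u \<le> i" using i by (auto simp: v_def split: if_splits)
    then show "r!i < r!Suc i" using nr[OF k(1)] nr[OF k(2)] ip U[of i "Suc i"] iu k by auto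
  qed
  have okr: "ok r S"
  proof (rule okI)
    show "length S < length r" using oL len by simp
    show "S!j < r!0" if "j < length S" for j
      using that oA[of j] nr[of 0] pq qk pc by (cases "p = 0"; cases "R = []") auto
    show False if h: "i < j" "j < length S" "r!Suc i \<le> S!j" "S!j < S!i" for i j
    proof -
      have k: "Suc i < length R" using h oL by auto
      have "R!Suc i \<le> S!j" using h nr[OF k] pc by (auto split: if_splits)
      then show False using oB h by fastforce
    qed
    show "r!j < S!j" if h: "j < length S" "r!j < r!Suc j" for j
    proof -
      have k: "j < length R" "Suc j < length R" using h oL by auto
      have "j \<noteq> p" using h nr[OF k(1)] nr[OF k(2)] pq low[of "Suc j"] by auto
      then show ?thesis using h nr[OF k(1)] nr[OF k(2)] oC[of j] pre[of j] Ee by (auto split: if_splits)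
    qed
    show "r!i \<le> S!j" if h: "i \<le> j" "j < length S" "r!i \<le> r!Suc j" for i j
    proof -
      have k: "i < length R" "Suc j < length R" using h oL by auto
      show ?thesis
      proof (cases "i = p")
        case True
        have "q \<le> j"
        proof (rule ccontr)
          assume "\<not> q \<le> j"
          then show False using True h nr[OF k(1)] nr[OF k(2)] low[of "Suc j"] by auto
        qed
        then show ?thesis using Shi[of j] h True nr[OF k(1)] by auto
      next
        case False
        then show ?thesis using h nr[OF k(1)] nr[OF k(2)] oD[of i j] pre[of i] Ee by (auto split: if_splits)
      qed
    qed
  qed
  have midR: "p < j \<Longrightarrow> j < v \<Longrightarrow> r!j < y" for j
    using D[of p j] nr[of j] vq qk by (auto simp: v_def y_def split: if_splits)
  have rq: "r!q = R!q" using nr pq qk by auto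
  have fr: "bump_frame r S v p q"
    by standard (use vr vs okr pv vq qk' len rp rq aE Ee nr[of "Suc q"] pq in auto)
  have ypc: "y < r!p" using rp pc by (simp add: y_def)
  have lt: "\<not> below_next r S q (r!p)" unfolding below_next_def using rp nr[of "Suc q"] len pq qk by (auto simp: E_def min_def)
  have quy: "upper_cond r v S y" unfolding upper_cond_def
  proof (intro allI impI)
    fix i assume h: "v \<le> i \<and> i \<le> length S \<and> (y \<le> r!i \<or> Suc i = length r \<or> (\<exists>j<v. y < r!j \<and> r!j \<le> r!Suc i))"
    have i0: "p < i" "i < length R" "0 < i" using h pv oL by auto
    have "y \<le> R!i \<or> i = q"
    proof (cases "q \<le> i")
      case True
      then show ?thesis using hi[of i] i0 pc by (cases "i = q") (auto simp: y_def)
    next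
      case False
      have "r!i = R!i" using nr[of i] i0 False by auto
      moreover have "Suc i \<noteq> length r" using False qk len by auto
      moreover have "\<not> (\<exists>j<v. y < r!j \<and> r!j \<le> r!Suc i)"
      proof
        assume "\<exists>j<v. y < r!j \<and> r!j \<le> r!Suc i"
        then obtain j where j: "j < v" "y < r!j" "r!j \<le> r!Suc i" by blast
        then have "j \<le> p" using midR[of j] by (meson not_le less_asym)
        then have "E \<le> r!j" using rp nr[of j] pre[of j] pq qk Ee by (cases "j = p") auto
        moreover have "r!Suc i < E" using nr[of "Suc i"] low[of "Suc i"] i0 False qk by (auto split: if_splits)
        ultimately show False using j by auto
      qed
      ultimately show ?thesis using h by auto
    qed
    then show "y \<le> S!(i - 1)" using oD[of p "i - 1"] i0 h le by (auto simp: y_def)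
  qed
  have qby: "lower_cond r v S y" unfolding y_def
  proof (rule lower_cond_of_ok[OF vs okR])
    fix j assume j: "j < v" "Suc j = v \<or> r!Suc j \<le> R!p"
    show "p \<le> j"
    proof (rule ccontr)
      assume "\<not> p \<le> j"
      then have "Suc j \<le> p" by simp
      then have "E \<le> r!Suc j" using rp nr[of "Suc j"] pre[of "Suc j"] pq qk Ee by (cases "Suc j = p") auto
      then show False using j pc \<open>Suc j \<le> p\<close> pv by auto
    qed
  qed
  have st: "strict r v S p (r!v) y"
    unfolding strict_def
  proof (intro conjI impI)
    show "Suc p < v \<Longrightarrow> r!Suc p < y" using midR by auto
    show "strictB S p y" unfolding y_def by (rule strictB_of_ok[OF okR])
  next
    assume s: "Suc p = v"
    have e: "r!v = R!Suc p" using s nr[of v] vq qk pv by auto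
    have ne: "R!p \<noteq> R!Suc p" using D[of p "Suc p"] U[of p "Suc p"] pu pq qk by (cases "p = u") auto
    show "y \<noteq> r!v" using e ne by (simp add: y_def)
    assume "y < r!v \<and> v \<le> length S"
    then show "y < S!(v - 1)" using e oC[of p] s by (auto simp: y_def)
  qed
  show ?thesis using fr ypc midR[of "Suc p"] quy qby lt st by (intro exI[of _ v]) auto
qed

section \<open>Existence of a non-strict letter\<close>

context bump_frame
begin

text \<open>The witness is the largest obstruction: the maximum of the entries that can violate
  \<open>strictB\<close>, or a value next to the valley. Being an obstruction makes it non-strict;
  being at least all of \<open>H\<close> gives \<open>lower_cond\<close>.\<close>

lemma nonstrict_exists:
  assumes room: "\<And>i. q \<le> length S \<Longrightarrow> Suc p < v \<Longrightarrow> r!Suc p \<le> S!(q - 1)"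
    and room3: "Suc p = v \<Longrightarrow> q = v \<Longrightarrow> below_next r S q (r!p) \<Longrightarrow> v \<le> length S \<and> S!(v - 1) < r!p"
  shows "\<exists>y. y < r!p \<and> (Suc p < v \<longrightarrow> r!Suc p \<le> y) \<and> upper_cond r v S y \<and> lower_cond r v S y \<and> \<not> strict r v S p uu y"
proof -
  \<comment> \<open>\<open>strictB S p y\<close> says exactly that all of \<open>H\<close> lies
    below \<open>y\<close>.\<close>
  define H where "H = {S!i | i. i < length S \<and> p \<le> i \<and> (p = 0 \<or> S!i < S!(p - 1))}"
  have Hf: "finite H" unfolding H_def by auto
  have Hc: "h < r!p" if hH: "h \<in> H" for h
  proof -
    obtain i where i: "h = S!i" "i < length S" "p \<le> i" "p = 0 \<or> S!i < S!(p - 1)" using hH unfolding H_def by blast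
    show ?thesis
    proof (cases "p = 0")
      case True then show ?thesis using oA i by auto
    next
      case False
      then have "p - 1 < i" "Suc (p - 1) = p" using i by linarith+
      then show ?thesis using oB[of "p - 1" i] i False by (metis leD leI)
    qed
  qed
  have mv: "r!v < S!i" if "v \<le> i" "i < length S" for i
    using that oC[of i] U[of v i] U[of i "Suc i"] oL by (cases "i = v") auto
  have Sasc: "S!i < S!j" if ij: "v \<le> i" "i < j" "j < length S" for i j
  proof -
    obtain w where w: "vee S w" using vs ij by force
    have "w \<le> v"
    proof (rule ccontr)
      assume n: "\<not> w \<le> v"
      then have "S!Suc v < S!v" "Suc v < length S" using veeD(1)[OF w] veeD(2)[OF w, of v "Suc v"] by auto
      moreover have "r!Suc v < S!Suc v" using oC[of "Suc v"] U[of "Suc v" "Suc (Suc v)"] oL calculation by auto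
      ultimately show False using oB[of v "Suc v"] by auto
    qed
    then show ?thesis using veeD(3)[OF w, of i j] ij by auto
  qed
  have qbH: "lower_cond r v S y" if y: "y < r!p" "\<And>h. h \<in> H \<Longrightarrow> h \<le> y" for y
    unfolding lower_cond_def
  proof (intro allI impI)
    fix j i assume h: "j < v \<and> (Suc j = v \<or> r!Suc j \<le> y) \<and> i < length S \<and> y < S!i"
    have "p \<le> j"
    proof (rule ccontr)
      assume "\<not> p \<le> j"
      then have "r!p \<le> r!Suc j" "Suc j \<noteq> v" using pre[of "Suc j"] pv by (cases "Suc j = p", auto)
      then show False using h y by auto
    qed
    have nH: "S!i \<notin> H" using y(2) h by fastforce
    then have p0: "p \<noteq> 0" and *: "p \<le> i \<Longrightarrow> S!(p - 1) \<le> S!i" using h unfolding H_def by (auto simp: not_less)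
    have "S!(j - 1) \<le> S!i" if d: "j < length S" "S!j < S!(j - 1)"
    proof -
      have "p - 1 < j - 1 \<or> p = j" using \<open>p \<le> j\<close> p0 by linarith
      then have "S!(j - 1) \<le> S!(p - 1)" using S_desc[OF d, of "p - 1" "j - 1"] by auto
      moreover have "S!(p - 1) \<le> S!i"
      proof (cases "p \<le> i")
        case False
        then have "i < p - 1 \<or> i = p - 1" by linarith
        moreover have "p - 1 \<le> j" using \<open>p \<le> j\<close> by linarith
        ultimately show ?thesis using S_desc[OF d, of i "p - 1"] by auto
      qed (use * in auto)
      ultimately show ?thesis by auto
    qed
    then show "1 \<le> j \<and> (j < length S \<and> S!j < S!(j - 1) \<longrightarrow> S!(j - 1) \<le> S!i)" using p0 \<open>p \<le> j\<close> by auto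
  qed
  have HB: "h \<in> H \<Longrightarrow> \<not> strictB S p h" for h unfolding H_def strictB_def by auto
  have Hex: "\<exists>h\<in>H. \<forall>h'\<in>H. h' \<le> h" if "H \<noteq> {}" using Hf that by (meson Max_ge Max_in)
  have big: "r!j \<ge> r!p" if "j < v" "y < r!j" "Suc p < v \<longrightarrow> r!Suc p \<le> y" for j y
    using that pre[of j] D[of "Suc p" j] by (cases "j < p"; cases "j = p"; cases "j = Suc p") auto
  have late: "q \<le> i" if "v \<le> i" "i < length r" "Suc i = length r \<or> (\<exists>j<v. y < r!j \<and> r!j \<le> r!Suc i)" "Suc p < v \<longrightarrow> r!Suc p \<le> y" for i y
  proof (rule ccontr)
    assume "\<not> q \<le> i"
    then have "r!Suc i < r!p" using lo[of "Suc i"] that pv by auto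
    then show False using that big[of _ y] \<open>\<not> q \<le> i\<close> qk by force
  qed
  show ?thesis
  proof (cases "Suc p < v")
    case K1: True
    \<comment> \<open>The larger of \<open>r!Suc p\<close> and the maximum of
      \<open>H\<close>.\<close>
    have "\<exists>y. (y = r!Suc p \<or> y \<in> H) \<and> r!Suc p \<le> y \<and> (\<forall>h\<in>H. h \<le> y)"
    proof (cases "\<exists>h\<in>H. r!Suc p \<le> h")
      case True
      then show ?thesis using Hex by (metis empty_iff order.trans)
    next
      case False
      then show ?thesis by (metis less_imp_le linorder_not_less order_refl)
    qed
    then obtain y where y: "y = r!Suc p \<or> y \<in> H" "r!Suc p \<le> y" "\<And>h. h \<in> H \<Longrightarrow> h \<le> y" by blast
    have yc: "y < r!p" using y(1) Hc D[of p "Suc p"] K1 by auto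
    have my: "r!v < y" using y(2) D[of "Suc p" v] K1 by auto
    have quy: "upper_cond r v S y" unfolding upper_cond_def
    proof (intro allI impI)
      fix i assume h: "v \<le> i \<and> i \<le> length S \<and> (y \<le> r!i \<or> Suc i = length r \<or> (\<exists>j<v. y < r!j \<and> r!j \<le> r!Suc i))"
      have i0: "0 < i" "i < length r" "i - 1 < length S" "Suc (i - 1) = i" using h pv oL by auto
      show "y \<le> S!(i - 1)"
      proof (rule ccontr)
        assume n: "\<not> y \<le> S!(i - 1)"
        have iq: "i \<le> q" using n yc S_hi[of "i - 1"] i0 by (metis leI le_trans less_imp_le less_Suc_eq_le)
        have fact1: "r!Suc p \<le> S!(i - 1)"
        proof (cases "y \<le> r!i")
          case True
          then show ?thesis using oD[of "Suc p" "i - 1"] y(2) i0 K1 h by (auto simp: less_eq_Suc_le)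
        next
          case False
          then have "q \<le> i" using late[of i y] h i0 y(2) by auto
          then show ?thesis using room iq h K1 by auto
        qed
        have "y \<in> H" using y(1) fact1 n by auto
        then obtain i0' where i0': "y = S!i0'" "i0' < length S" "p \<le> i0'" by (auto simp: H_def)
        have "i0' \<noteq> i - 1" using n i0' by auto
        show False
        proof (cases "i0' < v")
          case True
          then have "i0' < i - 1 \<or> i0' = i - 1" using h by linarith
          then have lt: "i0' < i - 1" using \<open>i0' \<noteq> i - 1\<close> by auto
          have "r!Suc i0' \<le> r!Suc p" using D[of "Suc p" "Suc i0'"] i0' True by (cases "i0' = p") auto
          then have "r!Suc i0' \<le> S!(i - 1)" using fact1 by simp
          then show False using oB[OF lt] i0 i0' n by auto
        next
          case False
          have gt: "S!(i - 1) < S!i0'" using n i0' by auto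
          have "v \<le> i - 1 \<or> i - 1 < v" by linarith
          then show False
          proof
            assume "v \<le> i - 1"
            then have lt: "i - 1 < i0'" using Sasc[of i0' "i - 1"] gt False \<open>i0' \<noteq> i - 1\<close> i0 by (meson leI le_neq_implies_less less_asym)
            then have "i \<le> i0'" by simp
            have "S!i \<le> S!i0'" using Sasc[of i i0'] \<open>i \<le> i0'\<close> h i0' by (cases "i = i0'") auto
            moreover have "y < S!i"
            proof (cases "y \<le> r!i")
              case True
              then show ?thesis using oC[of i] U[of i "Suc i"] h \<open>i \<le> i0'\<close> i0' oL by auto
            next
              case False
              then have "q \<le> i" using late[of i y] h i0 y(2) by auto
              then show ?thesis using S_hi[of i] yc \<open>i \<le> i0'\<close> i0' by auto
            qed
            ultimately show False using i0' by auto
          next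
            assume "i - 1 < v"
            then have "i = v" using h i0 by auto
            have "v \<le> i0'" using False by simp
            have "q = v \<or> q \<noteq> v" by simp
            moreover have "q \<le> v" using late[of v y] h \<open>i = v\<close> i0 y(2) my by auto
            ultimately have "q = v" using vq by auto
            then show False using S_hi[of i0'] i0' yc \<open>v \<le> i0'\<close> by auto
          qed
        qed
      qed
    qed
    have "\<not> strict r v S p uu y" using y(1) HB K1 unfolding strict_def by auto
    then show ?thesis using yc y(2) quy qbH[of y] y(3) by blast
  next
    case False
    then have pv': "Suc p = v" using pv by simp
    have v1: "v - 1 = p" using pv' by simp
    have sp: "r!v < r!p" using D pv' by auto
    have Hform: "i = p \<or> r!v < S!i" if "p \<le> i" "i < length S" for i
      using mv[of i] that pv' by (cases "i = p") auto
    have quK: "upper_cond r v S y" if y: "y < r!p" and a: "v \<le> length S \<Longrightarrow> y \<le> r!v \<or> q = v \<Longrightarrow> y \<le> S!p"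
        and b: "\<And>i. v < i \<Longrightarrow> i \<le> length S \<Longrightarrow> i \<le> q \<Longrightarrow> y \<le> r!i \<or> i = q \<Longrightarrow> y \<le> S!(i - 1)" for y
      unfolding upper_cond_def
    proof (intro allI impI)
      fix i assume h: "v \<le> i \<and> i \<le> length S \<and> (y \<le> r!i \<or> Suc i = length r \<or> (\<exists>j<v. y < r!j \<and> r!j \<le> r!Suc i))"
      have yq: "y \<le> r!i \<or> q \<le> i" using late[of i y] h oL pv' by auto
      show "y \<le> S!(i - 1)"
      proof (cases "i \<le> q")
        case True
        then show ?thesis using a b[of i] h v1 yq by (cases "i = v") auto
      next
        case False
        then have "q \<le> i - 1" "i - 1 < length S" using h by auto
        then show ?thesis using S_hi[of "i - 1"] y by auto
      qed
    qed
    show ?thesis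
    proof (cases "H = {}")
      case False
      then obtain y where y: "y \<in> H" "\<And>h. h \<in> H \<Longrightarrow> h \<le> y" using Hex by blast
      obtain i0 where i0: "y = S!i0" "i0 < length S" "p \<le> i0" "p = 0 \<or> S!i0 < S!(p - 1)" using y(1) unfolding H_def by blast
      have yc: "y < r!p" using y Hc by auto
      have "upper_cond r v S y"
      proof (rule quK[OF yc])
        show "y \<le> S!p" if "v \<le> length S" "y \<le> r!v \<or> q = v"
        proof (cases "i0 = p")
          case False
          then have "v \<le> i0" using i0 pv' by auto
          then show ?thesis using mv[of i0] i0 that S_hi[of i0] yc by auto
        qed (use i0 in auto)
        fix i assume i: "v < i" "i \<le> length S" "i \<le> q" "y \<le> r!i \<or> i = q"
        have ii: "i - 1 < length S" "v \<le> i - 1" "Suc (i - 1) = i" using i by auto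
        show "y \<le> S!(i - 1)"
        proof (rule ccontr)
          assume n: "\<not> y \<le> S!(i - 1)"
          show False
          proof (cases "i0 \<le> i - 1")
            case True
            then have lt: "i0 < i - 1" using n i0 by (cases "i0 = i - 1") auto
            show False
            proof (cases "i0 = p")
              case True
              then show False using oB[OF lt] ii mv[of "i - 1"] n i0 pv' by auto
            next
              case False
              then show False using Sasc[of i0 "i - 1"] lt ii n i0 pv' by auto
            qed
          next
            case False
            then have il: "i \<le> i0" by simp
            have "S!i \<le> y" using Sasc[of i i0] il i i0 by (cases "i = i0") auto
            moreover have "y < S!i"
              using i(4) S_hi[of i] yc oC[of i] U[of i "Suc i"] il i0 i oL by auto
            ultimately show False by simp
          qed
        qed
      qed
      moreover have "\<not> strict r v S p uu y" using HB y(1) unfolding strict_def by auto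
      ultimately show ?thesis using yc qbH[of y] y(2) pv' by blast
    next
      case True
      \<comment> \<open>With \<open>H\<close> empty only the conditions next to the valley can fail.
        They fail for \<open>S!p\<close>, which is the entry below the right neighbour of
        \<open>p\<close>, or for \<open>r!v\<close>, which is that neighbour.\<close>
      show ?thesis
      proof (cases "q = v \<and> (below_next r S q (r!p) \<or> (v \<le> length S \<and> S!p \<le> r!v)) \<or> (q \<noteq> v \<and> v \<le> length S \<and> S!p \<le> r!v)")
        case c: True
        have vl: "v \<le> length S" and yc: "S!p < r!p" using c room3 pv' v1 sp by auto
        have "upper_cond r v S (S!p)"
        proof (rule quK[OF yc])
          fix i assume i: "v < i" "i \<le> length S" "i \<le> q" "S!p \<le> r!i \<or> i = q"
          then have "q \<noteq> v" by auto
          moreover have "v \<le> i - 1" "i - 1 < length S" using i by linarith+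
          ultimately show "S!p \<le> S!(i - 1)" using mv[of "i - 1"] c i by auto
        qed auto
        moreover have "\<not> strict r v S p uu (S!p)"
          using c pv' vl v1 yc unfolding strict_def by auto
        ultimately show ?thesis using yc qbH[of "S!p"] True pv' by blast
      next
        case c: False
        have uu: "uu = r!v" using c by auto
        have "upper_cond r v S (r!v)"
        proof (rule quK[OF sp])
          show "r!v \<le> S!p" if "v \<le> length S" using c that by auto
          fix i assume "v < i" "i \<le> length S"
          then have "v \<le> i - 1" "i - 1 < length S" by linarith+
          then show "r!v \<le> S!(i - 1)" using mv[of "i - 1"] by auto
        qed
        moreover have "\<not> strict r v S p uu (r!v)" using uu pv' unfolding strict_def by auto
        ultimately show ?thesis using sp qbH[of "r!v"] True pv' by blast
      qed
    qed
  qed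
qed

end

section \<open>Insertions that fit below a given row\<close>

text \<open>
  The condition on \<open>(R, a)\<close> for the insertion of \<open>a\<close> into \<open>R\<close> to leave a row that fits below \<open>Q\<close>.
  It depends only on data before the insertion, which is what makes the recursion over rows close.
\<close>

definition admissible :: "nat list \<Rightarrow> nat list \<Rightarrow> nat \<Rightarrow> bool" where
  "admissible Q R a \<longleftrightarrow> a < Q!0 \<and> ok Q R \<and> (\<forall>t. vee Q t \<longrightarrow> upper_cond Q t R a \<and> lower_cond Q t R a)"

lemma vee_unique: "vee R u \<Longrightarrow> vee R v \<Longrightarrow> u = v"
  by (metis linorder_neqE_nat not_less_iff_gr_or_eq order.refl veeD(1,2,3))

lemma admissible_iff: "vee Q t \<Longrightarrow> admissible Q R a \<longleftrightarrow> a < Q!0 \<and> ok Q R \<and> upper_cond Q t R a \<and> lower_cond Q t R a"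
  unfolding admissible_def using vee_unique by blast

text \<open>If \<open>Q\<close> increased from the start, (v) would require
  \<open>Q!0 < R!0\<close>, against (i).\<close>

lemma ok_valley_pos:
  assumes "vee Q t" "ok Q R" "R \<noteq> []" shows "0 < t"
proof (rule ccontr)
  assume "\<not> 0 < t"
  then have "Q!0 < Q!Suc 0" using veeD(3)[OF assms(1), of 0 "Suc 0"] okD(1)[OF assms(2)] assms(3) by (cases R) auto
  then show False using okD(2,4)[OF assms(2), of 0] assms(3) by fastforce
qed

text \<open>The valley of \<open>R\<close> cannot lie beyond \<open>t\<close>:
  \<open>R!Suc t < R!t\<close> together with \<open>Q!Suc t < R!Suc t\<close> from (v) would be
  (ii).\<close>

lemma ok_lower_asc:
  assumes Q: "vee Q t" and ok: "ok Q R" and vs: "R = [] \<or> (\<exists>w. vee R w)"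
    and ij: "t \<le> i" "i < j" "j < length R"
  shows "R!i < R!j"
proof -
  obtain w where w: "vee R w" using vs ij by force
  have "w \<le> t"
  proof (rule ccontr)
    assume n: "\<not> w \<le> t"
    then have "R!Suc t < R!t" "Suc t < length R" using veeD(1)[OF w] veeD(2)[OF w, of t "Suc t"] by auto
    moreover have "Q!Suc t < R!Suc t" using okD(4)[OF ok, of "Suc t"] veeD(3)[OF Q, of "Suc t" "Suc (Suc t)"] okD(1)[OF ok] calculation by auto
    ultimately show False using okD(3)[OF ok, of t "Suc t"] by auto
  qed
  then show ?thesis using veeD(3)[OF w, of i j] ij by auto
qed

text \<open>Covers all forms of an undone bump at once: \<open>f\<close> is the row before it,
  \<open>g\<close> the row after it, and they agree off \<open>p\<close> and \<open>q\<close>. The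
  position \<open>x\<close> carries in \<open>f\<close> a value at least \<open>g!p\<close> that is
  smaller than everything left of \<open>p\<close>; it stands in for the entry \<open>g!p\<close>,
  which \<open>f\<close> may lack at \<open>p\<close>.\<close>

lemma admissible_iff_ok:
  fixes g f Q :: "nat list"
  assumes vg: "vee g v" and pv: "p < v" and vq: "v \<le> q" and qk: "q < length g" and ac: "g!q < g!p"
    and ce: "Suc q < length g \<Longrightarrow> g!p \<le> g!Suc q"
    and len: "length f = length g" and fg: "\<And>i. i < length g \<Longrightarrow> i \<noteq> p \<Longrightarrow> i \<noteq> q \<Longrightarrow> f!i = g!i"
    and fp: "f!p \<le> g!p" and fq: "f!q = g!q \<or> f!q = g!p"
    and sp: "Suc p < v \<Longrightarrow> g!Suc p < f!p"
    and x: "p \<le> x" "x < length g" "g!p \<le> f!x" "\<And>i. i < p \<Longrightarrow> f!x < g!i"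
    and Q: "vee Q t"
  shows "admissible Q f (g!q) \<longleftrightarrow> ok Q g"
proof -
  note D = veeD(2)[OF vg] and U = veeD(3)[OF vg]
  note DQ = veeD(2)[OF Q] and UQ = veeD(3)[OF Q]
  have pq: "p < q" using pv vq by simp
  have pre: "i < p \<Longrightarrow> g!p < g!i" for i using D pv by auto
  have lo: "p < i \<Longrightarrow> i \<le> q \<Longrightarrow> g!i < g!p" for i
    using D[of p i] U[of i q] ac qk by (cases "i \<le> v"; cases "i = q") (auto intro: less_trans)
  have lo2: "v \<le> i \<Longrightarrow> i < q \<Longrightarrow> g!i < g!q" for i using U qk by auto
  have lo2': "v \<le> i \<Longrightarrow> i \<le> q \<Longrightarrow> g!i \<le> g!q" for i using U[of i q] qk by (cases "i = q") auto
  have hi: "q < i \<Longrightarrow> i < length g \<Longrightarrow> g!p \<le> g!i" for i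
    using ce U[of "Suc q" i] vq by (cases "i = Suc q") auto
  have fpre: "i < p \<Longrightarrow> f!i = g!i" for i using fg[of i] pq qk by auto
  have fmid: "p < i \<Longrightarrow> i < q \<Longrightarrow> f!i = g!i" for i using fg[of i] qk by auto
  have fhi: "q < i \<Longrightarrow> i < length g \<Longrightarrow> f!i = g!i" for i using fg[of i] pq by auto
  have flo: "p \<le> i \<Longrightarrow> i \<le> q \<Longrightarrow> f!i \<le> g!p" for i
    using fmid[of i] lo[of i] fp fq ac pq by (cases "i = p"; cases "i = q") auto
  have midlt: "p < i \<Longrightarrow> i < v \<Longrightarrow> g!i < f!p" for i
    using sp D[of "Suc p" i] by (cases "i = Suc p") (auto intro: less_trans)
  have fdesc: "0 < j \<Longrightarrow> j < v \<Longrightarrow> f!j < f!(j - 1)" for j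
  proof -
    assume j: "0 < j" "j < v"
    then obtain j' where j': "j = Suc j'" by (cases j) auto
    consider "j < p" | "j = p" | "j' = p" | "p < j'" using j' by linarith
    then show ?thesis
    proof cases
      case 1 then show ?thesis using fpre[of j] fpre[of j'] D[of j' j] pv j' by auto
    next
      case 2 then show ?thesis using fpre[of j'] pre[of j'] fp j' by auto
    next
      case 3 then show ?thesis using fmid[of j] midlt[of j] j j' vq by auto
    next
      case 4 then show ?thesis using fmid[of j] fmid[of j'] D[of j' j] j j' vq by auto
    qed
  qed
  show ?thesis
  proof
    assume admissible: "admissible Q f (g!q)"
    have okf: "ok Q f" and quf: "upper_cond Q t f (g!q)" and qbf: "lower_cond Q t f (g!q)" using admissible admissible_iff[OF Q] by auto
    note oL = okD(1)[OF okf] and oA = okD(2)[OF okf] and oB = okD(3)[OF okf] and oC = okD(4)[OF okf] and oD = okD(5)[OF okf]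
    have t0: "0 < t" using ok_valley_pos[OF Q okf] qk len by (cases f) auto
    have Z: "Suc i < t \<and> g!q < Q!Suc i" if i: "i < v" "g!q < g!i" for i
    proof (rule ccontr)
      assume n: "\<not> (Suc i < t \<and> g!q < Q!Suc i)"
      \<comment> \<open>The cut at \<open>t - 1\<close> makes \<open>Suc j = t\<close> available
        whenever \<open>i\<close> is not below \<open>t - 1\<close>; otherwise
        \<open>Q!Suc i <= g!q\<close> is used.\<close>
      define j where "j = min i (t - 1)"
      have j: "j < t" "Suc j = t \<or> Q!Suc j \<le> g!q" "j \<le> i" using n t0 by (auto simp: j_def min_def)
      have gj: "g!q < g!j" using D[of j i] i j by (cases "j = i") auto
      obtain i' where i': "i' < length f" "g!q < f!i'" "0 < j \<Longrightarrow> f!i' < f!(j - 1)"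
      proof (cases "j = p")
        case True
        have "0 < j \<Longrightarrow> f!x < f!(j - 1)" using x(4)[of "p - 1"] fpre[of "p - 1"] True by auto
        then show thesis using that[of x] x ac len by auto
      next
        case False
        have "f!j = g!j" using fg[of j] False j i vq qk by auto
        then show thesis using that[of j] fdesc[of j] gj j i vq qk len by auto
      qed
      have "1 \<le> j \<and> (j < length f \<and> f!j < f!(j - 1) \<longrightarrow> f!(j - 1) \<le> f!i')"
        using qbf j i' unfolding lower_cond_def by blast
      then show False using fdesc[of j] i' j i vq qk len by auto
    qed
    have Zp: "Suc p < t" "g!q < Q!Suc p" using Z[of p] pv ac by auto
    have tq: "v < q" if "t \<le> q"
    proof (rule ccontr)
      assume "\<not> v < q"
      then have "q = v" using vq by simp
      then show False using Z[of "v - 1"] D[of "v - 1" v] pv that by auto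
    qed
    have fq1: "f!(q - 1) < g!q" if "v < q"
      using lo2[of "q - 1"] fmid[of "q - 1"] that pv by auto
    \<comment> \<open>The conclusion of \<open>upper_cond\<close> at \<open>q\<close> fails because
      \<open>f!(q - 1) < g!q\<close>, so none of its three alternatives can hold.\<close>
    have quq: "Q!q < g!q \<and> Suc q \<noteq> length Q \<and> \<not> (\<exists>j<t. g!q < Q!j \<and> Q!j \<le> Q!Suc q)" if "t \<le> q"
      using quf[unfolded upper_cond_def, rule_format, of q] that fq1[OF tq[OF that]] qk len by force
    show "ok Q g"
    proof (rule okI)
      show "length g < length Q" using oL len by simp
      show "g!j < Q!0" if "j < length g" for j
        using that oA[of j] oA[of x] x fg[of j] len ac by (cases "j = p"; cases "j = q") auto
      show False if h: "i < j" "j < length g" "Q!Suc i \<le> g!j" "g!j < g!i" for i j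
      proof -
        consider "j = q" | "j \<noteq> q" "i = p" | "j = p" | "i = q" | "i \<noteq> p" "i \<noteq> q" "j \<noteq> p" "j \<noteq> q" by blast
        then show False
        proof cases
          case 1
          then have "i < v" using h lo2[of i] by (cases "v \<le> i") auto
          then show False using Z[of i] h 1 by auto
        next
          case 2
          have "\<not> q < j" using hi[of j] h(2,4) 2 by auto
          then have jv: "j < v" using h(3) 2 Zp lo2'[of j] by (cases "v \<le> j") auto
          then have "f!j < f!p" using midlt[of j] fmid[of j] h 2 vq by auto
          then show False using oB[of p j] h 2 fmid[of j] jv vq len by auto
        next
          case 3
          then show False using oB[of i x] h x fpre[of i] len by fastforce
        next
          case 4
          then show False using hi[of j] h ac by auto
        next
          case 5
          then show False using oB[of i j] fg[of i] fg[of j] h len by auto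
        qed
      qed
      show "Q!j < g!j" if h: "j < length g" "Q!j < Q!Suc j" for j
      proof (cases "j = q")
        case True
        have "t \<le> q" using DQ[of q "Suc q"] h True by (cases "t \<le> q") auto
        then show ?thesis using quq True by auto
      next
        case False
        have "j \<noteq> p" using DQ[of p "Suc p"] Zp h by auto
        then show ?thesis using oC[of j] fg[of j] False h len by auto
      qed
      show "Q!i \<le> g!j" if h: "i \<le> j" "j < length g" "Q!i \<le> Q!Suc j" for i j
      proof (cases "j = q")
        case True
        have tq': "t \<le> q" using DQ[of i "Suc q"] h True by (cases "t \<le> q") auto
        show ?thesis
        proof (cases "i < t")
          case True
          then show ?thesis using quq[OF tq'] h \<open>j = q\<close> by (metis leI)
        next
          case False
          then show ?thesis using quq[OF tq'] UQ[of i q] h \<open>j = q\<close> oL len by (cases "i = q") auto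
        qed
      next
        case False
        have "j \<noteq> p" using DQ[of i "Suc p"] Zp h by auto
        then show ?thesis using oD[of i j] fg[of j] False h len by auto
      qed
    qed
  next
    assume okg: "ok Q g"
    note oL = okD(1)[OF okg] and oA = okD(2)[OF okg] and oB = okD(3)[OF okg] and oC = okD(4)[OF okg] and oD = okD(5)[OF okg]
    have vt: "v \<le> t"
    proof (rule ccontr)
      assume n: "\<not> v \<le> t"
      have "Q!Suc t < g!Suc t" using oC[of "Suc t"] UQ[of "Suc t" "Suc (Suc t)"] n vq qk oL by auto
      moreover have "g!Suc t < g!t" using D[of t "Suc t"] n by auto
      ultimately show False using oB[of t "Suc t"] n vq qk by auto
    qed
    have tp: "Suc p \<le> t" using vt pv by simp
    have okf: "ok Q f"
    proof (rule okI)
      show "length f < length Q" using oL len by simp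
      show "f!j < Q!0" if "j < length f" for j
        using that oA[of j] oA[of p] fg[of j] flo[of j] len pq qk by (cases "j = p"; cases "j = q") auto
      show False if h: "i < j" "j < length f" "Q!Suc i \<le> f!j" "f!j < f!i" for i j
      proof -
        consider "j = q" | "j = p" | "i = q" | "i = p" "j \<noteq> q" | "i \<noteq> p" "i \<noteq> q" "j \<noteq> p" "j \<noteq> q" by blast
        then show False
        proof cases
          case 1
          show False
          proof (cases "f!q = g!q")
            case True
            have "f!i \<le> g!i" using fp fg[of i] h 1 len by (cases "i = p") auto
            then show False using oB[of i q] h 1 True len by auto
          next
            case False
            then have e: "f!q = g!p" using fq by simp
            have "i < p"
            proof (rule ccontr)
              assume "\<not> i < p"
              then show False using flo[of i] h(1,4) 1 e by auto
            qed
            then show False using oB[of i p] h e 1 pre[of i] pq qk by auto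
          qed
        next
          case 2 then show False using oB[of i p] h pre[of i] fp pq qk by auto
        next
          case 3 then show False using hi[of j] fhi[of j] flo[of q] h pq len by auto
        next
          case 4
          then have "f!j = g!j" using fg[of j] h len by auto
          then show False using oB[of p j] h 4 fp len by auto
        next
          case 5 then show False using oB[of i j] fg[of i] fg[of j] h len by auto
        qed
      qed
      show "Q!j < f!j" if h: "j < length f" "Q!j < Q!Suc j" for j
      proof -
        have "j \<noteq> p" using DQ[of p "Suc p"] tp h by auto
        then show ?thesis using oC[of j] fg[of j] fq ac h len by (cases "j = q") auto
      qed
      show "Q!i \<le> f!j" if h: "i \<le> j" "j < length f" "Q!i \<le> Q!Suc j" for i j
      proof -
        have "j \<noteq> p" using DQ[of i "Suc p"] tp h by auto
        then show ?thesis using oD[of i j] fg[of j] fq ac h len by (cases "j = q") auto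
      qed
    qed
    have "upper_cond Q t f (g!q)" unfolding upper_cond_def
    proof (intro allI impI)
      fix i assume h: "t \<le> i \<and> i \<le> length f \<and> (g!q \<le> Q!i \<or> Suc i = length Q \<or> (\<exists>j<t. g!q < Q!j \<and> Q!j \<le> Q!Suc i))"
      have i: "v \<le> i" "0 < i" using h vt pv by auto
      show "g!q \<le> f!(i - 1)"
      proof (cases "i \<le> q")
        case True
        have il: "i < length g" using True qk by auto
        have a: "Q!i < g!i" using oC[of i] UQ[of i "Suc i"] h il oL by auto
        have "\<not> g!q \<le> Q!i" using a lo2'[of i] i True by auto
        moreover have "Suc i \<noteq> length Q" using il oL by auto
        moreover have "\<not> (\<exists>j<t. g!q < Q!j \<and> Q!j \<le> Q!Suc i)"
        proof
          assume "\<exists>j<t. g!q < Q!j \<and> Q!j \<le> Q!Suc i"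
          then obtain j where j: "j < t" "g!q < Q!j" "Q!j \<le> Q!Suc i" by blast
          then have "Q!j \<le> g!i" using oD[of j i] h il by auto
          then show False using j lo2'[of i] i True by auto
        qed
        ultimately show ?thesis using h by auto
      next
        case False
        then have "i - 1 = q \<or> q < i - 1" "i - 1 < length g" using h len i by linarith+
        then show ?thesis using fhi[of "i - 1"] hi[of "i - 1"] fq ac by auto
      qed
    qed
    moreover have "lower_cond Q t f (g!q)" unfolding lower_cond_def
    proof (intro allI impI)
      fix j i assume h: "j < t \<and> (Suc j = t \<or> Q!Suc j \<le> g!q) \<and> i < length f \<and> g!q < f!i"
      have gv: False if "Suc t' = t" "t = v" for t'
      proof -
        have "Q!v < g!v" using oC[of v] UQ[of v "Suc v"] that vq qk oL by auto
        moreover have "g!v < g!t'" using D[of t' v] that by auto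
        ultimately show False using oB[of t' v] that vq qk by auto
      qed
      have pj: "p < j"
      proof (rule ccontr)
        assume "\<not> p < j"
        then have jp: "j \<le> p" by simp
        show False
        proof (cases "Suc j = t")
          case True
          then have "t = v" using jp vt pv by auto
          then show False using gv True by auto
        next
          case False
          then have "Q!Suc j \<le> g!q" using h by auto
          moreover have "g!q < g!j" using jp pre[of j] ac by (cases "j = p") auto
          ultimately show False using oB[of j q] jp pq qk by auto
        qed
      qed
      have "f!(j - 1) \<le> f!i" if d: "j < length f" "f!j < f!(j - 1)"
      proof (rule ccontr)
        assume n: "\<not> f!(j - 1) \<le> f!i"
        obtain j' where j': "j = Suc j'" "p \<le> j'" using pj by (cases j) auto
        have jv: "j \<le> v"
        proof (rule ccontr)
          assume "\<not> j \<le> v"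
          then have vj: "v \<le> j'" using j' by simp
          have "f!j' \<le> f!j"
          proof (cases "j' < q")
            case True
            have "f!j' = g!j'" "g!j' < g!q" using fmid[of j'] lo2[of j'] True vj pv by auto
            then show ?thesis using fmid[of j] U[of j' j] fq ac True j' vj d len by (cases "j = q") auto
          next
            case False
            then have fj: "f!j = g!j" "g!p \<le> g!j" using fhi[of j] hi[of j] j' d len by auto
            show ?thesis using fj fq ac fhi[of j'] U[of j' j] False vj j' d len by (cases "j' = q") auto
          qed
          then show False using d j' by auto
        qed
        have fj': "f!j' \<le> g!p" using flo[of j'] j' jv vq by auto
        have fi: "f!i < f!j'" using n j' by auto
        have il: "i < length g" using h len by auto
        have "p \<le> i"
        proof (rule ccontr)
          assume "\<not> p \<le> i"
          then show False using fpre[of i] pre[of i] fj' fi by auto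
        qed
        moreover have "i \<noteq> p"
        proof
          assume "i = p"
          then have "j' \<noteq> p" using fi by auto
          then have "f!j' < f!p" using fmid[of j'] midlt[of j'] j' jv vq by auto
          then show False using fi \<open>i = p\<close> by auto
        qed
        moreover have "i \<noteq> q" using h fi fj' fq by auto
        moreover have "\<not> q < i" using fhi[of i] hi[of i] il fi fj' by auto
        ultimately have i: "p < i" "i < q" by auto
        then have gi: "f!i = g!i" using fmid by auto
        have iv: "i < v" using lo2[of i] gi h i by (cases "v \<le> i") auto
        have ij: "j \<le> i"
        proof (rule ccontr)
          assume "\<not> j \<le> i"
          then have "i = j' \<or> i < j'" using j' by linarith
          then show False
          proof
            assume "i = j'" then show False using fi by simp
          next
            assume "i < j'"
            then show False using fmid[of j'] D[of i j'] gi fi i jv j' vq by auto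
          qed
        qed
        then have gj: "g!q < g!j" using D[of j i] gi h iv by (cases "j = i") auto
        show False
        proof (cases "Suc j = t")
          case True
          then have "t = v" using ij iv vt by auto
          then show False using gv True by auto
        next
          case False
          then show False using oB[of j q] h gj ij i qk by auto
        qed
      qed
      then show "1 \<le> j \<and> (j < length f \<and> f!j < f!(j - 1) \<longrightarrow> f!(j - 1) \<le> f!i)" using pj by auto
    qed
    ultimately show "admissible Q f (g!q)" using okf admissible_iff[OF Q] oA[of q] qk by auto
  qed
qed

text \<open>Inserting the last entry again does not change the row, and \<open>ok Q R\<close>
  already contains both conditions: from \<open>t\<close> on \<open>R\<close> exceeds
  \<open>Q\<close> and ascends to its last entry, and larger entries further left are governed by
  (ii).\<close>

lemma admissible_last:
  assumes Q: "vee Q t" and vR: "vee R w"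
  shows "admissible Q R (last R) \<longleftrightarrow> ok Q R"
proof
  assume ok: "ok Q R"
  note oL = okD(1)[OF ok] and oA = okD(2)[OF ok] and oB = okD(3)[OF ok] and oC = okD(4)[OF ok] and oD = okD(5)[OF ok]
  note DQ = veeD(2)[OF Q] and UQ = veeD(3)[OF Q]
  have ne: "R \<noteq> []" using veeD(1)[OF vR] by auto
  have vsR: "R = [] \<or> (\<exists>w. vee R w)" using vR by auto
  define l where "l = length R - 1"
  have l: "length R = Suc l" "last R = R!l" using ne by (auto simp: l_def last_conv_nth)
  have t0: "0 < t" using ok_valley_pos[OF Q ok ne] .
  have asc: "t \<le> i \<Longrightarrow> i \<le> l \<Longrightarrow> R!i \<le> R!l" for i
  proof -
    assume i: "t \<le> i" "i \<le> l"
    have "R = [] \<or> (\<exists>w. vee R w)" using vR by auto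
    then show ?thesis using ok_lower_asc[OF Q ok _ i(1), of l] i l by (cases "i = l") (auto intro: less_imp_le)
  qed
  have "upper_cond Q t R (R!l)" unfolding upper_cond_def
  proof (intro allI impI)
    fix i assume h: "t \<le> i \<and> i \<le> length R \<and> (R!l \<le> Q!i \<or> Suc i = length Q \<or> (\<exists>j<t. R!l < Q!j \<and> Q!j \<le> Q!Suc i))"
    show "R!l \<le> R!(i - 1)"
    proof (cases "i = length R")
      case False
      then have il: "i \<le> l" using h l by auto
      have "Q!i < R!i" using oC[of i] UQ[of i "Suc i"] h il oL l by auto
      moreover have "Q!j \<le> R!i" if "j < t" "Q!j \<le> Q!Suc i" for j using oD[of j i] that h il l by auto
      ultimately show ?thesis using h asc[of i] il oL l by fastforce
    qed (use l in auto)
  qed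
  moreover have "lower_cond Q t R (R!l)" unfolding lower_cond_def
  proof (intro allI impI)
    fix j i assume h: "j < t \<and> (Suc j = t \<or> Q!Suc j \<le> R!l) \<and> i < length R \<and> R!l < R!i"
    have il: "i < l" using h l by (cases "i = l") auto
    have d: "R!Suc i < R!i" using vee_desc'[OF vsR, of i l] h il l by auto
    have it: "i < t" using asc[of i] il h by (cases "t \<le> i") auto
    have qi: "R!l < Q!Suc i" using oB[of i l] il h l by (metis leD leI lessI)
    have ij: "i < j"
    proof (rule ccontr)
      assume n: "\<not> i < j"
      show False
      proof (cases "Suc j = t")
        case True
        then have e: "Suc i = t" using n it by auto
        have "Q!Suc i < R!Suc i" using oC[of "Suc i"] UQ[of "Suc i" "Suc (Suc i)"] e il l oL by auto
        then show False using oB[of i "Suc i"] d il l by auto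
      next
        case False
        have "Q!Suc i \<le> Q!Suc j" using DQ[of "Suc j" "Suc i"] n it by (cases "i = j") auto
        then show False using qi h False by auto
      qed
    qed
    have "R!(j - 1) \<le> R!i" if "j < length R" "R!j < R!(j - 1)"
    proof -
      have "i < j - 1 \<or> i = j - 1" using ij by linarith
      then show ?thesis using vee_desc[OF vsR that, of i "j - 1"] by auto
    qed
    then show "1 \<le> j \<and> (j < length R \<and> R!j < R!(j - 1) \<longrightarrow> R!(j - 1) \<le> R!i)" using ij by auto
  qed
  ultimately show "admissible Q R (last R)" using ok admissible_iff[OF Q] l oA[of l] by auto
qed (use admissible_iff[OF Q] in auto)

text \<open>If \<open>x\<close> exceeds the last entry, \<open>upper_cond\<close> amounts to the
  length bound, (iv) and (v) for the new cell, and \<open>lower_cond\<close> to (ii). If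
  \<open>x\<close> prolongs a decreasing row, both sides force the new cell to lie before the valley
  of \<open>Q\<close>.\<close>

lemma admissible_ext:
  assumes Q: "vee Q t" and vR: "vee R w" and ext: "last R < x \<or> (x < last R \<and> Suc w = length R)"
  shows "admissible Q R x \<longleftrightarrow> ok Q (R @ [x])"
proof -
  note DQ = veeD(2)[OF Q] and UQ = veeD(3)[OF Q]
  have ne: "R \<noteq> []" using veeD(1)[OF vR] by auto
  have vsR: "R = [] \<or> (\<exists>w. vee R w)" using vR by auto
  define l where "l = length R"
  have l0: "0 < l" and lst: "last R = R!(l - 1)" using ne by (auto simp: l_def last_conv_nth)
  have nx: "(R @ [x])!i = (if i < l then R!i else x)" if "i \<le> l" for i
    using that by (auto simp: nth_append l_def)
  have ok_ext: "ok Q (R @ [x]) \<longleftrightarrow> ok Q R \<and> Suc l < length Q \<and> x < Q!0 \<and>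
     (\<forall>j<l. \<not> (Q!Suc j \<le> x \<and> x < R!j)) \<and> (Q!l < Q!Suc l \<longrightarrow> Q!l < x) \<and> (\<forall>i\<le>l. Q!i \<le> Q!Suc l \<longrightarrow> Q!i \<le> x)"
    (is "?A = ?B")
  proof
    assume A: ?A
    note a = okD[OF A]
    have 1: "ok Q R"
    proof (rule okI)
      show "length R < length Q" using a(1) by simp
      show "R!j < Q!0" if "j < length R" for j using a(2)[of j] nx[of j] that by (simp add: l_def)
      show False if "i < j" "j < length R" "Q!Suc i \<le> R!j" "R!j < R!i" for i j
        using a(3)[of i j] nx[of j] nx[of i] that by (auto simp: l_def)
      show "Q!j < R!j" if "j < length R" "Q!j < Q!Suc j" for j using a(4)[of j] nx[of j] that by (auto simp: l_def)
      show "Q!i \<le> R!j" if "i \<le> j" "j < length R" "Q!i \<le> Q!Suc j" for i j using a(5)[of i j] nx[of j] that by (auto simp: l_def)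
    qed
    have "x < Q!0" using a(2)[of l] nx[of l] by (simp add: l_def)
    moreover have "\<not> (Q!Suc j \<le> x \<and> x < R!j)" if "j < l" for j using a(3)[of j l] nx[of l] nx[of j] that by (auto simp: l_def)
    moreover have "Q!l < Q!Suc l \<longrightarrow> Q!l < x" using a(4)[of l] nx[of l] by (auto simp: l_def)
    moreover have "\<forall>i\<le>l. Q!i \<le> Q!Suc l \<longrightarrow> Q!i \<le> x" using a(5)[of _ l] nx[of l] by (auto simp: l_def)
    ultimately show ?B using 1 a(1) by (auto simp: l_def)
  next
    assume B: ?B
    then have b: "ok Q R" by simp
    note a = okD[OF b]
    show ?A
    proof (rule okI)
      show "length (R @ [x]) < length Q" using B by (simp add: l_def)
      show "(R @ [x])!j < Q!0" if "j < length (R @ [x])" for j using a(2)[of j] nx[of j] that B by (auto simp: l_def)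
      show False if "i < j" "j < length (R @ [x])" "Q!Suc i \<le> (R @ [x])!j" "(R @ [x])!j < (R @ [x])!i" for i j
        using a(3)[of i j] nx[of j] nx[of i] that B by (cases "j = l") (auto simp: l_def)
      show "Q!j < (R @ [x])!j" if "j < length (R @ [x])" "Q!j < Q!Suc j" for j
        using a(4)[of j] nx[of j] that B by (cases "j = l") (auto simp: l_def)
      show "Q!i \<le> (R @ [x])!j" if "i \<le> j" "j < length (R @ [x])" "Q!i \<le> Q!Suc j" for i j
        using a(5)[of i j] nx[of j] that B by (cases "j = l") (auto simp: l_def)
    qed
  qed
  show ?thesis
  proof (cases "ok Q R")
    case False
    then show ?thesis using ok_ext admissible_iff[OF Q] by auto
  next
    case ok: True
    note oL = okD(1)[OF ok] and oA = okD(2)[OF ok] and oB = okD(3)[OF ok] and oC = okD(4)[OF ok] and oD = okD(5)[OF ok]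
    have t0: "0 < t" using ok_valley_pos[OF Q ok ne] .
    have tk: "t < length Q" using veeD(1)[OF Q] .
    have asc: "t \<le> i \<Longrightarrow> i < l \<Longrightarrow> R!i \<le> R!(l - 1)" for i
    proof -
      assume i: "t \<le> i" "i < l"
      then have "i = l - 1 \<or> (i < l - 1 \<and> l - 1 < length R)" by (auto simp: l_def)
      moreover have "R = [] \<or> (\<exists>w. vee R w)" using vR by auto
      ultimately show ?thesis using ok_lower_asc[OF Q ok, of i "l - 1"] i(1) by (auto intro: less_imp_le)
    qed
    show ?thesis
    proof (cases "last R < x")
      case e1: True
      have Rt: "R!i < x" if "t \<le> i" "i < l" for i using asc[of i] that e1 lst by auto
      have Qx: "Q!i < x" if "t \<le> i" "i < l" for i
        using oC[of i] UQ[of i "Suc i"] Rt[of i] that oL by (auto simp: l_def)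
      have DQx: "Q!j \<le> x" if "j < t" "t \<le> i" "i < l" "Q!j \<le> Q!Suc i" for i j
        using oD[of j i] Rt[of i] that by (auto simp: l_def)
      have upper_cond: "upper_cond Q t R x \<longleftrightarrow> (t \<le> l \<longrightarrow> Q!l < x \<and> Suc l \<noteq> length Q \<and> (\<forall>j<t. Q!j \<le> Q!Suc l \<longrightarrow> Q!j \<le> x))"
      proof
        assume a: "upper_cond Q t R x"
        show "t \<le> l \<longrightarrow> Q!l < x \<and> Suc l \<noteq> length Q \<and> (\<forall>j<t. Q!j \<le> Q!Suc l \<longrightarrow> Q!j \<le> x)"
          using a[unfolded upper_cond_def, rule_format, of l] e1 lst unfolding l_def by (metis leD leI le_refl)
      next
        assume a: "t \<le> l \<longrightarrow> Q!l < x \<and> Suc l \<noteq> length Q \<and> (\<forall>j<t. Q!j \<le> Q!Suc l \<longrightarrow> Q!j \<le> x)"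
        show "upper_cond Q t R x" unfolding upper_cond_def
        proof (intro allI impI)
          fix i assume h: "t \<le> i \<and> i \<le> length R \<and> (x \<le> Q!i \<or> Suc i = length Q \<or> (\<exists>j<t. x < Q!j \<and> Q!j \<le> Q!Suc i))"
          have False
          proof (cases "i = l")
            case True then show False using h a by fastforce
          next
            case False
            then have "i < l" using h by (auto simp: l_def)
            moreover have False if "j < t" "x < Q!j" "Q!j \<le> Q!Suc i" for j
              using DQx[of j i] that h calculation by auto
            ultimately show False using h Qx[of i] oL by (auto simp: l_def)
          qed
          then show "x \<le> R!(i - 1)" ..
        qed
      qed
      have Di: "Suc i < l \<and> i < t \<and> R!Suc i < R!i" if "i < l" "x < R!i" for i
      proof -
        have "i < l - 1" using that e1 lst by (cases "i = l - 1") auto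
        then have "R!Suc i < R!i \<and> Suc i < l" using vee_desc'[OF vsR, of i "l - 1"] that e1 lst l0 by (auto simp: l_def)
        then show ?thesis using Rt[of i] that by (cases "t \<le> i") auto
      qed
      have lower_cond: "lower_cond Q t R x \<longleftrightarrow> (\<forall>j<l. \<not> (Q!Suc j \<le> x \<and> x < R!j))"
      proof
        assume a: "lower_cond Q t R x"
        show "\<forall>j<l. \<not> (Q!Suc j \<le> x \<and> x < R!j)"
        proof (intro allI impI notI)
          fix j assume j: "j < l" "Q!Suc j \<le> x \<and> x < R!j"
          then have d: "Suc j < l" "j < t" "R!Suc j < R!j" using Di[of j] by auto
          have "1 \<le> j \<and> (j < length R \<and> R!j < R!(j - 1) \<longrightarrow> R!(j - 1) \<le> R!j)"
            using a[unfolded lower_cond_def] j d unfolding l_def by blast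
          moreover have "1 \<le> j \<Longrightarrow> R!j < R!(j - 1)" using vee_desc[OF vsR, of "Suc j" "j - 1" j] d by (auto simp: l_def)
          ultimately show False using j by (auto simp: l_def)
        qed
      next
        assume a: "\<forall>j<l. \<not> (Q!Suc j \<le> x \<and> x < R!j)"
        show "lower_cond Q t R x" unfolding lower_cond_def
        proof (intro allI impI)
          fix j i assume h: "j < t \<and> (Suc j = t \<or> Q!Suc j \<le> x) \<and> i < length R \<and> x < R!i"
          then have il: "i < l" by (simp add: l_def)
          have d: "Suc i < l" "i < t" "R!Suc i < R!i" using Di[of i] il h by auto
          have qi: "x < Q!Suc i" using a il h by auto
          have ij: "i < j"
          proof (rule ccontr)
            assume n: "\<not> i < j"
            show False
            proof (cases "Suc j = t")
              case True
              then have e: "Suc i = t" using n d by auto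
              then show False using Qx[of "Suc i"] qi d by auto
            next
              case False
              have "Q!Suc i \<le> Q!Suc j" using DQ[of "Suc j" "Suc i"] n d by (cases "i = j") auto
              then show False using qi h False by auto
            qed
          qed
          have "R!(j - 1) \<le> R!i" if "j < length R" "R!j < R!(j - 1)"
          proof -
            have "i < j - 1 \<or> i = j - 1" using ij by linarith
            then show ?thesis using vee_desc[OF vsR that, of i "j - 1"] by auto
          qed
          then show "1 \<le> j \<and> (j < length R \<and> R!j < R!(j - 1) \<longrightarrow> R!(j - 1) \<le> R!i)" using ij by auto
        qed
      qed
      have "(t \<le> l \<longrightarrow> Q!l < x \<and> Suc l \<noteq> length Q \<and> (\<forall>j<t. Q!j \<le> Q!Suc l \<longrightarrow> Q!j \<le> x)) \<longleftrightarrow>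
         Suc l < length Q \<and> (Q!l < Q!Suc l \<longrightarrow> Q!l < x) \<and> (\<forall>i\<le>l. Q!i \<le> Q!Suc l \<longrightarrow> Q!i \<le> x)" (is "?L = ?M")
      proof (cases "t \<le> l")
        case True
        have ql: "Suc l < length Q \<Longrightarrow> Q!l < Q!Suc l" using UQ[of l "Suc l"] True by auto
        have lQ: "l < length Q" using oL by (simp add: l_def)
        show ?thesis
        proof
          assume L: ?L
          have "Q!i \<le> x" if "i \<le> l" "Q!i \<le> Q!Suc l" for i
          proof (cases "i < t")
            case False
            then have "Q!i \<le> Q!l" using UQ[of i l] that lQ by (cases "i = l") auto
            then show ?thesis using L True by auto
          qed (use L True that in auto)
          then show ?M using L True lQ by auto
        qed (use ql True in auto)
      next
        case False
        then have lt: "Suc l \<le> t" by simp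
        have n: "\<not> Q!i \<le> Q!Suc l" if "i \<le> l" for i using DQ[of i "Suc l"] that lt by auto
        have "\<not> Q!l < Q!Suc l" using n[of l] by linarith
        then show ?thesis using n False lt tk by auto
      qed
      then show ?thesis using ok ok_ext admissible_iff[OF Q] upper_cond lower_cond by auto
    next
      case False
      then have e2: "x < R!(l - 1)" "Suc w = l" using ext lst by (auto simp: l_def)
      have de: "i < j \<Longrightarrow> j < l \<Longrightarrow> R!j < R!i" for i j using veeD(2)[OF vR, of i j] e2 by auto
      have Rx: "i < l \<Longrightarrow> x < R!i" for i using de[of i "l - 1"] e2 by (cases "i = l - 1") auto
      have x0: "x < Q!0" using oA[of "l - 1"] e2 l0 by (auto simp: l_def)
      show ?thesis
      proof
        assume "admissible Q R x"
        then have lower_cond: "\<And>j i. j < t \<Longrightarrow> Suc j = t \<or> Q!Suc j \<le> x \<Longrightarrow> i < l \<Longrightarrow> x < R!i \<Longrightarrow>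
            1 \<le> j \<and> (j < l \<and> R!j < R!(j - 1) \<longrightarrow> R!(j - 1) \<le> R!i)"
          using admissible_iff[OF Q] unfolding lower_cond_def l_def by blast
        have lt: "l < t"
        proof (rule ccontr)
          assume n: "\<not> l < t"
          \<comment> \<open>\<open>lower_cond\<close> at \<open>j = t - 1\<close> and
            \<open>i = l - 1\<close> would need an inequality that a decreasing row
            violates.\<close>
          have "1 \<le> t - 1 \<and> (t - 1 < l \<and> R!(t - 1) < R!(t - 1 - 1) \<longrightarrow> R!(t - 1 - 1) \<le> R!(l - 1))"
            using lower_cond[of "t - 1" "l - 1"] t0 l0 Rx[of "l - 1"] by auto
          moreover have "R!(t - 1) < R!(t - 1 - 1)" "R!(l - 1) < R!(t - 1 - 1)" if "1 \<le> t - 1"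
            using de[of "t - 1 - 1" "t - 1"] de[of "t - 1 - 1" "l - 1"] n that l0 by auto
          ultimately show False using n l0 by auto
        qed
        have "\<not> Q!Suc j \<le> x" if "j < l" for j
        proof
          assume a: "Q!Suc j \<le> x"
          have "1 \<le> j \<and> (j < l \<and> R!j < R!(j - 1) \<longrightarrow> R!(j - 1) \<le> R!j)" using lower_cond[of j j] a that lt Rx[of j] by auto
          then show False using de[of "j - 1" j] that by auto
        qed
        moreover have n: "\<not> Q!i \<le> Q!Suc l" if "i \<le> l" for i using DQ[of i "Suc l"] that lt by auto
        moreover have "\<not> Q!l < Q!Suc l" using n[of l] by linarith
        ultimately show "ok Q (R @ [x])" using ok_ext ok x0 lt tk by auto
      next
        assume a: "ok Q (R @ [x])"
        then have b: "Suc l < length Q" "\<And>j. j < l \<Longrightarrow> x < Q!Suc j" "Q!l < Q!Suc l \<longrightarrow> Q!l < x"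
          using ok_ext Rx by (auto simp: not_le)
        have lt: "l < t"
        proof (rule ccontr)
          assume n: "\<not> l < t"
          then have "Q!l < x" using UQ[of l "Suc l"] b by auto
          then show False using b(2)[of "l - 1"] l0 by auto
        qed
        have "upper_cond Q t R x" unfolding upper_cond_def using lt by (auto simp: l_def)
        moreover have "lower_cond Q t R x" unfolding lower_cond_def
        proof (intro allI impI)
          fix j i assume h: "j < t \<and> (Suc j = t \<or> Q!Suc j \<le> x) \<and> i < length R \<and> x < R!i"
          have "l \<le> j" using h b(2)[of j] lt by (cases "l \<le> j") auto
          then show "1 \<le> j \<and> (j < length R \<and> R!j < R!(j - 1) \<longrightarrow> R!(j - 1) \<le> R!i)" using l0 unfolding l_def by linarith
        qed
        ultimately show "admissible Q R x" using ok x0 admissible_iff[OF Q] by auto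
      qed
    qed
  qed
qed

section \<open>The bumping step is a bijection\<close>

definition is_target :: "nat list \<Rightarrow> nat \<Rightarrow> nat list \<Rightarrow> bool" where
  "is_target S y r \<longleftrightarrow> (\<exists>v. vee r v \<and> 0 < v) \<and> admissible r S y"

text \<open>In the second alternative \<open>a\<close> equals the last entry but cannot be absorbed:
  the next row is only one cell shorter, so the end of this row is no removable corner.\<close>

definition is_source :: "nat list \<Rightarrow> nat list \<Rightarrow> nat \<Rightarrow> bool" where
  "is_source S R a \<longleftrightarrow> (\<exists>u. vee R u \<and> ok R S \<and>
     (Suc u < length R \<and> a < last R \<or> S \<noteq> [] \<and> length R = Suc (length S) \<and> a = last R))"

text \<open>The value \<open>uu\<close> of \<open>bump_frame\<close>, for statements that range over
  several frames.\<close>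

definition corner :: "nat list \<Rightarrow> nat list \<Rightarrow> nat \<Rightarrow> nat \<Rightarrow> nat \<Rightarrow> nat" where
  "corner r S v p q = (if q = v \<and> below_next r S q (r!p) then r!p else r!v)"

text \<open>
  The row before the insertion of \<open>r!q\<close>.  The letter \<open>y\<close> stood at position \<open>p\<close> if that is
  possible (\<open>strict\<close>); otherwise \<open>y\<close> was created by a 0-Hecke relation and is recovered from its
  uniqueness (\<open>nonstrict_unique\<close>).
\<close>

definition uninsert :: "nat list \<Rightarrow> nat list \<Rightarrow> nat \<Rightarrow> nat \<Rightarrow> nat \<Rightarrow> nat \<Rightarrow> nat list" where
  "uninsert r S v p q y = (if strict r v S p (corner r S v p q) y
     then (if below_next r S q (r!p) then r[p := y, q := r!p] else r[p := y])
     else if below_next r S q (r!p) \<and> (q \<le> length S \<longrightarrow> r!p \<le> S!(q - 1)) then r[q := r!p] else r)"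

text \<open>Directed backwards: \<open>(y, r)\<close> determines \<open>(R, a)\<close> by a formula.
  Uniqueness of the source is therefore immediate, and uniqueness of the target is the substantial
  half of bijectivity.\<close>

definition step :: "nat list \<Rightarrow> nat list \<Rightarrow> nat \<Rightarrow> nat \<Rightarrow> nat list \<Rightarrow> bool" where
  "step S R a y r \<longleftrightarrow> (\<exists>v p q. bump_frame r S v p q \<and> y < r!p \<and> (Suc p < v \<longrightarrow> r!Suc p \<le> y) \<and>
     upper_cond r v S y \<and> lower_cond r v S y \<and> a = r!q \<and> R = uninsert r S v p q y)"

section \<open>From the target of a step to its source\<close>

lemma target_bump_frame:
  assumes vs: "S = [] \<or> (\<exists>w. vee S w)" and t: "is_target S y r"
  shows "\<exists>v p q. bump_frame r S v p q \<and> y < r!p \<and> (Suc p < v \<longrightarrow> r!Suc p \<le> y) \<and> upper_cond r v S y \<and> lower_cond r v S y"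
proof -
  obtain v where v: "vee r v" "0 < v" and a: "admissible r S y" using t by (auto simp: is_target_def)
  have ad: "y < r!0" "ok r S" "upper_cond r v S y" "lower_cond r v S y" using a admissible_iff[OF v(1)] by auto
  have ex: "\<exists>p. (p < v \<and> y < r!p) \<and> (\<forall>p'. p' < v \<and> y < r!p' \<longrightarrow> p' \<le> p)"
    using ex_has_greatest_nat[of "\<lambda>p. p < v \<and> y < r!p" 0 "\<lambda>x. x" v] v ad by auto
  then obtain p where p: "p < v" "y < r!p" "\<And>p'. p' < v \<Longrightarrow> y < r!p' \<Longrightarrow> p' \<le> p" by auto
  have pv: "r!v < r!p" using veeD(2)[OF v(1)] p by auto
  have ex: "\<exists>q. (v \<le> q \<and> q < length r \<and> r!q < r!p) \<and> (\<forall>q'. v \<le> q' \<and> q' < length r \<and> r!q' < r!p \<longrightarrow> q' \<le> q)"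
    using ex_has_greatest_nat[of "\<lambda>q. v \<le> q \<and> q < length r \<and> r!q < r!p" v "\<lambda>x. x" "length r"] veeD(1)[OF v(1)] pv by auto
  then obtain q where q: "v \<le> q" "q < length r" "r!q < r!p" "\<And>q'. v \<le> q' \<Longrightarrow> q' < length r \<Longrightarrow> r!q' < r!p \<Longrightarrow> q' \<le> q" by auto
  have "r!p \<le> r!Suc q" if "Suc q < length r" using q(1) q(4)[of "Suc q"] that by (cases "r!Suc q < r!p") auto
  then have "bump_frame r S v p q"
    using v(1) vs ad(2) p(1) q(1-3) by unfold_locales
  moreover have "Suc p < v \<longrightarrow> r!Suc p \<le> y" using p(3)[of "Suc p"] by (metis leI Suc_n_not_le_n)
  ultimately show ?thesis using p ad by blast
qed

lemma bump_frame_unique: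
  assumes f: "bump_frame r S v p q" "y < r!p" "Suc p < v \<longrightarrow> r!Suc p \<le> y"
    and f': "bump_frame r S v' p' q'" "y < r!p'" "Suc p' < v' \<longrightarrow> r!Suc p' \<le> y"
  shows "v = v' \<and> p = p' \<and> q = q'"
proof -
  have v: "v = v'" using bump_frame.vr[OF f(1)] bump_frame.vr[OF f'(1)] vee_unique by blast
  have P: "p \<le> p'" if f: "bump_frame r S v p q" "y < r!p" "Suc p < v \<longrightarrow> r!Suc p \<le> y"
    and f': "bump_frame r S v p' q'" "y < r!p'" "Suc p' < v \<longrightarrow> r!Suc p' \<le> y" for p q p' q'
  proof (rule ccontr)
    assume "\<not> p \<le> p'"
    then have "Suc p' \<le> p" by simp
    then have "r!p \<le> r!Suc p'" using bump_frame.D[OF f(1), of "Suc p'" p] bump_frame.pv[OF f(1)] by (cases "Suc p' = p") auto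
    then show False using f f' \<open>Suc p' \<le> p\<close> bump_frame.pv[OF f(1)] by auto
  qed
  have "p \<le> p'" using P[of p q p' q'] f f' v by blast
  moreover have "p' \<le> p" using P[of p' q' p q] f f' v by blast
  ultimately have p: "p = p'" by simp
  have Qq: "q \<le> q'" if f: "bump_frame r S v p q" and f': "bump_frame r S v p q'" for q q'
  proof (rule ccontr)
    assume "\<not> q \<le> q'"
    then have "r!p \<le> r!q" using bump_frame.hi[OF f', of q] bump_frame.qk[OF f] by auto
    then show False using bump_frame.ac[OF f] by auto
  qed
  have "q \<le> q'" "q' \<le> q" using Qq[of q q'] Qq[of q' q] f(1) f'(1) v p by auto
  then show ?thesis using v p by auto
qed

lemma step_target:
  assumes "step S R a y r"
  shows "is_target S y r"
proof -
  obtain v p q where f: "bump_frame r S v p q" "y < r!p" "upper_cond r v S y" "lower_cond r v S y"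
    using assms unfolding step_def by blast
  have "y < r!0" using bump_frame.pre[OF f(1), of 0] f(2) by (cases "p = 0") auto
  then have "admissible r S y" using admissible_iff[OF bump_frame.vr[OF f(1)]] f bump_frame.okr[OF f(1)] by blast
  moreover have "0 < v" using bump_frame.pv[OF f(1)] by simp
  ultimately show ?thesis unfolding is_target_def using bump_frame.vr[OF f(1)] by blast
qed

lemma step_ex:
  assumes "S = [] \<or> (\<exists>w. vee S w)" "is_target S y r" shows "\<exists>R a. step S R a y r"
proof -
  obtain v p q where "bump_frame r S v p q" "y < r!p" "Suc p < v \<longrightarrow> r!Suc p \<le> y" "upper_cond r v S y" "lower_cond r v S y"
    using target_bump_frame[OF assms] by blast
  then show ?thesis unfolding step_def by blast
qed

lemma step_unique_source:
  assumes "step S R a y r" "step S R' a' y r" shows "R = R' \<and> a = a'"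
proof -
  obtain v p q where f: "bump_frame r S v p q" "y < r!p" "Suc p < v \<longrightarrow> r!Suc p \<le> y" "a = r!q" "R = uninsert r S v p q y"
    using assms(1) unfolding step_def by blast
  obtain v' p' q' where f': "bump_frame r S v' p' q'" "y < r!p'" "Suc p' < v' \<longrightarrow> r!Suc p' \<le> y" "a' = r!q'" "R' = uninsert r S v' p' q' y"
    using assms(2) unfolding step_def by blast
  have "v = v' \<and> p = p' \<and> q = q'" using bump_frame_unique[OF f(1-3) f'(1-3)] .
  then show ?thesis using f f' by simp
qed

text \<open>For adjacent positions around the valley \<open>S!p >= r!p > y\<close>, so
  non-strictness can only come from \<open>strictB\<close>. This yields a descent of
  \<open>S\<close> into \<open>p\<close>, and then \<open>lower_cond\<close> with
  \<open>i = j = p\<close> is violated.\<close>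

lemma (in bump_frame) replace_right_not_adjacent:
  assumes yc: "y < r!p" and q: "lower_cond r v S y" and n: "\<not> strict r v S p (corner r S v p q) y"
    and lt: "below_next r S q (r!p)" and le: "q \<le> length S \<longrightarrow> r!p \<le> S!(q - 1)"
  shows "\<not> (Suc p = v \<and> q = v)"
proof
  assume k: "Suc p = v \<and> q = v"
  then have v1: "v - 1 = p" by auto
  have "corner r S v p q = r!p" using k lt by (auto simp: corner_def)
  then have nB: "\<not> strictB S p y" using n k le v1 yc unfolding strict_def by auto
  then obtain i where i: "i < length S" "p \<le> i" "p = 0 \<or> S!i < S!(p - 1)" "y \<le> S!i" unfolding strictB_def by (auto simp: not_less)
  then have pl: "p < length S" "r!p \<le> S!p" using le k v1 by auto
  have Q: "1 \<le> p \<and> (p < length S \<and> S!p < S!(p - 1) \<longrightarrow> S!(p - 1) \<le> S!j)" if "j < length S" "y < S!j" for j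
    using q that k pv unfolding lower_cond_def by blast
  have p1: "1 \<le> p" using Q[of p] pl yc by auto
  then have "S!i < S!(p - 1)" using i by auto
  moreover have "p - 1 < i" using p1 i by linarith
  ultimately have "S!p < S!(p - 1)" using S_desc'[of "p - 1" i] i p1 by auto
  then show False using Q[of p] pl yc by auto
qed

lemma step_source:
  assumes vs: "S = [] \<or> (\<exists>w. vee S w)" and st: "step S R a y r"
  shows "is_source S R a"
proof -
  obtain v p q where f: "bump_frame r S v p q" "y < r!p" "Suc p < v \<longrightarrow> r!Suc p \<le> y" "upper_cond r v S y" "lower_cond r v S y" "a = r!q"
    "R = uninsert r S v p q y" using st unfolding step_def by blast
  interpret bump_frame r S v p q by (rule f(1))
  have yk: "Suc p < v \<Longrightarrow> r!Suc p \<le> y" using f by auto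
  have crn: "uu = corner r S v p q" by (simp add: corner_def)
  have pq: "p < q" using pv vq by simp
  \<comment> \<open>An ascent whose top exceeds \<open>a\<close> shows at once that the row has an
    increasing part and that its last entry exceeds \<open>a\<close>.\<close>
  have asc: "is_source S R a" if R: "vee R u" "ok R S" "length R = length r" and i: "i < j" "j < length r" "R!i < R!j" "a < R!j" for u i j
  proof -
    have uj: "u < j" using veeD(2)[OF R(1), of i j] i by (meson leI not_less_iff_gr_or_eq)
    then have "R!j \<le> last R"
    proof -
      have ne: "R \<noteq> []" using R i by auto
      have "j = length R - 1 \<or> (j < length R - 1 \<and> length R - 1 < length R)" using i R(3) by linarith
      then have "R!j \<le> R!(length R - 1)"
        using veeD(3)[OF R(1), of j "length R - 1"] uj by auto
      then show ?thesis using last_conv_nth[OF ne] by simp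
    qed
    then show ?thesis unfolding is_source_def using R uj i by (intro exI[of _ u]) auto
  qed
  show ?thesis
  proof (cases "strict r v S p (corner r S v p q) y")
    case st: True
    show ?thesis
    proof (cases "below_next r S q (r!p)")
      case lt: True
      then have R: "R = r[p := y, q := r!p]" using f(7) st by (simp add: uninsert_def)
      have st': "strict r v S p uu y" using st crn by simp
      obtain u where u: "vee R u" "ok R S" using replace_both_ok[OF f(2) yk f(4) lt st'] R by blast
      show ?thesis using asc[OF u, of p q] R f pq qk ac by (auto simp: nth_list_update)
    next
      case lt: False
      then have R: "R = r[p := y]" using f(7) st by (simp add: uninsert_def)
      have st': "strict r v S p (r!v) y" using st lt by (simp add: corner_def)
      obtain u where u: "vee R u" "ok R S" using replace_left_ok[OF f(2) yk f(4) st'] R by blast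
      have sq: "Suc q < length r" using lt oL unfolding below_next_def by auto
      show ?thesis using asc[OF u, of q "Suc q"] R f pq sq U[of q "Suc q"] vq by (auto simp: nth_list_update)
    qed
  next
    case st: False
    show ?thesis
    proof (cases "below_next r S q (r!p) \<and> (q \<le> length S \<longrightarrow> r!p \<le> S!(q - 1))")
      case G: True
      then have R: "R = r[q := r!p]" using f(7) st by (simp add: uninsert_def)
      have nk: "\<not> (Suc p = v \<and> q = v)" using replace_right_not_adjacent[OF f(2) f(5) st] G by auto
      obtain u where u: "vee R u" "ok R S" using replace_right_ok[OF _ _ nk] G R by blast
      have "p < q - 1" using nk pq vq pv by linarith
      then show ?thesis using asc[OF u, of "q - 1" q] R f pq qk ac lo[of "q - 1"] by (auto simp: nth_list_update)
    next
      case I: False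
      then have R: "R = r" using f(7) st by (auto simp: uninsert_def)
      show ?thesis
      proof (cases "Suc q < length r")
        case True
        show ?thesis using asc[of v q "Suc q"] R vr okr f True U[of q "Suc q"] vq by auto
      next
        case False
        then have "q \<le> length S" using I oL unfolding below_next_def by auto
        then have "length r = Suc (length S)" "q = length r - 1" using False oL qk by auto
        moreover have "S \<noteq> []" using pq \<open>q \<le> length S\<close> by auto
        moreover have "r \<noteq> []" using qk by auto
        ultimately show ?thesis unfolding is_source_def using R vr okr f last_conv_nth[of r] by auto
      qed
    qed
  qed
qed

text \<open>If \<open>r!i <= r!Suc q\<close>, then (iv) bounds \<open>S!q\<close> from below by
  \<open>r!i\<close> as well whenever this entry exists, and \<open>r!p < r!i\<close> would make
  \<open>below_next\<close> true.\<close>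

lemma (in bump_frame) not_lt_pre:
  assumes "\<not> below_next r S q (r!p)" "i < p"
  shows "Suc q < length r" "r!Suc q < r!i"
proof -
  show 1: "Suc q < length r" using assms(1) oL unfolding below_next_def by auto
  show "r!Suc q < r!i"
  proof (rule ccontr)
    assume n: "\<not> r!Suc q < r!i"
    then show False using assms pre[of i] oD[of i q] pv vq unfolding below_next_def by auto
  qed
qed

lemma step_admissible:
  assumes st: "step S R a y r" and Q: "vee Q t"
  shows "admissible Q R a \<longleftrightarrow> ok Q r"
proof -
  obtain v p q where f: "bump_frame r S v p q" "y < r!p" "Suc p < v \<longrightarrow> r!Suc p \<le> y" "a = r!q"
    "R = uninsert r S v p q y" using st unfolding step_def by blast
  interpret bump_frame r S v p q by (rule f(1))
  have pq: "p < q" using pv vq by simp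
  note AO = admissible_iff_ok[OF vr pv vq qk ac ce _ _ _ _ _ _ _ _ _ Q]
  show ?thesis
  proof (cases "strict r v S p (corner r S v p q) y")
    case st: True
    then have sp: "Suc p < v \<Longrightarrow> r!Suc p < y" by (simp add: strict_def)
    show ?thesis
    proof (cases "below_next r S q (r!p)")
      case lt: True
      then have R: "R = r[p := y, q := r!p]" using f(5) st by (simp add: uninsert_def)
      have "admissible Q R (r!q) \<longleftrightarrow> ok Q r"
        by (rule AO[where x = q]) (use R f sp pq qk pre in \<open>auto simp: nth_list_update\<close>)
      then show ?thesis using f by simp
    next
      case lt: False
      then have R: "R = r[p := y]" using f(5) st by (simp add: uninsert_def)
      have sq: "Suc q < length r" using lt oL unfolding below_next_def by auto
      \<comment> \<open>Since \<open>r!p\<close> is lost here, its right neighbour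
        \<open>r!Suc q\<close> serves as the replacement; \<open>not_lt_pre\<close> compares it with
        the entries left of \<open>p\<close>.\<close>
      have "admissible Q R (r!q) \<longleftrightarrow> ok Q r"
        by (rule AO[where x = "Suc q"]) (use R f sp pq qk sq ce not_lt_pre[OF lt] in \<open>auto simp: nth_list_update\<close>)
      then show ?thesis using f by simp
    qed
  next
    case st: False
    have sp: "Suc p < v \<Longrightarrow> r!Suc p < r!p" using D by auto
    have "R = r[q := r!p] \<or> R = r" using f(5) st by (auto simp: uninsert_def)
    then have "admissible Q R (r!q) \<longleftrightarrow> ok Q r"
    proof
      assume R: "R = r[q := r!p]"
      show ?thesis by (rule AO[where x = p]) (use R f sp pq qk pre in \<open>auto simp: nth_list_update\<close>)
    next
      assume R: "R = r"
      show ?thesis by (rule AO[where x = p]) (use R f sp pq qk pre in \<open>auto simp: nth_list_update\<close>)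
    qed
    then show ?thesis using f by simp
  qed
qed

text \<open>The displaced \<open>R!q\<close> already occurs at \<open>p\<close> in the decreasing
  part and therefore displaces nothing there. The letter passed on is the one supplied by
  \<open>nonstrict_exists\<close>.\<close>

lemma replace_right_conv:
  fixes R S u p q a
  defines "r \<equiv> R[q := a]"
  assumes vR: "vee R u" and vs: "S = [] \<or> (\<exists>w. vee S w)" and okR: "ok R S"
    and uq: "u < q" and qk: "q < length R" and aq: "a < R!q" and pu: "p < u" and pc: "R!p = R!q"
    and hq: "Suc u < q \<Longrightarrow> R!(q - 1) < a" and hm: "q = Suc u \<Longrightarrow> a \<noteq> R!u"
  shows "\<exists>y. step S R a y r"
proof -
  note D = veeD(2)[OF vR] and U = veeD(3)[OF vR]
  note oL = okD(1)[OF okR] and oA = okD(2)[OF okR] and oB = okD(3)[OF okR] and oC = okD(4)[OF okR] and oD = okD(5)[OF okR]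
  have pq: "p < q" using pu uq by simp
  have len: "length r = length R" by (simp add: r_def)
  have nr: "i < length R \<Longrightarrow> r!i = (if i = q then a else R!i)" for i
    by (simp add: r_def nth_list_update)
  have rp: "r!p = R!q" and rq: "r!q = a" using nr pq qk pc by auto
  have hi: "q < i \<Longrightarrow> i < length R \<Longrightarrow> R!q < R!i" for i using U[of q i] uq by auto
  have Shi: "q \<le> j \<Longrightarrow> j < length S \<Longrightarrow> R!q < S!j" for j
    using oC[of j] U[of j "Suc j"] hi[of j] uq oL by (cases "j = q") auto
  define v where "v = (if q = Suc u \<and> a < R!u then Suc u else u)"
  have pv: "p < v" and vq: "v \<le> q" using pu uq by (auto simp: v_def)
  have vr: "vee r v"
  proof (rule veeI)
    show "v < length r" using vq qk len by simp
  next
    fix i assume i: "i < v"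
    then have iu: "i \<le> u" by (auto simp: v_def split: if_splits)
    have k: "i < length R" "Suc i < length R" using i vq qk by auto
    show "r!Suc i < r!i"
    proof (cases "Suc i = q")
      case True
      then have "q = Suc u" "i = u" using iu uq by auto
      then have "a < R!u" using i by (auto simp: v_def split: if_splits)
      then show ?thesis using nr[OF k(1)] nr[OF k(2)] True uq \<open>i = u\<close> by auto
    next
      case False
      have "Suc i \<le> u" using i False iu by (auto simp: v_def split: if_splits)
      then show ?thesis
        using nr[OF k(1)] nr[OF k(2)] False D[of i "Suc i"] iu uq by auto
    qed
  next
    fix i assume i: "v \<le> i" "Suc i < length r"
    have k: "i < length R" "Suc i < length R" using i len by auto
    have iu: "u \<le> i" using i by (auto simp: v_def split: if_splits)
    have "Suc i = q \<Longrightarrow> R!i < a" using hq hm i iu by (cases "i = u") (auto simp: v_def split: if_splits)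
    then show "r!i < r!Suc i" using nr[OF k(1)] nr[OF k(2)] aq U[of i "Suc i"] iu k by auto
  qed
  have okr: "ok r S"
  proof (rule okI)
    show "length S < length r" using oL len by simp
    show "S!j < r!0" if "j < length S" for j
      using that oA[of j] nr[of 0] pq qk by (cases "R = []") auto
    show False if h: "i < j" "j < length S" "r!Suc i \<le> S!j" "S!j < S!i" for i j
    proof -
      have k: "Suc i < length R" using h oL by auto
      have "Suc i = q \<Longrightarrow> R!Suc i \<le> S!j" using Shi[of j] h by auto
      then have "R!Suc i \<le> S!j" using h nr[OF k] by (auto split: if_splits)
      then show False using oB h by fastforce
    qed
    show "r!j < S!j" if h: "j < length S" "r!j < r!Suc j" for j
    proof -
      have k: "j < length R" "Suc j < length R" using h oL by auto
      then show ?thesis using h nr[OF k(1)] nr[OF k(2)] Shi[of j] aq oC[of j] by (auto split: if_splits)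
    qed
    show "r!i \<le> S!j" if h: "i \<le> j" "j < length S" "r!i \<le> r!Suc j" for i j
    proof -
      have k: "i < length R" "Suc j < length R" using h oL by auto
      show ?thesis
      proof (cases "q \<le> j")
        case True
        then show ?thesis using h nr[OF k(1)] nr[OF k(2)] Shi[of j] aq oD[of i j] by (auto split: if_splits)
      next
        case False
        then show ?thesis using h nr[OF k(1)] nr[OF k(2)] oD[of i j] aq by (auto split: if_splits)
      qed
    qed
  qed
  have lt: "below_next r S q (r!p)" unfolding below_next_def using rp hi[of "Suc q"] nr[of "Suc q"] Shi[of q] len pq by auto
  have le: "q \<le> length S \<longrightarrow> r!p \<le> S!(q - 1)" using oD[of p "q - 1"] pq pc rp by auto
  interpret bump_frame r S v p q
    by unfold_locales (use vr vs okr pv vq qk len rp rq aq hi[of "Suc q"] nr[of "Suc q"] pq in auto)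
  obtain y where y: "y < r!p" "Suc p < v \<longrightarrow> r!Suc p \<le> y" "upper_cond r v S y" "lower_cond r v S y" "\<not> strict r v S p uu y"
  proof -
    have "\<exists>y. y < r!p \<and> (Suc p < v \<longrightarrow> r!Suc p \<le> y) \<and> upper_cond r v S y \<and> lower_cond r v S y \<and> \<not> strict r v S p uu y"
    proof (rule nonstrict_exists)
      show "r!Suc p \<le> S!(q - 1)" if "q \<le> length S" "Suc p < v"
        using le that lo[of "Suc p"] vq by auto
      show "v \<le> length S \<and> S!(v - 1) < r!p" if "Suc p = v" "q = v"
      proof -
        have "v \<le> Suc u" by (simp add: v_def)
        then have False using that pu uq by linarith
        then show ?thesis ..
      qed
    qed
    then show thesis using that by blast
  qed
  have "R = r[q := r!p]" using rp qk by (simp add: r_def list_update_overwrite list_update_id)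
  then have "R = uninsert r S v p q y" using y(5) lt le by (simp add: uninsert_def corner_def)
  then show ?thesis unfolding step_def using y bump_frame_axioms rq by blast
qed

section \<open>From the source of a step to its target\<close>

lemma least_index:
  assumes "\<exists>i<n. P (i::nat)"
  obtains i where "i < n" "P i" "\<And>j. j < i \<Longrightarrow> \<not> P j"
proof -
  obtain k where k: "k < n" "P k" using assms by blast
  have "(LEAST i. P i) \<le> k" using k(2) by (rule Least_le)
  then have "(LEAST i. P i) < n" using k(1) by simp
  then show thesis using that LeastI[of P, OF k(2)] not_less_Least[of _ P] by blast
qed

lemma list_update_back:
  assumes "p \<noteq> q" shows "R[p := b, q := a, p := R!p, q := R!q] = R"
proof -
  have "R[p := b, q := a, p := R!p] = R[p := b, p := R!p, q := a]" using assms by (metis list_update_swap)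
  then show ?thesis by simp
qed

text \<open>The forward rule. If \<open>a\<close> does not occur in the increasing part, it
  displaces the first larger entry there. If it does, the row stays as it is or only an entry on the
  left is replaced, except when \<open>a\<close> is the valley and is exchanged with its right
  neighbour.\<close>

lemma source_step:
  assumes vs: "S = [] \<or> (\<exists>w. vee S w)" and src: "is_source S R a"
  shows "\<exists>y r. step S R a y r"
proof -
  obtain u where vR: "vee R u" and okR: "ok R S" and s: "Suc u < length R \<and> a < last R \<or> S \<noteq> [] \<and> length R = Suc (length S) \<and> a = last R"
    using src unfolding is_source_def by blast
  note D = veeD(2)[OF vR] and U = veeD(3)[OF vR]
  note oL = okD(1)[OF okR] and oA = okD(2)[OF okR] and oB = okD(3)[OF okR] and oC = okD(4)[OF okR] and oD = okD(5)[OF okR]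
  have uk: "u < length R" using veeD(1)[OF vR] .
  have lastR: "last R = R!(length R - 1)" using uk by (cases R rule: rev_cases) auto
  have D': "i \<le> j \<Longrightarrow> j \<le> u \<Longrightarrow> R!j \<le> R!i" for i j using D[of i j] by (cases "i = j") auto
  show ?thesis
  proof (cases "\<exists>q. u \<le> q \<and> q < length R \<and> R!q = a")
    case True
    then obtain q where q: "u \<le> q" "q < length R" "R!q = a" by blast
    \<comment> \<open>\<open>P p\<close> says that \<open>p\<close> and \<open>q\<close> form a
      frame in which \<open>R\<close> is its own result, the last case of
      \<open>uninsert\<close>.\<close>
    define P where "P p \<longleftrightarrow> p < u \<and> a < R!p \<and> (Suc q < length R \<longrightarrow> R!p \<le> R!Suc q) \<and>
       (\<not> below_next R S q (R!p) \<or> (q \<le> length S \<and> S!(q - 1) < R!p))" for p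
    show ?thesis
    proof (cases "\<exists>p. P p")
      case True
      \<comment> \<open>The greatest such \<open>p\<close> is taken because of the first hypothesis
        of \<open>nonstrict_exists\<close>: if it failed, \<open>Suc p\<close> would satisfy
        \<open>P\<close> too.\<close>
      then have "\<exists>p. P p \<and> (\<forall>p'. P p' \<longrightarrow> p' \<le> p)"
        using ex_has_greatest_nat[of P _ "\<lambda>x. x" u] by (metis P_def less_imp_le)
      then obtain p where p: "P p" "\<And>p'. P p' \<Longrightarrow> p' \<le> p" by blast
      interpret bump_frame R S u p q
        by unfold_locales (use vR vs okR p q in \<open>auto simp: P_def\<close>)
      have "\<exists>y. y < R!p \<and> (Suc p < u \<longrightarrow> R!Suc p \<le> y) \<and> upper_cond R u S y \<and> lower_cond R u S y \<and> \<not> strict R u S p uu y"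
      proof (rule nonstrict_exists)
        show "R!Suc p \<le> S!(q - 1)" if h: "q \<le> length S" "Suc p < u"
        proof (rule ccontr)
          assume n: "\<not> R!Suc p \<le> S!(q - 1)"
          have "a < R!Suc p"
          proof (rule ccontr)
            assume "\<not> a < R!Suc p"
            then show False using oD[of "Suc p" "q - 1"] h q n by auto
          qed
          moreover have "R!Suc p < R!p" using D[of p "Suc p"] h by auto
          ultimately have "P (Suc p)" using p(1) h n unfolding P_def by auto
          then show False using p(2) by fastforce
        qed
        show "u \<le> length S \<and> S!(u - 1) < R!p" if "Suc p = u" "q = u" "below_next R S q (R!p)"
          using p(1) that unfolding P_def by auto
      qed
      then obtain y where y: "y < R!p" "Suc p < u \<longrightarrow> R!Suc p \<le> y" "upper_cond R u S y" "lower_cond R u S y" "\<not> strict R u S p uu y" by blast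
      have "R = uninsert R S u p q y" using y(5) p(1) unfolding P_def by (auto simp: uninsert_def corner_def)
      then show ?thesis unfolding step_def using y bump_frame_axioms q by blast
    next
      case noP: False
      \<comment> \<open>If \<open>q\<close> were the last position, the next row would be only one
        cell shorter, and (i) would give \<open>P 0\<close>.\<close>
      have sq: "Suc q < length R"
      proof (rule ccontr)
        assume "\<not> Suc q < length R"
        then have ql: "q = length R - 1" using q by auto
        then have l: "S \<noteq> []" "length R = Suc (length S)" using s lastR q by auto
        then have qS: "q = length S" "0 < length S" using ql by auto
        have s0: "S!(q - 1) < R!0" using oA[of "q - 1"] qS by auto
        have a0: "a < R!0"
        proof (rule ccontr)
          assume "\<not> a < R!0"
          then show False using oD[of 0 "q - 1"] qS q s0 by auto
        qed
        have "0 < u" using ok_valley_pos[OF vR okR l(1)] .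
        then have "P 0" using s0 a0 qS ql \<open>\<not> Suc q < length R\<close> unfolding P_def by auto
        then show False using noP by blast
      qed
      have aE: "a < R!Suc q" using U[of q "Suc q"] q sq by auto
      have "R!u \<le> R!q" using U[of u q] q by (cases "u = q") auto
      then have "\<exists>i<Suc u. R!i < R!Suc q" using aE q by auto
      then obtain p where p: "p < Suc u" "R!p < R!Suc q" "\<And>j. j < p \<Longrightarrow> \<not> R!j < R!Suc q"
        by (rule least_index) blast
      have pc': "R!Suc q < R!(p - 1)" if "0 < p"
      proof -
        have "\<not> R!(p - 1) < R!Suc q" using p(3) that by auto
        moreover have "R!(p - 1) \<noteq> R!Suc q"
        proof
          assume e: "R!(p - 1) = R!Suc q"
          have "P (p - 1)" unfolding P_def below_next_def using e aE sq p(1) that by auto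
          then show False using noP by blast
        qed
        ultimately show ?thesis by auto
      qed
      show ?thesis
      proof (cases "p < q")
        case pq: True
        have lp: "(q \<le> length S \<longrightarrow> R!p \<le> S!(q - 1)) \<and> (q < length S \<longrightarrow> R!p < S!q)"
        proof (cases "R!p \<le> a")
          case True
          have "R!p \<le> S!(q - 1)" if "q \<le> length S" using oD[of p "q - 1"] that pq True q by auto
          moreover have "R!p < S!q" if "q < length S" using oC[of q] that aE q True by auto
          ultimately show ?thesis by blast
        next
          case False
          have "p \<noteq> u" using False U[of u q] q by (cases "u = q") auto
          then have "p < u" using p by auto
          moreover have "\<not> P p" using noP by blast
          ultimately have "\<not> (\<not> below_next R S q (R!p) \<or> (q \<le> length S \<and> S!(q - 1) < R!p))"
            using False p(2) unfolding P_def by auto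
          then show ?thesis unfolding below_next_def by auto
        qed
        define E where "E = (if q < length S then min (R!Suc q) (S!q) else R!Suc q)"
        have "\<exists>v. bump_frame (R[p := E]) S v p q \<and> R!p < R[p := E]!p \<and> (Suc p < v \<longrightarrow> R[p := E]!Suc p \<le> R!p) \<and> upper_cond (R[p := E]) v S (R!p) \<and> lower_cond (R[p := E]) v S (R!p)
          \<and> \<not> below_next (R[p := E]) S q (R[p := E]!p) \<and> strict (R[p := E]) v S p (R[p := E]!v) (R!p)"
          unfolding E_def
          by (rule replace_left_conv[OF vR vs okR q(1) sq]) (use p pq lp pc' in auto)
        then obtain v where v: "bump_frame (R[p := E]) S v p q" "R!p < R[p := E]!p" "Suc p < v \<longrightarrow> R[p := E]!Suc p \<le> R!p" "upper_cond (R[p := E]) v S (R!p)" "lower_cond (R[p := E]) v S (R!p)"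
          "\<not> below_next (R[p := E]) S q (R[p := E]!p)" "strict (R[p := E]) v S p (R[p := E]!v) (R!p)" by blast
        have "R = uninsert (R[p := E]) S v p q (R!p)" using v(6,7) by (simp add: uninsert_def corner_def)
        moreover have "a = R[p := E]!q" using pq q by simp
        ultimately show ?thesis unfolding step_def using v by blast
      next
        case False
        then have e: "p = u" "q = u" using p q by auto
        \<comment> \<open>Here \<open>a\<close> is the valley: it changes places with its right
          neighbour and is also the letter passed on.\<close>
        let ?r = "R[p := R!Suc q, Suc q := a]"
        have "\<exists>v. bump_frame ?r S v p (Suc q) \<and> R!p < ?r!p \<and> (Suc p < v \<longrightarrow> ?r!Suc p \<le> R!p) \<and> upper_cond ?r v S (R!p) \<and> lower_cond ?r v S (R!p)
          \<and> below_next ?r S (Suc q) (?r!p) \<and> strict ?r v S p (if Suc q = v \<and> below_next ?r S (Suc q) (?r!p) then ?r!p else ?r!v) (R!p)"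
          by (rule replace_both_conv[OF vR vs okR]) (use e sq aE pc' p q in auto)
        then obtain v where v: "bump_frame ?r S v p (Suc q)" "R!p < ?r!p" "Suc p < v \<longrightarrow> ?r!Suc p \<le> R!p" "upper_cond ?r v S (R!p)" "lower_cond ?r v S (R!p)"
          "below_next ?r S (Suc q) (?r!p)" "strict ?r v S p (corner ?r S v p (Suc q)) (R!p)" unfolding corner_def by blast
        have "?r!p = R!Suc q" using e sq by simp
        moreover have "?r[p := R!p, Suc q := R!Suc q] = R" using e sq by (intro list_update_back) auto
        ultimately have "R = uninsert ?r S v p (Suc q) (R!p)" using v(6,7) by (simp add: uninsert_def)
        moreover have "a = ?r!Suc q" using sq by simp
        ultimately show ?thesis unfolding step_def using v by blast
      qed
    qed
  next
    case False
    then have al: "a < last R" "Suc u < length R" using s lastR uk by auto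
    have "\<exists>i<length R. u < i \<and> a < R!i"
      using al lastR by (intro exI[of _ "length R - 1"]) auto
    then obtain q where q: "q < length R" "u < q \<and> a < R!q" "\<And>j. j < q \<Longrightarrow> \<not> (u < j \<and> a < R!j)"
      by (rule least_index) blast
    have hq: "R!(q - 1) < a" if uq: "Suc u < q"
    proof -
      obtain q' where q': "q = Suc q'" "u < q'" using uq by (cases q) auto
      then have "\<not> a < R!q'" "R!q' \<noteq> a" using q(3)[of q'] False q(1) by auto
      then show ?thesis using q' by auto
    qed
    have hm: "a \<noteq> R!u" using False uk by auto
    have "\<exists>i<Suc u. R!i < R!q" using U[of u q] q by auto
    then obtain p where p: "p < Suc u" "R!p < R!q" "\<And>j. j < p \<Longrightarrow> \<not> R!j < R!q"
      by (rule least_index) blast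
    show ?thesis
    proof (cases "0 < p \<and> R!(p - 1) = R!q")
      case True
      have "\<exists>y. step S R a y (R[q := a])"
        by (rule replace_right_conv[OF vR vs okR, of q a "p - 1"]) (use q p True hq hm in auto)
      then show ?thesis by blast
    next
      case False
      let ?r = "R[p := R!q, q := a]"
      have pc': "R!q < R!(p - 1)" if "0 < p" using p(3)[of "p - 1"] that False by auto
      have "\<exists>v. bump_frame ?r S v p q \<and> R!p < ?r!p \<and> (Suc p < v \<longrightarrow> ?r!Suc p \<le> R!p) \<and> upper_cond ?r v S (R!p) \<and> lower_cond ?r v S (R!p)
          \<and> below_next ?r S q (?r!p) \<and> strict ?r v S p (if q = v \<and> below_next ?r S q (?r!p) then ?r!p else ?r!v) (R!p)"
        by (rule replace_both_conv[OF vR vs okR]) (use q p hq hm pc' in auto)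
      then obtain v where v: "bump_frame ?r S v p q" "R!p < ?r!p" "Suc p < v \<longrightarrow> ?r!Suc p \<le> R!p" "upper_cond ?r v S (R!p)" "lower_cond ?r v S (R!p)"
          "below_next ?r S q (?r!p)" "strict ?r v S p (corner ?r S v p q) (R!p)" unfolding corner_def by blast
      have pq: "p \<noteq> q" "p < length R" using p q by auto
      have "?r!p = R!q" "?r!q = a" using pq q by (auto simp: nth_list_update)
      moreover have "?r[p := R!p, q := R!q] = R" using pq q by (intro list_update_back) auto
      ultimately have "R = uninsert ?r S v p q (R!p)" using v(6,7) by (simp add: uninsert_def)
      moreover have "a = ?r!q" using q by simp
      ultimately show ?thesis unfolding step_def using v by blast
    qed
  qed
qed

text \<open>Reads the two positions off \<open>(R, a)\<close> without reference to the target: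
  \<open>q\<close> is the first top of an ascent that exceeds \<open>a\<close>, all earlier tops
  being smaller than \<open>a\<close>, and \<open>p\<close> is the first entry not above
  \<open>R!q\<close>. The last clause records what happens when \<open>a\<close> is the
  valley.\<close>

definition right_bump :: "nat list \<Rightarrow> nat \<Rightarrow> nat \<Rightarrow> nat \<Rightarrow> bool" where
  "right_bump R a p q \<longleftrightarrow> p < q \<and> q < length R \<and> R!(q - 1) < R!q \<and> a < R!q
     \<and> (\<forall>i. 0 < i \<and> i < q \<and> R!(i - 1) < R!i \<longrightarrow> R!i < a) \<and> R!p \<le> R!q \<and> (\<forall>i<p. R!q < R!i)
     \<and> (\<forall>u. vee R u \<and> R!u = a \<longrightarrow> p = u)"

lemma right_bump_unique:
  assumes "right_bump R a p q" "right_bump R a p' q'" shows "p = p' \<and> q = q'"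
proof -
  have Q: "q \<le> q'" if "right_bump R a p q" "right_bump R a p' q'" for p q p' q'
  proof (rule ccontr)
    assume "\<not> q \<le> q'"
    then have "R!q' < a" using that unfolding right_bump_def by (metis gr_implies_not0 linorder_not_le not_gr0)
    then show False using that unfolding right_bump_def by auto
  qed
  have q: "q = q'" using Q[OF assms] Q[OF assms(2,1)] by simp
  have P: "p \<le> p'" if "right_bump R a p q" "right_bump R a p' q" for p p'
  proof (rule ccontr)
    assume "\<not> p \<le> p'"
    then have "R!q < R!p'" using that unfolding right_bump_def by auto
    then show False using that unfolding right_bump_def by auto
  qed
  show ?thesis using P[of p p'] P[of p' p] assms q by auto
qed

text \<open>All tops of ascents before \<open>q\<close> are smaller than \<open>a\<close>, so
  \<open>a\<close> can occur in the increasing part only as the valley directly before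
  \<open>q\<close>.\<close>

lemma right_bump_valley:
  assumes right_bump: "right_bump R a p q" and v: "vee R u" and x: "u \<le> x" "x < length R" "R!x = a"
  shows "x = u \<and> p = u \<and> q = Suc u"
proof -
  note D = veeD(2)[OF v] and U = veeD(3)[OF v]
  have g: "p < q" "q < length R" "R!(q - 1) < R!q" "a < R!q" "\<And>i. 0 < i \<Longrightarrow> i < q \<Longrightarrow> R!(i - 1) < R!i \<Longrightarrow> R!i < a"
    "\<And>u. vee R u \<Longrightarrow> R!u = a \<Longrightarrow> p = u" using right_bump unfolding right_bump_def by blast+
  have uq: "u < q" using D[of "q - 1" q] g by (cases "u < q") auto
  have xq: "x < q"
  proof (rule ccontr)
    assume "\<not> x < q"
    then have "R!q \<le> R!x" using U[of q x] uq x by (cases "x = q") auto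
    then show False using g x by auto
  qed
  have "x = u"
  proof (rule ccontr)
    assume "x \<noteq> u"
    then have "0 < x" "R!(x - 1) < R!x" using x U[of "x - 1" x] by auto
    then show False using g(5)[of x] xq x by auto
  qed
  moreover have "q = Suc x"
  proof (rule ccontr)
    assume "q \<noteq> Suc x"
    then have "Suc x < q" using xq by simp
    moreover have "R!x < R!Suc x" using U[of x "Suc x"] x calculation g by auto
    ultimately show False using g(5)[of "Suc x"] x by auto
  qed
  ultimately show ?thesis using g(6)[OF v] x by auto
qed

lemma (in bump_frame) right_bump_frame:
  assumes yc: "y < r!p" and yk: "Suc p < v \<Longrightarrow> r!Suc p \<le> y"
    and R: "R = r[p := y, q := r!p] \<and> (Suc p < v \<longrightarrow> r!Suc p < y) \<or> R = r[q := r!p] \<and> \<not> (Suc p = v \<and> q = v)"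
  shows "right_bump R (r!q) p q"
proof -
  have pq: "p < q" using pv vq by simp
  have len: "length R = length r" using R by auto
  have nR: "R!i = r!i" if "i < length r" "i \<noteq> p" "i \<noteq> q" for i using R that by (auto simp: nth_list_update)
  have Rq: "R!q = r!p" using R qk pq by (auto simp: nth_list_update)
  have Rp: "R!p \<le> r!p" using R yc pq qk by (auto simp: nth_list_update)
  have Rpq: "Suc p = q \<Longrightarrow> R!p < r!p" using R yc pq qk pv vq by (auto simp: nth_list_update)
  have Rps: "Suc p < v \<Longrightarrow> r!Suc p < R!p" using R D[of p "Suc p"] pq qk by (auto simp: nth_list_update)
  have vk: "v < length r" using vq qk by simp
  have dsc: "R!Suc i < R!i" if "Suc i < v" for i
  proof -
    consider "i = p" | "Suc i = p" | "i \<noteq> p" "Suc i \<noteq> p" by blast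
    then show ?thesis
    proof cases
      case 1 then show ?thesis using that Rps nR[of "Suc i"] vq vk by auto
    next
      case 2 then show ?thesis using that Rp pre[of i] nR[of i] vq vk by auto
    next
      case 3 then show ?thesis using that nR[of i] nR[of "Suc i"] D[of i "Suc i"] vq vk by auto
    qed
  qed
  show ?thesis unfolding right_bump_def
  proof (intro conjI allI impI)
    show "p < q" "q < length R" using pq qk len by auto
    show "R!(q - 1) < R!q"
    proof (cases "q - 1 = p")
      case True then show ?thesis using Rpq Rq pq by auto
    next
      case False then show ?thesis using nR[of "q - 1"] lo[of "q - 1"] pq qk Rq by auto
    qed
    show "r!q < R!q" using ac Rq by simp
    show "R!p \<le> R!q" using Rp Rq by simp
  next
    fix i assume i: "0 < i \<and> i < q \<and> R!(i - 1) < R!i"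
    have "v \<le> i" using dsc[of "i - 1"] i by (cases "v \<le> i") auto
    then show "R!i < r!q" using nR[of i] lo2[of i] i pv qk by auto
  next
    fix i assume "i < p" then show "R!q < R!i" using nR[of i] pre[of i] Rq pq qk by auto
  next
    fix u assume u: "vee R u \<and> R!u = r!q"
    have uk: "u < length r" using u veeD(1)[of R u] len by auto
    show "p = u"
    proof (rule ccontr)
      assume pu: "p \<noteq> u"
      have uq: "u \<noteq> q" using u Rq ac by auto
      then have Ru: "R!u = r!u" using nR uk pu by auto
      show False
      proof (cases "v \<le> u")
        case True
        then show False using u Ru uq U[of u q] U[of q u] uk qk vq by (cases "u < q") auto
      next
        case False
        have "R!u < R!Suc u" using u veeD(3)[of R u u "Suc u"] False vk len by auto
        then have "\<not> Suc u < v" using dsc[of u] by auto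
        then have e: "Suc u = v" using False by simp
        have "r!v \<le> r!q" using U[of v q] vq qk by (cases "v = q") auto
        have "Suc u = q"
        proof (rule ccontr)
          assume "Suc u \<noteq> q"
          then have "R!Suc u = r!Suc u" using nR[of "Suc u"] e pv vk by auto
          then show False using \<open>R!u < R!Suc u\<close> Ru D[of u "Suc u"] e by auto
        qed
        then show False using u Ru D[of u q] e by auto
      qed
    qed
  qed
qed

text \<open>The forms of \<open>uninsert\<close> read forwards. Entries are replaced on both sides
  (\<open>N\<close>), only in the increasing part (\<open>G\<close>), only in the decreasing part
  (\<open>A\<close>), or nowhere (\<open>I\<close>).\<close>

lemma step_cases:
  assumes st: "step S R a y r"
  obtains
    (N) v p q where "bump_frame r S v p q" "right_bump R a p q" "R!p < R!q" "y = R!p" "r = R[p := R!q, q := a]"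
  | (G) v p q where "bump_frame r S v p q" "right_bump R a p q" "R!p = R!q" "r = R[q := a]" "y < r!p" "Suc p < v \<longrightarrow> r!Suc p \<le> y"
      "upper_cond r v S y" "lower_cond r v S y" "\<not> strict r v S p (corner r S v p q) y"
  | (A) v p q u where "bump_frame r S v p q" "vee R u" "p \<le> u" "u \<le> q" "R!q = a" "Suc q < length R" "R!p < R!Suc q" "\<And>i. i < p \<Longrightarrow> R!Suc q < R!i"
      "y = R!p" "r = R[p := (if q < length S then min (R!Suc q) (S!q) else R!Suc q)]" "q \<le> length S \<longrightarrow> R!p \<le> S!(q - 1)" "R!p < r!p"
  | (I) v p q where "bump_frame r S v p q" "R = r" "a = r!q" "y < r!p" "Suc p < v \<longrightarrow> r!Suc p \<le> y"
      "upper_cond r v S y" "lower_cond r v S y" "\<not> strict r v S p (corner r S v p q) y" "\<not> (below_next r S q (r!p) \<and> (q \<le> length S \<longrightarrow> r!p \<le> S!(q - 1)))"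
proof -
  obtain v p q where f: "bump_frame r S v p q" "y < r!p" "Suc p < v \<longrightarrow> r!Suc p \<le> y" "upper_cond r v S y" "lower_cond r v S y" "a = r!q"
    "R = uninsert r S v p q y" using st unfolding step_def by blast
  interpret bump_frame r S v p q by (rule f(1))
  have yk: "Suc p < v \<Longrightarrow> r!Suc p \<le> y" using f by auto
  have pq: "p < q" using pv vq by simp
  have quq: "q \<le> length S \<Longrightarrow> y \<le> S!(q - 1)"
    using f(4) vq pv ce f(2) unfolding upper_cond_def by (metis linorder_neqE_nat not_less_eq qk)
  show thesis
  proof (cases "strict r v S p (corner r S v p q) y")
    case st: True
    show thesis
    proof (cases "below_next r S q (r!p)")
      case lt: True
      then have R: "R = r[p := y, q := r!p]" using f(7) st by (simp add: uninsert_def)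
      have "right_bump R (r!q) p q" using right_bump_frame[OF f(2) yk, of R] R st unfolding strict_def by blast
      moreover have "R[p := R!q, q := a] = r"
        using R f(6) pq qk by (intro nth_equalityI) (auto simp: nth_list_update)
      moreover have "R!p = y" "R!q = r!p" using R pq qk by (auto simp: nth_list_update)
      ultimately show thesis using f(2,6) by (intro N[OF f(1)]) auto
    next
      case lt: False
      then have R: "R = r[p := y]" using f(7) st by (simp add: uninsert_def)
      have st': "strict r v S p (r!v) y" using st lt by (simp add: corner_def)
      obtain u where u: "vee R u" using replace_left_ok[OF f(2) yk f(4) st'] R by blast
      have sq: "Suc q < length r" using lt oL unfolding below_next_def by auto
      have E: "r!p = (if q < length S then min (R!Suc q) (S!q) else R!Suc q)"
        using lt R ce sq S_hi[of q] pq unfolding below_next_def by (auto simp: min_def)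
      have nR: "R!i = r!i" if "i \<noteq> p" for i using R that by simp
      have Rp: "R!p = y" using R pq qk by simp
      have uq: "u \<le> q"
      proof (rule ccontr)
        assume "\<not> u \<le> q"
        then have "R!Suc q < R!q" using veeD(2)[OF u, of q "Suc q"] by auto
        then show False using nR[of q] nR[of "Suc q"] U[of q "Suc q"] vq sq pq by auto
      qed
      have pu: "p \<le> u"
      proof (rule ccontr)
        assume n: "\<not> p \<le> u"
        then have "R!(p - 1) < R!p" using veeD(3)[OF u, of "p - 1" p] R pq qk by auto
        then show False using nR[of "p - 1"] pre[of "p - 1"] Rp f(2) n by auto
      qed
      have "r = R[p := r!p]" using R by simp
      then have r: "r = R[p := (if q < length S then min (R!Suc q) (S!q) else R!Suc q)]" using E by simp
      show thesis
      proof (rule A[OF f(1) u pu uq _ _ _ _ _ r])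
        show "R!q = a" using nR[of q] pq f by auto
        show "Suc q < length R" using sq R by simp
        show "R!p < R!Suc q" using Rp f(2) ce[OF sq] nR[of "Suc q"] pq by auto
        show "R!Suc q < R!i" if "i < p" for i using not_lt_pre[OF lt that] nR[of i] nR[of "Suc q"] that pq by auto
        show "y = R!p" using Rp by simp
        show "q \<le> length S \<longrightarrow> R!p \<le> S!(q - 1)" using quq Rp by auto
        show "R!p < r!p" using Rp f(2) by simp
      qed
    qed
  next
    case st: False
    show thesis
    proof (cases "below_next r S q (r!p) \<and> (q \<le> length S \<longrightarrow> r!p \<le> S!(q - 1))")
      case g: True
      then have R: "R = r[q := r!p]" using f(7) st by (simp add: uninsert_def)
      have nk: "\<not> (Suc p = v \<and> q = v)" using replace_right_not_adjacent[OF f(2) f(5) st] g by auto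
      have "right_bump R (r!q) p q" using right_bump_frame[OF f(2) yk, of R] R nk by blast
      moreover have "R[q := a] = r" using R f(6) by simp
      moreover have "R!p = R!q" using R pq qk by simp
      ultimately show thesis using f st by (intro G[OF f(1)]) auto
    next
      case i: False
      then have R: "R = r" using f(7) st by (auto simp: uninsert_def)
      then show thesis using f st i by (intro I[OF f(1)]) auto
    qed
  qed
qed

text \<open>\<open>N\<close> and \<open>G\<close> share the positions of \<open>right_bump\<close>
  and differ in whether \<open>R!p\<close> equals \<open>R!q\<close>; every other pair of distinct
  cases is contradictory. In \<open>N\<close> and \<open>A\<close> the letter \<open>y\<close> is
  read off \<open>R\<close>, in \<open>G\<close> and \<open>I\<close> it is unique by
  \<open>nonstrict_unique\<close>.\<close>

lemma step_unique_target:
  assumes s1: "step S R a y r" and s2: "step S R a y' r'"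
  shows "y = y' \<and> r = r'"
proof -
  have NGuniq: "y = y'" if "bump_frame r S v p q" "y < r!p" "Suc p < v \<longrightarrow> r!Suc p \<le> y"
      "upper_cond r v S y" "lower_cond r v S y" "\<not> strict r v S p (corner r S v p q) y"
      "y' < r!p" "Suc p < v \<longrightarrow> r!Suc p \<le> y'"
      "upper_cond r v S y'" "lower_cond r v S y'" "\<not> strict r v S p (corner r S v p q) y'" for r v p q y y'
    using bump_frame.nonstrict_unique[OF that(1), of y y'] bump_frame.nonstrict_unique[OF that(1), of y' y] that
    unfolding corner_def by (meson linorder_neqE_nat)
  have VU: "v = v'" if "bump_frame r S v p q" "bump_frame r S v' p' q'" for r v p q v' p' q'
    using bump_frame.vr[OF that(1)] bump_frame.vr[OF that(2)] vee_unique by blast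
  have NGA: False if "right_bump R a p q" "vee R u" "p' \<le> u" "u \<le> q'" "R!q' = a" "Suc q' < length R" "R!p' < R!Suc q'" "p' < q'" for p q u p' q'
  proof -
    have e: "q' = u" "p = u" "q = Suc u" using right_bump_valley[OF that(1,2,4)] that by auto
    then have "\<not> p' < p" using that(1,7) unfolding right_bump_def by auto
    then show False using e that by auto
  qed
  have NGI: False if "right_bump R a p q" "bump_frame R S v p' q'" "a = R!q'" for p q v p' q'
  proof -
    have e: "q' = v" "p = v" "q = Suc v" using right_bump_valley[OF that(1) bump_frame.vr[OF that(2)] bump_frame.vq[OF that(2)] bump_frame.qk[OF that(2)]] that by auto
    have "Suc q' < length R" using that(1) e unfolding right_bump_def by auto
    then have "R!p' \<le> R!q" using bump_frame.ce[OF that(2)] e by auto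
    then show False using that(1) bump_frame.pv[OF that(2)] e unfolding right_bump_def by (meson leD)
  qed
  \<comment> \<open>In case \<open>A\<close> the value \<open>R!p\<close> fits below the right
    neighbours of \<open>q\<close> and is bounded by \<open>S!(q - 1)\<close>; the same then holds
    for \<open>R!p' <= R!p\<close>, which case \<open>I\<close> denies.\<close>
  have AI: False if A: "vee R u" "p \<le> u" "u \<le> q" "R!q = a" "Suc q < length R" "\<And>i. i < p \<Longrightarrow> R!Suc q < R!i"
      "r = R[p := (if q < length S then min (R!Suc q) (S!q) else R!Suc q)]" "q \<le> length S \<longrightarrow> R!p \<le> S!(q - 1)" "R!p < r!p" "bump_frame r S v0 p q"
    and I: "bump_frame R S v p' q'" "a = R!q'" "\<not> (below_next R S q' (R!p') \<and> (q' \<le> length S \<longrightarrow> R!p' \<le> S!(q' - 1)))" for u p q r v p' q' v0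
  proof -
    have uv: "u = v" using vee_unique[OF A(1) bump_frame.vr[OF I(1)]] .
    have qq: "q' = q" using veeD(3)[OF A(1), of q q'] veeD(3)[OF A(1), of q' q] A(3,4,5) I(2) bump_frame.vq[OF I(1)] bump_frame.qk[OF I(1)] uv
      by (metis Suc_lessD less_irrefl linorder_neqE_nat)
    have pk: "p < length R" using A(2,3,5) by auto
    have "\<not> p' < p" using A(6)[of p'] bump_frame.ce[OF I(1)] qq A(5) by auto
    then have le: "R!p' \<le> R!p" using bump_frame.D[OF I(1), of p p'] bump_frame.pv[OF I(1)] by (cases "p = p'") auto
    have "R!p < R!Suc q" "q < length S \<longrightarrow> R!p < S!q" using A(7,9) pk by (auto split: if_splits)
    then have "below_next R S q (R!p')" "q \<le> length S \<longrightarrow> R!p' \<le> S!(q - 1)" using le A(8) unfolding below_next_def by auto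
    then show False using I(3) qq by auto
  qed
  from s1 show ?thesis
  proof (cases rule: step_cases)
    case 1: (N v p q)
    from s2 show ?thesis
    proof (cases rule: step_cases)
      case (N v' p' q')
      then show ?thesis using right_bump_unique[OF 1(2) N(2)] 1 N by auto
    next
      case (G v' p' q')
      then show ?thesis using right_bump_unique[OF 1(2) G(2)] 1 G by auto
    next
      case (A v' p' q' u')
      have "p' < q'" using bump_frame.pv[OF A(1)] bump_frame.vq[OF A(1)] by simp
      then show ?thesis using NGA[OF 1(2) A(2-7)] by auto
    next
      case (I v' p' q')
      then show ?thesis using NGI[OF 1(2)] by auto
    qed
  next
    case 1: (G v p q)
    from s2 show ?thesis
    proof (cases rule: step_cases)
      case (N v' p' q')
      then show ?thesis using right_bump_unique[OF 1(2) N(2)] 1 N by auto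
    next
      case (G v' p' q')
      then have e: "p = p'" "q = q'" "r = r'" using right_bump_unique[OF 1(2) G(2)] 1 G by auto
      then have "v = v'" using VU 1(1) G(1) by blast
      then show ?thesis using NGuniq[of r v p q y y'] 1 G e by auto
    next
      case (A v' p' q' u')
      have "p' < q'" using bump_frame.pv[OF A(1)] bump_frame.vq[OF A(1)] by simp
      then show ?thesis using NGA[OF 1(2) A(2-7)] by auto
    next
      case (I v' p' q')
      then show ?thesis using NGI[OF 1(2)] by auto
    qed
  next
    case 1: (A v p q u)
    have pq: "p < q" using bump_frame.pv[OF 1(1)] bump_frame.vq[OF 1(1)] by simp
    from s2 show ?thesis
    proof (cases rule: step_cases)
      case (N v' p' q')
      then show ?thesis using NGA[OF N(2) 1(2-7) pq] by auto
    next
      case (G v' p' q')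
      then show ?thesis using NGA[OF G(2) 1(2-7) pq] by auto
    next
      case (A v' p' q' u')
      have uu: "u = u'" using vee_unique[OF 1(2) A(2)] .
      have qq: "q' = q" using veeD(3)[OF 1(2), of q q'] veeD(3)[OF 1(2), of q' q] 1(4,5,6) A(4,5,6) uu
        by (metis Suc_lessD less_irrefl linorder_neqE_nat)
      have "p = p'" using 1(7) 1(8)[of p'] A(7) A(8)[of p] qq by (metis linorder_neqE_nat less_asym)
      then show ?thesis using 1(9,10) A(9,10) qq by auto
    next
      case (I v' p' q')
      then show ?thesis using AI[OF 1(2,3,4,5,6,8,10,11,12,1), of v' p' q'] by auto
    qed
  next
    case 1: (I v p q)
    from s2 show ?thesis
    proof (cases rule: step_cases)
      case (N v' p' q')
      then show ?thesis using NGI[OF N(2)] 1 by auto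
    next
      case (G v' p' q')
      then show ?thesis using NGI[OF G(2)] 1 by auto
    next
      case (A v' p' q' u')
      then show ?thesis using AI[OF A(2,3,4,5,6,8,10,11,12,1), of v p q] 1 by auto
    next
      case (I v' p' q')
      have rr: "r' = r" using 1(2) I(2) by simp
      have f1: "bump_frame r S v p q" and f2: "bump_frame r S v p' q'" using 1(1) I(1) VU[of r v p q v' p' q'] rr by auto
      have vv: "v = v'" using VU 1(1) I(1) rr by blast
      have qq: "q' = q" using bump_frame.U[OF f1, of q q'] bump_frame.U[OF f1, of q' q] 1(3) I(3) rr bump_frame.vq[OF f1] bump_frame.vq[OF f2] bump_frame.qk[OF f1] bump_frame.qk[OF f2]
        by (metis less_irrefl linorder_neqE_nat)
      \<comment> \<open>From \<open>p < p'\<close> follows \<open>r!p' <= y < r!p\<close>, and with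
        \<open>upper_cond\<close> for \<open>y\<close> the value \<open>r!p'\<close> could be
        returned to \<open>q\<close>, contrary to case \<open>I\<close>.\<close>
      have P: False if h: "p < p'" "bump_frame r S v p q" "bump_frame r S v p' q" "upper_cond r v S y" "y < r!p" "Suc p < v \<longrightarrow> r!Suc p \<le> y"
        "\<not> (below_next r S q (r!p') \<and> (q \<le> length S \<longrightarrow> r!p' \<le> S!(q - 1)))" for p p' y
      proof -
        interpret F: bump_frame r S v p q by (rule h(2))
        interpret F': bump_frame r S v p' q by (rule h(3))
        have "r!p' \<le> r!Suc p" using F.D[of "Suc p" p'] F'.pv h(1) by (cases "p' = Suc p") auto
        moreover have "Suc p < v" using F'.pv h(1) by auto
        ultimately have le: "r!p' \<le> y" using h by auto
        have "y \<le> S!(q - 1)" if "q \<le> length S"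
          using h(4) F.vq F.pv F.ce h(5) that unfolding upper_cond_def by (metis linorder_neqE_nat not_less_eq F.qk)
        then show False using h(5,7) le F.ce F.S_hi[of q] unfolding below_next_def by auto
      qed
      have "p = p'" using P[of p p' y] P[of p' p y'] 1 I f1 f2 qq rr vv by (metis linorder_neqE_nat)
      then show ?thesis using NGuniq[of r v p q y y'] 1 I f1 rr qq vv by auto
    qed
  qed
qed

section \<open>The bumping step preserves the 0-Hecke class\<close>

text \<open>
  Demazure operators on windows: applied to \<open>(1, 2, 3, \<dots>)\<close>, a word produces the window of the
  inverse of the signed permutation it represents in the 0-Hecke monoid.
\<close>

definition dem :: "nat \<Rightarrow> (nat \<Rightarrow> int) \<Rightarrow> nat \<Rightarrow> int" where
  "dem i z = (if i = 0 then z(1 := - \<bar>z 1\<bar>)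
     else z(i := max (z i) (z (Suc i)), Suc i := min (z i) (z (Suc i))))"

abbreviation W :: "nat list \<Rightarrow> (nat \<Rightarrow> int) \<Rightarrow> nat \<Rightarrow> int" where "W \<equiv> foldr dem"

abbreviation far :: "nat \<Rightarrow> nat \<Rightarrow> bool" where "far i j \<equiv> i + 2 \<le> j \<or> j + 2 \<le> i"

lemma dem_idem [simp]: "dem i (dem i z) = dem i z"
  by (auto simp: dem_def fun_eq_iff)

lemma dem_comm': "i + 2 \<le> j \<Longrightarrow> dem i (dem j z) = dem j (dem i z)"
  by (auto simp: dem_def fun_eq_iff)

lemma dem_comm: "far i j \<Longrightarrow> dem i (dem j z) = dem j (dem i z)"
  using dem_comm' by metis

lemma dem_braid: "0 < i \<Longrightarrow> dem i (dem (Suc i) (dem i z)) = dem (Suc i) (dem i (dem (Suc i) z))"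
  by (auto simp: dem_def fun_eq_iff max_def min_def)

lemma dem_braid0: "dem 1 (dem 0 (dem 1 (dem 0 z))) = dem 0 (dem 1 (dem 0 (dem 1 z)))"
  by (auto simp: dem_def fun_eq_iff max_def min_def abs_if)

lemma W_far: "(\<And>z. z \<in> set L \<Longrightarrow> far a z) \<Longrightarrow> W L (dem a x) = dem a (W L x)"
  by (induction L) (auto simp: dem_comm)

lemma dem_absorb: "far a c \<Longrightarrow> dem a (dem c (dem a x)) = dem a (dem c x)"
  by (metis dem_comm dem_idem)

text \<open>For letters that are not neighbours both sides collapse by commutation and idempotence,
  so users only have to rule out the pair \<open>0\<close>, \<open>1\<close>.\<close>

lemma dem_braid_any:
  assumes "a < c" "c = Suc a \<Longrightarrow> 0 < a" shows "dem c (dem a (dem c x)) = dem a (dem c (dem a x))"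
proof (cases "c = Suc a")
  case True then show ?thesis using dem_braid assms by simp
next
  case False
  then have "far a c" using assms by auto
  then show ?thesis by (metis dem_comm dem_idem)
qed

text \<open>Valid for the pair \<open>0\<close>, \<open>1\<close> as well, where it is the defining
  relation; for all other pairs the shorter relations imply it.\<close>

lemma dem_braid4:
  assumes "a < c" shows "dem c (dem a (dem c (dem a x))) = dem a (dem c (dem a (dem c x)))"
proof (cases "0 < a")
  case True then show ?thesis using dem_braid_any[OF assms] by (metis dem_idem)
next
  case False
  show ?thesis
  proof (cases "c = 1")
    case True then show ?thesis using dem_braid0 False by auto
  next
    case F: False
    then have "far a c" using assms False by linarith
    then show ?thesis by (metis dem_comm dem_idem)
  qed
qed

section \<open>The 0-Hecke class of a row with replaced entries\<close>

lemma split3: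
  assumes "p < q" "q < length r"
  obtains X Z V where "r = X @ r!p # Z @ r!q # V" "length X = p" "length Z = q - Suc p"
    "\<And>x. x \<in> set X \<Longrightarrow> \<exists>i<p. x = r!i" "\<And>x. x \<in> set Z \<Longrightarrow> \<exists>i. p < i \<and> i < q \<and> x = r!i"
    "\<And>x. x \<in> set V \<Longrightarrow> \<exists>i. q < i \<and> i < length r \<and> x = r!i"
    "Suc p < q \<longrightarrow> Z = r!Suc p # tl Z \<and> (\<forall>x\<in>set (tl Z). \<exists>i. Suc p < i \<and> i < q \<and> x = r!i)"
    "Suc q < length r \<longrightarrow> V = r!Suc q # tl V \<and> (\<forall>x\<in>set (tl V). \<exists>i. Suc q < i \<and> i < length r \<and> x = r!i)"
    "Suc q = length r \<longrightarrow> V = []"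
proof -
  define X where "X = take p r"
  define Z where "Z = take (q - Suc p) (drop (Suc p) r)"
  define V where "V = drop (Suc q) r"
  have r1: "r = take p r @ r!p # drop (Suc p) r" using id_take_nth_drop[of p r] assms by simp
  have d: "drop (Suc p) r = Z @ r!q # V"
    using id_take_nth_drop[of "q - Suc p" "drop (Suc p) r"] assms unfolding Z_def V_def by simp
  have 1: "r = X @ r!p # Z @ r!q # V" using r1 d X_def by simp
  have lX: "length X = p" using assms by (simp add: X_def)
  have lZ: "length Z = q - Suc p" using assms by (simp add: Z_def)
  have nZ: "\<And>j. j < length Z \<Longrightarrow> Z!j = r!(Suc p + j)" using assms lZ by (simp add: Z_def)
  have nV: "\<And>j. j < length V \<Longrightarrow> V!j = r!(Suc q + j)" using assms by (simp add: V_def)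
  have lV: "length V = length r - Suc q" by (simp add: V_def)
  have sX: "\<exists>i<p. x = r!i" if "x \<in> set X" for x using that assms by (auto simp: X_def in_set_conv_nth)
  have sZ: "\<exists>i. p < i \<and> i < q \<and> x = r!i" if "x \<in> set Z" for x
  proof -
    obtain j where "j < length Z" "x = Z!j" using \<open>x \<in> set Z\<close> by (auto simp: in_set_conv_nth)
    then show ?thesis using nZ lZ by (intro exI[of _ "Suc p + j"]) auto
  qed
  have sV: "\<exists>i. q < i \<and> i < length r \<and> x = r!i" if "x \<in> set V" for x
  proof -
    obtain j where "j < length V" "x = V!j" using \<open>x \<in> set V\<close> by (auto simp: in_set_conv_nth)
    then show ?thesis using nV lV by (intro exI[of _ "Suc q + j"]) auto
  qed
  have tZ: "Suc p < q \<longrightarrow> Z = r!Suc p # tl Z \<and> (\<forall>x\<in>set (tl Z). \<exists>i. Suc p < i \<and> i < q \<and> x = r!i)"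
  proof
    assume "Suc p < q"
    then obtain z Z' where Z: "Z = z # Z'" using lZ by (cases Z) auto
    have "\<exists>i. Suc p < i \<and> i < q \<and> x = r!i" if "x \<in> set Z'" for x
    proof -
      obtain j where "j < length Z'" "x = Z'!j" using \<open>x \<in> set Z'\<close> by (auto simp: in_set_conv_nth)
      then show ?thesis using nZ[of "Suc j"] lZ Z by (intro exI[of _ "Suc p + Suc j"]) auto
    qed
    then show "Z = r!Suc p # tl Z \<and> (\<forall>x\<in>set (tl Z). \<exists>i. Suc p < i \<and> i < q \<and> x = r!i)" using nZ[of 0] Z by auto
  qed
  have tV: "Suc q < length r \<longrightarrow> V = r!Suc q # tl V \<and> (\<forall>x\<in>set (tl V). \<exists>i. Suc q < i \<and> i < length r \<and> x = r!i)"
  proof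
    assume "Suc q < length r"
    then obtain z Z' where Z: "V = z # Z'" using lV by (cases V) auto
    have "\<exists>i. Suc q < i \<and> i < length r \<and> x = r!i" if "x \<in> set Z'" for x
    proof -
      obtain j where "j < length Z'" "x = Z'!j" using \<open>x \<in> set Z'\<close> by (auto simp: in_set_conv_nth)
      then show ?thesis using nV[of "Suc j"] lV Z by (intro exI[of _ "Suc q + Suc j"]) auto
    qed
    then show "V = r!Suc q # tl V \<and> (\<forall>x\<in>set (tl V). \<exists>i. Suc q < i \<and> i < length r \<and> x = r!i)" using nV[of 0] Z by auto
  qed
  show thesis using that[OF 1 lX lZ sX sZ sV tZ tV] by (simp add: V_def)
qed

context bump_frame
begin

text \<open>Commutations suffice: \<open>a\<close> moves left over everything after
  \<open>q\<close>, \<open>c\<close> over the middle segment, and \<open>y\<close> over everything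
  before \<open>p\<close>.\<close>

lemma replace_both_hecke:
  assumes yc: "y < r!p" and lt: "below_next r S q (r!p)" and sp: "Suc p < v \<Longrightarrow> r!Suc p < y"
  shows "W (r[p := y, q := r!p] @ [r!q]) z = W (y # r) z"
proof -
  have pq: "p < q" using pv vq by simp
  obtain X Z V where r: "r = X @ r!p # Z @ r!q # V" and lX: "length X = p" and lZ: "length Z = q - Suc p"
    and sX: "\<And>x. x \<in> set X \<Longrightarrow> \<exists>i<p. x = r!i" and sZ: "\<And>x. x \<in> set Z \<Longrightarrow> \<exists>i. p < i \<and> i < q \<and> x = r!i"
    and sV: "\<And>x. x \<in> set V \<Longrightarrow> \<exists>i. q < i \<and> i < length r \<and> x = r!i"
    by (rule split3[OF pq qk]) blast
  define c where "c = r!p" define a where "a = r!q"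
  have r': "r = X @ c # Z @ a # V" using r c_def a_def by simp
  have "r[p := y] = X @ y # Z @ a # V" using r' lX list_update_length by metis
  moreover have "((X @ y # Z) @ a # V)[q := c] = (X @ y # Z) @ c # V"
    using list_update_length[of "X @ y # Z" a V c] lX lZ pq by simp
  ultimately have R: "r[p := y, q := r!p] = X @ y # Z @ c # V" unfolding c_def[symmetric] by simp
  have V: "far a x" if "x \<in> set V" for x
  proof -
    obtain i where i: "q < i" "i < length r" "x = r!i" using sV[OF \<open>x \<in> set V\<close>] by blast
    have "r!p < r!i" using lt i U[of "Suc q" i] vq unfolding below_next_def by (cases "i = Suc q") auto
    then show ?thesis using i ac unfolding a_def by auto
  qed
  have X: "far y x" if "x \<in> set X" for x using sX[OF that] pre yc by fastforce
  have Z: "far c x" if "x \<in> set Z" for x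
  proof -
    obtain i where i: "p < i" "i < q" "x = r!i" using sZ[OF \<open>x \<in> set Z\<close>] by blast
    have "r!i < y \<or> r!i < a"
    proof (cases "i < v")
      case True
      then show ?thesis using sp i D[of "Suc p" i] by (cases "i = Suc p") auto
    next
      case False then show ?thesis using lo2[of i] i unfolding a_def by auto
    qed
    then show ?thesis using i yc ac unfolding a_def c_def by auto
  qed
  have "W (X @ y # Z @ c # V @ [a]) z = W (y # X @ c # Z @ a # V) z"
    using W_far[OF V] W_far[OF X] W_far[OF Z] by simp
  then show ?thesis unfolding R a_def[symmetric] using r' by simp
qed

lemma decomp:
  obtains X Z V where "r = X @ r!p # Z @ r!q # V" "length X = p" "length Z = q - Suc p"
    "\<And>x. x \<in> set X \<Longrightarrow> \<exists>i<p. x = r!i" "\<And>x. x \<in> set Z \<Longrightarrow> \<exists>i. p < i \<and> i < q \<and> x = r!i"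
    "\<And>x. x \<in> set V \<Longrightarrow> \<exists>i. q < i \<and> i < length r \<and> x = r!i"
    "Suc p < q \<longrightarrow> Z = r!Suc p # tl Z \<and> (\<forall>x\<in>set (tl Z). \<exists>i. Suc p < i \<and> i < q \<and> x = r!i)"
    "Suc q < length r \<longrightarrow> V = r!Suc q # tl V \<and> (\<forall>x\<in>set (tl V). \<exists>i. Suc q < i \<and> i < length r \<and> x = r!i)"
    "Suc q = length r \<longrightarrow> V = []"
  by (rule split3[of p q r]) (use pv vq qk in auto)

lemma Zfar:
  assumes "\<And>i. p < i \<Longrightarrow> i < v \<Longrightarrow> r!i + 2 \<le> r!p" "p < i" "i < q"
  shows "r!i + 2 \<le> r!p"
  using assms lo2[of i] ac by (cases "i < v") auto

lemma Vfar:
  assumes "r!p < r!Suc q" "q < i" "i < length r"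
  shows "r!p < r!i"
  using assms U[of "Suc q" i] vq by (cases "i = Suc q") auto

text \<open>(v) puts \<open>S!q\<close> above \<open>r!q\<close>, so (ii) excludes a descent here,
  and neighbours in a unimodal row differ.\<close>

lemma S_adj: "q \<le> length S \<Longrightarrow> q < length S \<Longrightarrow> S!(q - 1) < S!q"
proof -
  assume ql: "q < length S"
  obtain w where w: "vee S w" using vs ql by force
  have q0: "0 < q" using pv vq by simp
  have "r!q < S!q" using oC[of q] U[of q "Suc q"] vq oL ql by auto
  then have le: "S!(q - 1) \<le> S!q" using oB[of "q - 1" q] q0 ql by auto
  show ?thesis
  proof (cases "q \<le> w")
    case True
    then show ?thesis using veeD(2)[OF w, of "q - 1" q] le q0 by auto
  next
    case False
    then show ?thesis using veeD(3)[OF w, of "q - 1" q] q0 ql by auto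
  qed
qed

lemma S_split:
  assumes "q < length S"
  shows "S = take (q - 1) S @ S!(q - 1) # S!q # drop (Suc q) S"
proof -
  have q0: "0 < q" using pv vq by simp
  have "S = take q S @ S!q # drop (Suc q) S" using id_take_nth_drop[OF assms] .
  moreover have "take q S = take (q - 1) S @ [S!(q - 1)]" using take_Suc_conv_app_nth[of "q - 1" S] q0 assms by auto
  ultimately show ?thesis by simp
qed

lemma S_tail_far:
  assumes "S!q < r!Suc q" "x \<in> set (drop (Suc q) S)"
  shows "S!q + 2 \<le> x"
proof -
  obtain j where j: "j < length S - Suc q" "x = S!(Suc q + j)" using assms(2) by (auto simp: in_set_conv_nth)
  let ?i = "Suc q + j"
  have "r!?i < S!?i" using oC[of ?i] U[of ?i "Suc ?i"] vq oL j by auto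
  moreover have "r!Suc q \<le> r!?i"
  proof (cases "j = 0")
    case False
    moreover have "?i < length r" using oL j by linarith
    ultimately show ?thesis using U[of "Suc q" ?i] vq by auto
  qed simp
  ultimately show ?thesis using assms j by auto
qed

text \<open>If \<open>c = e\<close>, this is a braid move between \<open>a\<close> and
  \<open>e\<close>. Otherwise \<open>below_next\<close> fails because \<open>S!q = c\<close>, and
  the copy of \<open>c\<close> missing from the row is supplied by the lower row.\<close>

lemma replace_left_hecke:
  assumes yc: "y < r!p" and lt: "\<not> below_next r S q (r!p)" and st: "strict r v S p (r!v) y" and quy: "upper_cond r v S y"
  shows "W (S @ r[p := y] @ [r!q]) z = W (S @ y # r) z"
proof -
  have sq: "Suc q < length r" using lt oL unfolding below_next_def by auto
  obtain X Z V where r: "r = X @ r!p # Z @ r!q # V" and lX: "length X = p" and lZ: "length Z = q - Suc p"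
    and sX: "\<And>x. x \<in> set X \<Longrightarrow> \<exists>i<p. x = r!i" and sZ: "\<And>x. x \<in> set Z \<Longrightarrow> \<exists>i. p < i \<and> i < q \<and> x = r!i"
    and V: "V = r!Suc q # tl V" and sV: "\<forall>x\<in>set (tl V). \<exists>i. Suc q < i \<and> i < length r \<and> x = r!i"
    by (rule decomp) (use sq in blast)
  define c where "c = r!p" define a where "a = r!q" define e where "e = r!Suc q" define V' where "V' = tl V"
  have r': "r = X @ c # Z @ a # e # V'" using r V c_def a_def e_def V'_def by simp
  have R: "r[p := y] = X @ y # Z @ a # e # V'" using r' lX list_update_length by metis
  have ac': "a < c" and ce': "c \<le> e" using ac ce[OF sq] a_def c_def e_def by auto
  have sp: "Suc p < v \<Longrightarrow> r!Suc p < y" and sm: "Suc p = v \<Longrightarrow> y \<noteq> r!v" using st by (auto simp: strict_def)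
  \<comment> \<open>Excludes the letters \<open>0\<close>, \<open>1\<close> from the braid moves
    below, for which the relation of length three is false.\<close>
  have y0: "0 < y \<or> (y = 0 \<and> 0 < r!v)"
    using sp sm pv by (cases "Suc p = v") auto
  have mq: "r!v \<le> a" using U[of v q] vq qk unfolding a_def by (cases "q = v") auto
  have Z: "far c x \<and> x + 2 \<le> c" if xZ: "x \<in> set Z" for x
  proof -
    obtain i where i: "p < i" "i < q" "x = r!i" using sZ[OF xZ] by blast
    have "r!i + 2 \<le> r!p"
    proof (rule Zfar[OF _ i(1,2)])
      fix i assume "p < i" "i < v"
      then show "r!i + 2 \<le> r!p" using sp D[of "Suc p" i] yc by (cases "i = Suc p") auto
    qed
    then show ?thesis using i unfolding c_def by auto
  qed
  have V': "e < x" if xV: "x \<in> set V'" for x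
  proof -
    obtain i where "Suc q < i" "i < length r" "x = r!i" using sV xV V'_def by blast
    then show ?thesis using U[of "Suc q" i] vq unfolding e_def by auto
  qed
  have Xy: "far y x" if "x \<in> set X" for x using sX[OF that] pre yc by fastforce
  have aV: "far a x" if "x \<in> set V'" for x using V'[OF that] ac' ce' by auto
  show ?thesis
  proof (cases "c = e")
    case True
    have a0: "0 < a" if "e = Suc a" using y0 mq yc True that unfolding c_def by (cases "a = 0") auto
    have "W (X @ y # Z @ a # e # V' @ [a]) z = W (y # X @ c # Z @ a # e # V') z" for z
    proof -
      have 1: "W (X @ y # Z @ a # e # V' @ [a]) z = dem y (W X (W Z (dem a (dem e (dem a (W V' z))))))"
        using W_far[OF aV] W_far[OF Xy] by simp
      have 2: "W (y # X @ c # Z @ a # e # V') z = dem y (W X (W Z (dem c (dem a (dem e (W V' z))))))"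
        using W_far[of Z c] Z by simp
      show ?thesis unfolding 1 2 using dem_braid_any[of a e] a0 ac' True by simp
    qed
    then show ?thesis unfolding R a_def[symmetric] using r' by simp
  next
    case False
    then have ce2: "c < e" using ce' by simp
    then have ql: "q < length S" "S!q \<le> c" using lt sq unfolding below_next_def c_def e_def by auto
    have cS: "c = S!q" using S_hi[of q] ql unfolding c_def by auto
    define b where "b = S!(q - 1)" define S0 where "S0 = take (q - 1) S" define S3 where "S3 = drop (Suc q) S"
    have S: "S = S0 @ b # c # S3" using S_split[OF ql(1)] cS b_def S0_def S3_def by simp
    have S3: "c + 2 \<le> x" if "x \<in> set S3" for x using S_tail_far[of x] that ce2 cS unfolding S3_def e_def by auto
    have X2: "c + 2 \<le> x" if "x \<in> set X" for x
    proof -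
      obtain i where "i < p" "x = r!i" using sX[OF \<open>x \<in> set X\<close>] by blast
      then show ?thesis using not_lt_pre[OF lt, of i] ce2 unfolding e_def by auto
    qed
    have yb: "y \<le> b"
    proof -
      have "y \<le> S!(q - 1)"
        using quy vq pv ce yc ql sq unfolding upper_cond_def by (metis less_imp_le_nat)
      then show ?thesis by (simp add: b_def)
    qed
    have bc: "b < c" using S_adj ql cS b_def by auto
    have far1: "\<And>x. x \<in> set S3 \<Longrightarrow> far c x" "\<And>x. x \<in> set X \<Longrightarrow> far c x" "\<And>x. x \<in> set S3 \<Longrightarrow> far y x"
      using S3 X2 yc c_def by fastforce+
    have ea: "far a e" using ac' ce2 by auto
    have "W (S0 @ b # c # S3 @ X @ y # Z @ a # e # V' @ [a]) z = W (S0 @ b # c # S3 @ y # X @ c # Z @ a # e # V') z" for z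
    proof -
      let ?t = "dem a (dem e (W V' z))"
      have 1: "W (S0 @ b # c # S3 @ X @ y # Z @ a # e # V' @ [a]) z = W S0 (dem b (dem c (dem y (W S3 (W X (W Z ?t))))))"
        using W_far[OF aV] W_far[OF Xy] W_far[OF far1(3)] dem_absorb[OF ea] by simp
      have 2: "W (S0 @ b # c # S3 @ y # X @ c # Z @ a # e # V') z = W S0 (dem b (dem c (dem y (dem c (W S3 (W X (W Z ?t)))))))"
        using W_far[OF far1(1)] W_far[OF far1(2)] W_far[OF far1(3)] by simp
      \<comment> \<open>If \<open>c\<close> and \<open>y\<close> are neighbours, then
        \<open>y = b\<close>, and the letter \<open>b\<close> of the lower row completes the
        braid.\<close>
      have "dem b (dem c (dem y (dem c u))) = dem b (dem c (dem y u))" for u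
      proof (cases "y + 2 \<le> c")
        case True
        then show ?thesis by (metis dem_comm' dem_idem)
      next
        case False
        then have e: "y = b" "c = Suc y" using yb bc yc c_def by auto
        then have "0 < y" using y0 mq ac' by auto
        then show ?thesis using e dem_braid[of y] by (metis dem_idem)
      qed
      then show ?thesis using 1 2 by simp
    qed
    then show ?thesis unfolding R a_def[symmetric] using r' S by simp
  qed
qed

text \<open>The extra letter moves left to \<open>a e\<close>. If these are neighbours,
  \<open>a e a\<close> becomes \<open>e a e\<close>, whose first letter commutes over the middle and
  merges with \<open>c = e\<close>.\<close>

lemma row_absorbs:
  assumes "Suc q < length r \<Longrightarrow> r!Suc q = Suc (r!q) \<Longrightarrow> 0 < r!q \<and> (\<forall>i. p < i \<and> i < v \<longrightarrow> r!i + 2 \<le> r!p)"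
  shows "W (r @ [r!q]) z = W r z"
proof -
  obtain X Z V where r: "r = X @ r!p # Z @ r!q # V" and lX: "length X = p" and lZ: "length Z = q - Suc p"
    and sZ: "\<And>x. x \<in> set Z \<Longrightarrow> \<exists>i. p < i \<and> i < q \<and> x = r!i"
    and V: "Suc q < length r \<longrightarrow> V = r!Suc q # tl V \<and> (\<forall>x\<in>set (tl V). \<exists>i. Suc q < i \<and> i < length r \<and> x = r!i)"
    and V0: "Suc q = length r \<longrightarrow> V = []"
    by (rule decomp) blast
  show ?thesis
  proof (cases "Suc q < length r")
    case False
    then have V: "V = []" using V0 qk by auto
    define c where "c = r!p" define a where "a = r!q"
    have r': "r = X @ c # Z @ [a]" using r V c_def a_def by simp
    have "W (X @ c # Z @ [a] @ [a]) z = W (X @ c # Z @ [a]) z" by simp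
    then show ?thesis unfolding a_def[symmetric] using r' by simp
  next
    case sq: True
    define c where "c = r!p" define a where "a = r!q" define e where "e = r!Suc q" define V' where "V' = tl V"
    have r': "r = X @ c # Z @ a # e # V'" using r V sq c_def a_def e_def V'_def by simp
    have ae: "a < e" using U[of q "Suc q"] vq sq a_def e_def by auto
    have aV: "far a x" if xV: "x \<in> set V'" for x
    proof -
      obtain i where "Suc q < i" "i < length r" "x = r!i" using V sq xV V'_def by blast
      then show ?thesis using U[of "Suc q" i] vq ae unfolding e_def by auto
    qed
    have "W (X @ c # Z @ a # e # V' @ [a]) z = W (X @ c # Z @ a # e # V') z"
    proof (cases "e = Suc a")
      case False
      then have "far a e" using ae by auto
      then show ?thesis using W_far[OF aV] dem_absorb[of a e] by simp
    next
      case True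
      then have h: "0 < a" "\<And>i. p < i \<Longrightarrow> i < v \<Longrightarrow> r!i + 2 \<le> r!p" using assms sq unfolding a_def e_def by auto
      have ce': "c = e" using ce[OF sq] ac True unfolding a_def c_def e_def by auto
      have Z: "far c x" if xZ: "x \<in> set Z" for x
      proof -
        obtain i where i: "p < i" "i < q" "x = r!i" using sZ[OF xZ] by blast
        then show ?thesis using Zfar[OF h(2)] unfolding c_def by auto
      qed
      show ?thesis using W_far[OF aV] W_far[OF Z] dem_braid[OF h(1)] True ce' by (simp add: dem_braid[symmetric])
    qed
    then show ?thesis unfolding a_def[symmetric] using r' by simp
  qed
qed

text \<open>Here \<open>y\<close> is the right neighbour of \<open>r!p\<close>; the two copies of
  \<open>c\<close> are brought together around it, and \<open>c y c\<close> becomes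
  \<open>y c y\<close>.\<close>

lemma replace_right_hecke_naive:
  assumes lt: "below_next r S q (r!p)" and y: "Suc p < v \<and> y = r!Suc p \<or> Suc p = v \<and> y = r!v \<and> v < q"
  shows "W (r[q := r!p] @ [r!q]) z = W (y # r) z"
proof -
  have pq: "Suc p < q" using y vq by auto
  obtain X Z V where r: "r = X @ r!p # Z @ r!q # V" and lX: "length X = p" and lZ: "length Z = q - Suc p"
    and sX: "\<And>x. x \<in> set X \<Longrightarrow> \<exists>i<p. x = r!i"
    and Z: "Z = r!Suc p # tl Z" and sZ: "\<forall>x\<in>set (tl Z). \<exists>i. Suc p < i \<and> i < q \<and> x = r!i"
    and sV: "\<And>x. x \<in> set V \<Longrightarrow> \<exists>i. q < i \<and> i < length r \<and> x = r!i"
    by (rule decomp) (use pq in blast)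
  define c where "c = r!p" define a where "a = r!q" define Z' where "Z' = tl Z"
  have yS: "y = r!Suc p" using y by auto
  have r': "r = X @ c # y # Z' @ a # V" using r Z c_def a_def Z'_def yS by (metis append_Cons)
  have R: "r[q := r!p] = X @ c # y # Z' @ c # V"
  proof -
    have "q = length (X @ c # y # Z')"
    proof -
      have "Suc (length Z') = length Z" using Z Z'_def by (metis length_Cons)
      then show ?thesis using lX lZ pq by simp
    qed
    then have "(X @ c # y # Z' @ a # V)[q := c] = X @ c # y # Z' @ c # V"
      using list_update_length[of "X @ c # y # Z'" a V c] by simp
    then show ?thesis unfolding c_def[symmetric] using r' by simp
  qed
  have yc: "y < c" using yS lo[of "Suc p"] pq c_def by auto
  have ac': "a < c" using ac a_def c_def by simp
  have aV: "far a x" if xV: "x \<in> set V" for x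
  proof -
    obtain i where i: "q < i" "i < length r" "x = r!i" using sV[OF xV] by blast
    then have "r!p < r!i" using Vfar[of i] lt unfolding below_next_def by auto
    then show ?thesis using i ac unfolding a_def by auto
  qed
  have Xy: "far y x" if "x \<in> set X" for x using sX[OF that] pre yc c_def by fastforce
  have Zc: "far c x" if xZ: "x \<in> set Z'" for x
  proof -
    obtain i where i: "Suc p < i" "i < q" "x = r!i" using sZ xZ Z'_def by blast
    have "r!i < y \<or> r!i < a"
    proof (cases "i < v")
      case True then show ?thesis using D[of "Suc p" i] i yS by auto
    next
      case False then show ?thesis using lo2[of i] i a_def by auto
    qed
    then show ?thesis using i yc ac' by auto
  qed
  have y0: "0 < y" if "c = Suc y"
  proof (rule ccontr)
    assume "\<not> 0 < y"
    then have "y = 0" "c = 1" using that by auto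
    then have "Suc p = v" "v < q" using y yS D[of "Suc p" v] by auto
    then have "y < a" using U[of v q] qk yS a_def by auto
    then show False using ac' \<open>c = 1\<close> by auto
  qed
  have "W (X @ c # y # Z' @ c # V @ [a]) z = W (y # X @ c # y # Z' @ a # V) z"
    using W_far[OF aV] W_far[OF Xy] W_far[OF Zc] dem_braid_any[OF yc y0] by simp
  then show ?thesis unfolding R a_def[symmetric] using r' by simp
qed

text \<open>The second copy of \<open>c\<close> commutes over the middle segment and merges with the
  first.\<close>

lemma replace_right_hecke_absorb:
  assumes lt: "below_next r S q (r!p)" and far: "\<And>i. p < i \<Longrightarrow> i < v \<Longrightarrow> r!i + 2 \<le> r!p"
  shows "W (r[q := r!p] @ [r!q]) z = W r z"
proof -
  have pq: "p < q" using pv vq by simp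
  obtain X Z V where r: "r = X @ r!p # Z @ r!q # V" and lX: "length X = p" and lZ: "length Z = q - Suc p"
    and sZ: "\<And>x. x \<in> set Z \<Longrightarrow> \<exists>i. p < i \<and> i < q \<and> x = r!i"
    and sV: "\<And>x. x \<in> set V \<Longrightarrow> \<exists>i. q < i \<and> i < length r \<and> x = r!i"
    by (rule decomp) blast
  define c where "c = r!p" define a where "a = r!q"
  have r': "r = X @ c # Z @ a # V" using r c_def a_def by simp
  have R: "r[q := r!p] = X @ c # Z @ c # V"
  proof -
    have "q = length (X @ c # Z)" using lX lZ pq by simp
    then have "(X @ c # Z @ a # V)[q := c] = X @ c # Z @ c # V"
      using list_update_length[of "X @ c # Z" a V c] by simp
    then show ?thesis unfolding c_def[symmetric] using r' by simp
  qed
  have aV: "far a x" if xV: "x \<in> set V" for x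
  proof -
    obtain i where i: "q < i" "i < length r" "x = r!i" using sV[OF xV] by blast
    then have "r!p < r!i" using Vfar[of i] lt unfolding below_next_def by auto
    then show ?thesis using i ac unfolding a_def by auto
  qed
  have Zc: "far c x" if xZ: "x \<in> set Z" for x
  proof -
    obtain i where i: "p < i" "i < q" "x = r!i" using sZ[OF xZ] by blast
    then show ?thesis using Zfar[OF far] unfolding c_def by auto
  qed
  have "W (X @ c # Z @ c # V @ [a]) z = W (X @ c # Z @ a # V) z"
    using W_far[OF aV] W_far[OF Zc] by simp
  then show ?thesis unfolding R a_def[symmetric] using r' by simp
qed

end

section \<open>Letters absorbed by the lower row\<close>

lemma W_absorb:
  assumes "i < length S" "S!i = y" "\<And>j. i < j \<Longrightarrow> j < length S \<Longrightarrow> far y (S!j)"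
  shows "W (S @ [y]) z = W S z"
proof -
  have S: "S = take i S @ y # drop (Suc i) S" using id_take_nth_drop[OF assms(1)] assms(2) by simp
  have f: "far y x" if xin: "x \<in> set (drop (Suc i) S)" for x
  proof -
    obtain j where "j < length S - Suc i" "x = S!(Suc i + j)" using xin by (auto simp: in_set_conv_nth)
    then show ?thesis using assms(3)[of "Suc i + j"] by simp
  qed
  have "W ((take i S @ y # drop (Suc i) S) @ [y]) z = W (take i S @ y # drop (Suc i) S) z"
    using W_far[OF f] by simp
  then show ?thesis using S by simp
qed

text \<open>All copies of \<open>y\<close> in \<open>L\<close> merge with the letter that travels
  through \<open>L\<close>.\<close>

lemma W_pull:
  assumes "\<And>x. x \<in> set L \<Longrightarrow> x = y \<or> far y x"
  shows "dem y (W L z) = W (filter (\<lambda>x. x \<noteq> y) L) (dem y z)"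
  using assms
proof (induction L)
  case (Cons x L)
  then have IH: "dem y (W L z) = W (filter (\<lambda>x. x \<noteq> y) L) (dem y z)" by simp
  show ?case
  proof (cases "x = y")
    case True then show ?thesis by (simp add: IH[symmetric])
  next
    case False
    then have "far y x" using Cons.prems[of x] by auto
    then show ?thesis using IH False dem_comm[of y x] by simp
  qed
qed simp

text \<open>Commutations gather the letters into \<open>(y+1) y (y+1) y\<close>, and a braid move
  with idempotence reduces this to \<open>(y+1) y (y+1)\<close>.\<close>

lemma W_absorb_braid:
  assumes y: "0 < y" and K: "\<And>x. x \<in> set K \<Longrightarrow> far (Suc y) x"
    and L: "\<And>x. x \<in> set L \<Longrightarrow> x = y \<or> x + 2 \<le> y" and M: "\<And>x. x \<in> set M \<Longrightarrow> far y x"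
  shows "W (A @ Suc y # K @ y # L @ Suc y # M @ [y]) z = W (A @ Suc y # K @ y # L @ Suc y # M) z"
proof -
  define L' where "L' = filter (\<lambda>x. x \<noteq> y) L"
  have L1: "dem y (W L u) = W L' (dem y u)" for u using W_pull[of L y] L unfolding L'_def by blast
  have L2: "W L' (dem (Suc y) u) = dem (Suc y) (W L' u)" for u
    by (rule W_far) (use L L'_def in fastforce)
  have K1: "dem (Suc y) (W K u) = W K (dem (Suc y) u)" for u using W_far[OF K] by simp
  have M1: "W M (dem y u) = dem y (W M u)" for u using W_far[OF M] by simp
  have L3: "W L' (dem y u) = dem y (W L' u)" for u
    by (rule W_far) (use L L'_def in fastforce)
  have *: "W (A @ Suc y # K @ y # L @ Suc y # M') u = W A (W K (dem (Suc y) (dem y (dem (Suc y) (W L' (W M' u))))))" for M' u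
    using L1 K1 L2 L3 by simp
  have br: "dem (Suc y) (dem y (dem (Suc y) (dem y u))) = dem (Suc y) (dem y (dem (Suc y) u))" for u
    using dem_braid[OF y] by (metis dem_idem)
  show ?thesis unfolding * using M1 L3 br by simp
qed

lemma split2:
  assumes "i < j" "j < length S"
  shows "S = take i S @ S!i # take (j - Suc i) (drop (Suc i) S) @ S!j # drop (Suc j) S"
    "\<And>x. x \<in> set (take (j - Suc i) (drop (Suc i) S)) \<Longrightarrow> \<exists>k. i < k \<and> k < j \<and> x = S!k"
proof -
  have "S = take i S @ S!i # drop (Suc i) S" using id_take_nth_drop[of i S] assms by simp
  moreover have "drop (Suc i) S = take (j - Suc i) (drop (Suc i) S) @ S!j # drop (Suc j) S"
    using id_take_nth_drop[of "j - Suc i" "drop (Suc i) S"] assms by simp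
  ultimately show "S = take i S @ S!i # take (j - Suc i) (drop (Suc i) S) @ S!j # drop (Suc j) S" by metis
  fix x assume "x \<in> set (take (j - Suc i) (drop (Suc i) S))"
  then obtain k where "k < j - Suc i" "x = S!(Suc i + k)" using assms by (auto simp: in_set_conv_nth)
  then show "\<exists>k. i < k \<and> k < j \<and> x = S!k" using assms by (intro exI[of _ "Suc i + k"]) auto
qed

lemma W_absorb_braid_nth:
  assumes y: "0 < y" and ij: "h < i" "i < j" "j < length S" and "S!h = Suc y" "S!i = y" "S!j = Suc y"
    and K: "\<And>k. h < k \<Longrightarrow> k < i \<Longrightarrow> S!k < y" and L: "\<And>k. i < k \<Longrightarrow> k < j \<Longrightarrow> S!k = y \<or> S!k + 2 \<le> y"
    and M: "\<And>k. j < k \<Longrightarrow> k < length S \<Longrightarrow> far y (S!k)"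
  shows "W (S @ [y]) z = W S z"
proof -
  define A where "A = take h S" define K where "K = take (i - Suc h) (drop (Suc h) S)"
  define L where "L = take (j - Suc i) (drop (Suc i) S)" define M where "M = drop (Suc j) S"
  have "S = A @ Suc y # K @ y # drop (Suc i) S" using split2(1)[of h i S] assms A_def K_def by simp
  moreover have "drop (Suc i) S = L @ Suc y # M"
    using id_take_nth_drop[of "j - Suc i" "drop (Suc i) S"] assms L_def M_def by simp
  ultimately have S: "S = A @ Suc y # K @ y # L @ Suc y # M" by metis
  have 1: "far (Suc y) x" if xK: "x \<in> set K" for x
  proof -
    obtain k where "h < k" "k < i" "x = S!k" using split2(2)[of h i S x] ij xK unfolding K_def by auto
    then show ?thesis using assms(8)[of k] by simp
  qed
  have 2: "x = y \<or> x + 2 \<le> y" if xL: "x \<in> set L" for x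
  proof -
    obtain k where "i < k" "k < j" "x = S!k" using split2(2)[of i j S x] ij xL unfolding L_def by auto
    then show ?thesis using assms(9)[of k] by simp
  qed
  have 3: "far y x" if xM: "x \<in> set M" for x
  proof -
    obtain k where "k < length S - Suc j" "x = S!(Suc j + k)" using xM by (auto simp: in_set_conv_nth M_def)
    then show ?thesis using assms(10)[of "Suc j + k"] by simp
  qed
  show ?thesis using W_absorb_braid[OF y 1 2 3, where A = A and z = z] S by simp
qed

context bump_frame
begin

lemma S_asc: "v \<le> i \<Longrightarrow> i < j \<Longrightarrow> j < length S \<Longrightarrow> S!i < S!j"
  using ok_lower_asc[OF vr okr vs] .

lemma S_gt: "v \<le> j \<Longrightarrow> j < length S \<Longrightarrow> r!v \<le> r!j \<and> r!j < S!j"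
  using oC[of j] U[of j "Suc j"] U[of v j] oL by (cases "j = v") auto

text \<open>A non-strict letter other than the neighbouring values excluded by \<open>yk\<close> and
  \<open>hm\<close> equals an entry of \<open>S\<close>. It is absorbed there directly, unless
  \<open>y + 1\<close> stands in \<open>S\<close> on both sides of it; then
  \<open>W_absorb_braid_nth\<close> applies.\<close>

lemma nonstrict_absorb:
  assumes yc: "y < r!p" and yk: "Suc p < v \<Longrightarrow> r!Suc p < y"
    and quy: "upper_cond r v S y" and qby: "lower_cond r v S y" and ns: "\<not> strict r v S p uu y"
    and hm: "Suc p = v \<Longrightarrow> y = r!v \<Longrightarrow> q = v \<and> below_next r S q (r!p)"
  shows "W (S @ [y]) z = W S z"
proof -
  have Q: "1 \<le> p \<and> (p < length S \<and> S!p < S!(p - 1) \<longrightarrow> S!(p - 1) \<le> S!j)" if "j < length S" "y < S!j" for j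
  proof -
    have "Suc p = v \<or> r!Suc p \<le> y" using yk pv by (cases "Suc p = v") auto
    then show ?thesis using qby that pv unfolding lower_cond_def by blast
  qed
  have ltv: "below_next r S q (r!p) \<Longrightarrow> q = v \<Longrightarrow> v < length S \<Longrightarrow> r!p < S!v" unfolding below_next_def by auto
  consider (sv) "Suc p = v" "y < uu" "v \<le> length S" "S!p \<le> y"
    | (H) i where "i < length S" "p \<le> i" "p = 0 \<or> S!i < S!(p - 1)" "y \<le> S!i"
  proof -
    have "Suc p = v \<Longrightarrow> y \<noteq> uu" using hm yc by auto
    moreover have "v - 1 = p" if "Suc p = v" using that by auto
    ultimately have "(Suc p = v \<and> y < uu \<and> v \<le> length S \<and> S!p \<le> y) \<or> \<not> strictB S p y"
      using ns yk unfolding strict_def by (metis leI)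
    then show thesis using sv H unfolding strictB_def by (metis leI)
  qed
  then show ?thesis
  proof cases
    case sv
    have vp: "v - 1 = p" using sv by auto
    have "y \<le> S!(v - 1)"
    proof (cases "q = v \<and> below_next r S q (r!p)")
      case True
      then have "Suc v = length r \<or> (\<exists>j<v. y < r!j \<and> r!j \<le> r!Suc v)" using ce qk yc pv by (metis Suc_lessI)
      then show ?thesis using quy sv unfolding upper_cond_def by blast
    next
      case False
      then have "y \<le> r!v" using sv(2) by (metis less_imp_le_nat)
      then show ?thesis using quy sv unfolding upper_cond_def by blast
    qed
    then have e: "S!p = y" using sv vp by simp
    have "far y (S!j)" if j: "p < j" "j < length S" for j
    proof (cases "q = v \<and> below_next r S q (r!p)")
      case True
      then have "r!p < S!v" using ltv j sv by auto
      moreover have "S!v \<le> S!j" using S_asc[of v j] j sv by (cases "j = v") auto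
      ultimately show ?thesis using yc by auto
    next
      case False
      then have "y < r!v" using sv(2) by metis
      then show ?thesis using S_gt[of j] j sv by auto
    qed
    then show ?thesis using W_absorb[of p S y] e sv by auto
  next
    case H
    define P where "P = (\<lambda>i. p \<le> i \<and> i < length S \<and> S!i = y)"
    have sp: "p < length S \<and> S!p < S!(p - 1)" if "p \<noteq> 0"
    proof -
      have "Suc (p - 1) = p" "p - 1 < i" using that H by auto
      then show ?thesis using S_desc'[of "p - 1" i] H that by auto
    qed
    have "P i"
    proof (rule ccontr)
      assume "\<not> P i"
      then have "y < S!i" using H P_def by auto
      then show False using Q[OF H(1)] sp H by auto
    qed
    \<comment> \<open>The entry \<open>r!Suc i\<close> lies strictly between \<open>S!j\<close>, by
      (ii), and \<open>y\<close>.\<close>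
    have lowr: "S!j + 2 \<le> y" if "P i" "i < j" "j < length S" "S!j < y" for i j
    proof -
      have iv: "i < v" using S_asc[of i j] that unfolding P_def by fastforce
      have lt: "S!j < r!Suc i" using oB[of i j] that unfolding P_def by fastforce
      have "r!Suc i < y"
      proof (cases "Suc p = v")
        case True
        then have "v \<le> j" using that iv unfolding P_def by auto
        then have "r!v < S!j" using S_gt[of j] that by auto
        moreover have "Suc i = v" using True that iv unfolding P_def by auto
        ultimately show ?thesis using that by auto
      next
        case False
        then have "r!Suc p < y" using yk pv by auto
        moreover have "r!Suc i \<le> r!Suc p" using D[of "Suc p" "Suc i"] iv that unfolding P_def by (cases "i = p") auto
        ultimately show ?thesis by auto
      qed
      then show ?thesis using lt by auto
    qed
    have hig: "p \<noteq> 0 \<and> S!(p - 1) \<le> S!j" if "j < length S" "y < S!j" for j using Q[OF that] sp by auto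
    have yb: "p \<noteq> 0 \<Longrightarrow> y < S!(p - 1)" using H \<open>P i\<close> unfolding P_def by auto
    \<comment> \<open>By \<open>hig\<close> and \<open>yb\<close> an entry \<open>Suc y\<close> at
      or after \<open>p\<close> forces \<open>S!(p - 1) = Suc y\<close>, so the other case leaves
      only letters far from \<open>y\<close> after its last occurrence.\<close>
    show ?thesis
    proof (cases "p \<noteq> 0 \<and> S!(p - 1) = Suc y \<and> (\<exists>j. p \<le> j \<and> j < length S \<and> S!j = Suc y)")
      case False
      have "\<exists>i. P i \<and> (\<forall>k. P k \<longrightarrow> k \<le> i)"
        using ex_has_greatest_nat[of P i "\<lambda>x. x" "length S"] \<open>P i\<close> unfolding P_def by auto
      then obtain i where i: "P i" "\<And>k. P k \<Longrightarrow> k \<le> i" by auto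
      have "far y (S!j)" if j: "i < j" "j < length S" for j
      proof -
        have "S!j \<noteq> y" using i(2)[of j] j i(1) unfolding P_def by auto
        moreover have "S!j \<noteq> Suc y" using False hig[OF j(2)] yb j i(1) unfolding P_def by auto
        ultimately show ?thesis using lowr[OF i(1) j] by linarith
      qed
      then show ?thesis using W_absorb[of i S y] i unfolding P_def by auto
    next
      case True
      then obtain j where j: "p \<le> j" "j < length S" "S!j = Suc y" by blast
      have p0: "p \<noteq> 0" "S!(p - 1) = Suc y" using True by auto
      have P1: "Suc (p - 1) = p" using p0 by auto
      obtain w where w: "vee S w" using vs j by force
      have btw: "S!k < Suc y" if k: "p \<le> k" "k < j" for k
      proof (cases "k \<le> w")
        case True then show ?thesis using veeD(2)[OF w, of "p - 1" k] k p0 by (metis P1 Suc_le_lessD)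
      next
        case False then show ?thesis using veeD(3)[OF w, of k j] k j by auto
      qed
      have wj: "w < j"
      proof (rule ccontr)
        assume "\<not> w < j"
        then have "S!j < S!(p - 1)" using veeD(2)[OF w, of "p - 1" j] j P1 by (metis Suc_le_lessD not_less)
        then show False using j p0 by auto
      qed
      have up: "far y (S!k)" if "j < k" "k < length S" for k using veeD(3)[OF w, of j k] wj j that by auto
      have "\<exists>i. P i \<and> (\<forall>k. P k \<longrightarrow> i \<le> k)" using \<open>P i\<close> by (metis LeastI Least_le)
      then obtain i where i: "P i" "\<And>k. P k \<Longrightarrow> i \<le> k" by auto
      have ij: "i < j"
      proof (rule ccontr)
        assume "\<not> i < j"
        then have "S!j \<le> S!i" using veeD(3)[OF w, of j i] wj i(1) unfolding P_def by (cases "i = j") auto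
        then show False using i(1) j unfolding P_def by auto
      qed
      have K: "S!k < y" if "p - 1 < k" "k < i" for k
      proof -
        have "p \<le> k" using that P1 by auto
        then show ?thesis using btw[of k] i(1) i(2)[of k] that ij unfolding P_def by fastforce
      qed
      have L: "S!k = y \<or> S!k + 2 \<le> y" if "i < k" "k < j" for k
        using btw[of k] lowr[OF i(1), of k] i(1) that j unfolding P_def by fastforce
      \<comment> \<open>The letters \<open>0\<close> and \<open>1\<close> do not satisfy the braid
        relation of length three; hypothesis \<open>hm\<close> leads to a contradiction in that
        case.\<close>
      have y0: "0 < y"
      proof (rule ccontr)
        assume "\<not> 0 < y"
        then have y: "y = 0" by simp
        then have pv': "Suc p = v" using yk pv by (cases "Suc p = v") auto
        then have vj: "v \<le> j" using ij i(1) unfolding P_def by auto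
        have "r!v = 0" "r!j = 0" using S_gt[OF vj j(2)] j y by auto
        then have "q = v \<and> below_next r S q (r!p)" using hm pv' y by metis
        moreover have "j = v" using U[of v j] vj j(2) oL \<open>r!v = 0\<close> \<open>r!j = 0\<close> by (cases "j = v") auto
        ultimately show False using ltv j y yc by auto
      qed
      show ?thesis
        using W_absorb_braid_nth[OF y0, of "p - 1" i j S] ij j(2,3) p0(2) i(1) K L up P1 unfolding P_def
        by (metis Suc_le_lessD)
    qed
  qed
qed

lemma naive_absorb:
  assumes "r!Suc p + 2 \<le> r!p"
  shows "W (r!Suc p # r) z = W r z"
proof -
  define c where "c = r!p" define y where "y = r!Suc p" define X where "X = take p r" define T where "T = drop (Suc (Suc p)) r"
  have l: "Suc p < length r" using pv vq qk by auto
  have r': "r = X @ c # y # T"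
    using id_take_nth_drop[of p r] Cons_nth_drop_Suc[of "Suc p" r] l c_def y_def X_def T_def by simp
  have Xy: "far y x" if xin: "x \<in> set X" for x
  proof -
    obtain i where "i < p" "x = r!i" using xin l by (auto simp: X_def in_set_conv_nth)
    then show ?thesis using pre[of i] assms y_def by auto
  qed
  have "W (y # X @ c # y # T) z = W X (dem y (dem c (dem y (W T z))))" using W_far[OF Xy] by simp
  moreover have "dem y (dem c (dem y u)) = dem c (dem y u)" for u
    using dem_comm[of y c "dem y u"] assms c_def y_def by simp
  ultimately have "W (y # X @ c # y # T) z = W (X @ c # y # T) z" by simp
  then show ?thesis unfolding y_def[symmetric] using r' by simp
qed

text \<open>With \<open>c = y + 1\<close>, commutations collect \<open>y c\<close> from the lower
  row and \<open>y c y\<close> behind it, and \<open>y c y c y\<close> reduces to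
  \<open>y c y\<close>. For \<open>y = 0\<close> this needs the relation of length four, hence a
  letter \<open>1\<close> at \<open>S!(q - 2)\<close>.\<close>

lemma tie_absorb:
  assumes lt: "\<not> below_next r S q (r!p)" and ne: "Suc q < length r \<Longrightarrow> r!p < r!Suc q"
    and y: "y = r!Suc p" "r!p = Suc y" and Sy: "S!(q - 1) = y"
    and z: "y = 0 \<Longrightarrow> 2 \<le> q \<and> S!(q - 2) = 1"
  shows "W (S @ y # r) z = W (S @ r) z"
proof -
  have ql: "q < length S" "S!q \<le> r!p" and ce2: "r!p < r!Suc q" using lt ne oL unfolding below_next_def by auto
  define c where "c = r!p"
  define X where "X = take p r" define T where "T = drop (Suc (Suc p)) r"
  have l: "Suc p < length r" using pv vq qk by auto
  have r': "r = X @ c # y # T"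
    using id_take_nth_drop[of p r] Cons_nth_drop_Suc[of "Suc p" r] l c_def y X_def T_def by simp
  have cS: "c = S!q" using S_hi[of q] ql unfolding c_def by auto
  have cy: "c = Suc y" using y c_def by simp
  have X2: "c + 2 \<le> x" if xin: "x \<in> set X" for x
  proof -
    obtain i where "i < p" "x = r!i" using xin l by (auto simp: X_def in_set_conv_nth)
    then show ?thesis using not_lt_pre[OF lt, of i] ce2 unfolding c_def by auto
  qed
  define S0 where "S0 = take (q - 1) S" define S3 where "S3 = drop (Suc q) S"
  have S: "S = S0 @ y # c # S3" using S_split[OF ql(1)] cS Sy S0_def S3_def by simp
  have S3: "c + 2 \<le> x" if "x \<in> set S3" for x using S_tail_far[of x] that ce2 cS unfolding S3_def c_def by auto
  have far1: "\<And>x. x \<in> set S3 \<Longrightarrow> far c x" "\<And>x. x \<in> set X \<Longrightarrow> far c x" "\<And>x. x \<in> set S3 \<Longrightarrow> far y x" "\<And>x. x \<in> set X \<Longrightarrow> far y x"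
    using S3 X2 cy by fastforce+
  have 1: "W (S0 @ y # c # S3 @ y # X @ c # y # T) z = W S0 (dem y (dem c (dem y (dem c (dem y (W S3 (W X (W T z))))))))"
    using W_far[OF far1(1)] W_far[OF far1(2)] W_far[OF far1(3)] W_far[OF far1(4)] by simp
  have 2: "W (S0 @ y # c # S3 @ X @ c # y # T) z = W S0 (dem y (dem c (dem y (W S3 (W X (W T z))))))"
    using W_far[OF far1(1)] W_far[OF far1(2)] W_far[OF far1(3)] W_far[OF far1(4)] by simp
  have "W S0 (dem y (dem c (dem y (dem c (dem y u))))) = W S0 (dem y (dem c (dem y u)))" for u
  proof (cases "y = 0")
    case False
    then show ?thesis using dem_braid[of y] cy by (metis dem_idem neq0_conv)
  next
    case True
    then have q2: "2 \<le> q" "S!(q - 2) = 1" using z by auto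
    then have "Suc (q - 2) = q - 1" by auto
    then have "S0 = take (q - 2) S @ [1]"
      using take_Suc_conv_app_nth[of "q - 2" S] ql q2 unfolding S0_def by auto
    moreover have "dem 1 (dem 0 (dem 1 (dem 0 (dem 1 (dem 0 u))))) = dem 1 (dem 0 (dem 1 (dem 0 u)))"
      using dem_braid0 by (metis dem_idem)
    ultimately show ?thesis using True cy by simp
  qed
  then have "W (S0 @ y # c # S3 @ y # X @ c # y # T) z = W (S0 @ y # c # S3 @ X @ c # y # T) z" using 1 2 by simp
  then show ?thesis using r' S by simp
qed

text \<open>Two braid moves carry the change across the row: \<open>a c a\<close> becomes
  \<open>c a c\<close>, and then \<open>c k c\<close> becomes \<open>k c k\<close>.\<close>

lemma corner_braid:
  assumes sq: "Suc q < length r" and ce: "r!p = r!Suc q" and pv': "Suc p < v"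
  shows "W (r @ [r!q]) z = W (r!Suc p # r) z"
proof -
  have pq: "Suc p < q" using pv' vq by simp
  obtain X Z V where r: "r = X @ r!p # Z @ r!q # V" and lX: "length X = p" and lZ: "length Z = q - Suc p"
    and sX: "\<And>x. x \<in> set X \<Longrightarrow> \<exists>i<p. x = r!i"
    and Z: "Z = r!Suc p # tl Z" and sZ: "\<forall>x\<in>set (tl Z). \<exists>i. Suc p < i \<and> i < q \<and> x = r!i"
    and V: "V = r!Suc q # tl V" and sV: "\<forall>x\<in>set (tl V). \<exists>i. Suc q < i \<and> i < length r \<and> x = r!i"
    by (rule decomp) (use pq sq in blast)
  define c where "c = r!p" define a where "a = r!q" define k where "k = r!Suc p"
  define Z' where "Z' = tl Z" define V' where "V' = tl V"
  have r': "r = X @ c # k # Z' @ a # c # V'"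
    using r Z V ce unfolding c_def a_def k_def Z'_def V'_def by (metis append_Cons)
  have kc: "k < c" "a < c" using lo[of "Suc p"] pq ac unfolding k_def c_def a_def by auto
  have k0: "0 < k" using D[of "Suc p" v] pv' unfolding k_def by auto
  have a0: "0 < a" if "c = Suc a" using kc k0 that by (cases "a = 0") auto
  have Zc: "far c x" if xZ: "x \<in> set Z'" for x
  proof -
    obtain i where i: "Suc p < i" "i < q" "x = r!i" using sZ xZ Z'_def by blast
    have "r!i < k \<or> r!i < a"
    proof (cases "i < v")
      case True then show ?thesis using D[of "Suc p" i] i k_def by auto
    next
      case False then show ?thesis using lo2[of i] i a_def by auto
    qed
    then show ?thesis using i kc by auto
  qed
  have aV: "far a x" if xV: "x \<in> set V'" for x
  proof -
    obtain i where "Suc q < i" "i < length r" "x = r!i" using sV xV V'_def by blast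
    then show ?thesis using U[of "Suc q" i] vq ac ce unfolding a_def by auto
  qed
  have Xk: "far k x" if "x \<in> set X" for x using sX[OF that] pre kc unfolding c_def by fastforce
  have "W (X @ c # k # Z' @ a # c # V' @ [a]) z = W X (dem c (dem k (W Z' (dem a (dem c (dem a (W V' z)))))))"
    using W_far[OF aV] by simp
  also have "\<dots> = W X (dem c (dem k (W Z' (dem c (dem a (dem c (W V' z)))))))" using dem_braid_any[OF kc(2) a0] by simp
  also have "\<dots> = W X (dem c (dem k (dem c (W Z' (dem a (dem c (W V' z)))))))" using W_far[OF Zc] by simp
  also have "\<dots> = W X (dem k (dem c (dem k (W Z' (dem a (dem c (W V' z)))))))" using dem_braid_any[OF kc(1) k0] by simp
  also have "\<dots> = W (k # X @ c # k # Z' @ a # c # V') z" using W_far[OF Xk] by simp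
  finally show ?thesis unfolding a_def[symmetric] k_def[symmetric] using r' by simp
qed

text \<open>With \<open>p\<close> and \<open>q\<close> adjacent the row contains
  \<open>c a c\<close>, and appending \<open>a\<close> gives one side of the relation of length
  four. This is where the pair \<open>0\<close>, \<open>1\<close> is allowed.\<close>

lemma corner_braid4:
  assumes sq: "Suc q < length r" and ce: "r!p = r!Suc q" and pv': "Suc p = q"
  shows "W (r @ [r!q]) z = W (r!q # r) z"
proof -
  obtain X Z V where r: "r = X @ r!p # Z @ r!q # V" and lZ: "length Z = q - Suc p"
    and sX: "\<And>x. x \<in> set X \<Longrightarrow> \<exists>i<p. x = r!i"
    and V: "V = r!Suc q # tl V" and sV: "\<forall>x\<in>set (tl V). \<exists>i. Suc q < i \<and> i < length r \<and> x = r!i"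
    by (rule decomp) (use sq in blast)
  define c where "c = r!p" define a where "a = r!q" define V' where "V' = tl V"
  have "Z = []" using lZ pv' by simp
  then have r': "r = X @ c # a # c # V'" using r V ce unfolding c_def a_def V'_def by (metis append_Nil)
  have kc: "a < c" using ac unfolding c_def a_def by auto
  have aV: "far a x" if xV: "x \<in> set V'" for x
  proof -
    obtain i where "Suc q < i" "i < length r" "x = r!i" using sV xV V'_def by blast
    then show ?thesis using U[of "Suc q" i] vq ac ce unfolding a_def by auto
  qed
  have Xk: "far a x" if "x \<in> set X" for x using sX[OF that] pre kc unfolding c_def by fastforce
  have "W (X @ c # a # c # V' @ [a]) z = W X (dem c (dem a (dem c (dem a (W V' z)))))"
    using W_far[OF aV] by simp
  also have "\<dots> = W (a # X @ c # a # c # V') z" using W_far[OF Xk] dem_braid4[OF kc] by simp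
  finally show ?thesis unfolding a_def[symmetric] using r' by simp
qed

lemma replace_right_hecke:
  assumes yc: "y < r!p" and yk: "Suc p < v \<Longrightarrow> r!Suc p \<le> y" and quy: "upper_cond r v S y" and qby: "lower_cond r v S y"
    and ns: "\<not> strict r v S p (corner r S v p q) y"
    and lt: "below_next r S q (r!p)" and le: "q \<le> length S \<longrightarrow> r!p \<le> S!(q - 1)"
  shows "W (S @ r[q := r!p] @ [r!q]) z = W (S @ y # r) z"
proof -
  have nv: "\<not> (Suc p = v \<and> q = v)" using replace_right_not_adjacent[OF yc qby ns lt le] .
  show ?thesis
  proof (cases "Suc p < v \<and> y = r!Suc p \<or> Suc p = v \<and> y = r!v \<and> v < q")
    case True
    then show ?thesis using replace_right_hecke_naive[OF lt True] by simp
  next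
    case False
    have yk': "Suc p < v \<Longrightarrow> r!Suc p < y" using False yk by fastforce
    have hm: "Suc p = v \<Longrightarrow> y = r!v \<Longrightarrow> q = v \<and> below_next r S q (r!p)" using False nv vq by auto
    have ab: "W (S @ [y]) u = W S u" for u
      using nonstrict_absorb[OF yc yk' quy qby _ hm] ns unfolding corner_def by blast
    have f: "r!i + 2 \<le> r!p" if "p < i" "i < v" for i
      using yk' D[of "Suc p" i] yc that by (cases "i = Suc p") auto
    have "W (S @ y # r) z = W (S @ [y]) (W r z)" by simp
    also have "\<dots> = W S (W (r[q := r!p] @ [r!q]) z)" using ab replace_right_hecke_absorb[OF lt f] by simp
    finally show ?thesis by simp
  qed
qed

text \<open>If \<open>y\<close> is not obtained from the neighbour of \<open>r!p\<close>, the lower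
  row absorbs \<open>y\<close> and the row absorbs \<open>r!q\<close>. If it is, either
  \<open>r!p = r!Suc q\<close> and a braid turns \<open>r!q\<close> into \<open>y\<close>, or both
  letters are absorbed, \<open>y\<close> by the row when it is at distance two from
  \<open>r!p\<close> and otherwise by way of the lower row, where
  \<open>S!(q - 1) = y\<close>.\<close>

lemma replace_none_hecke:
  assumes yc: "y < r!p" and yk: "Suc p < v \<Longrightarrow> r!Suc p \<le> y" and quy: "upper_cond r v S y" and qby: "lower_cond r v S y"
    and ns: "\<not> strict r v S p (corner r S v p q) y"
    and nG: "\<not> (below_next r S q (r!p) \<and> (q \<le> length S \<longrightarrow> r!p \<le> S!(q - 1)))"
  shows "W (S @ r @ [r!q]) z = W (S @ y # r) z"
proof -
  have mq: "r!v \<le> r!q" using U[of v q] vq qk by (cases "q = v") auto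
  have fin: "r!p = r!Suc q \<and> Suc q < length r \<or> (Suc q < length r \<longrightarrow> r!p < r!Suc q)" using ce by fastforce
  have ra: "W (r @ [r!q]) u = W r u" if "Suc q < length r \<longrightarrow> r!p < r!Suc q" for u
    by (rule row_absorbs) (use that ac in auto)
  have yq: "q \<le> length S \<Longrightarrow> y \<le> S!(q - 1)"
  proof -
    assume "q \<le> length S"
    moreover have "Suc q = length r \<or> (\<exists>j<v. y < r!j \<and> r!j \<le> r!Suc q)" using ce qk yc pv by (metis Suc_lessI)
    ultimately show ?thesis using quy vq unfolding upper_cond_def by blast
  qed
  show ?thesis
  proof (cases "Suc p < v \<and> y = r!Suc p \<or> Suc p = v \<and> y = r!v \<and> \<not> (q = v \<and> below_next r S q (r!p))")
    case False
    have yk': "Suc p < v \<Longrightarrow> r!Suc p < y" using False yk by fastforce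
    have hm: "Suc p = v \<Longrightarrow> y = r!v \<Longrightarrow> q = v \<and> below_next r S q (r!p)" using False by auto
    have ab: "W (S @ [y]) u = W S u" for u
      using nonstrict_absorb[OF yc yk' quy qby _ hm] ns unfolding corner_def by blast
    have "W (r @ [r!q]) z = W r z"
    proof (rule row_absorbs)
      assume h: "Suc q < length r" "r!Suc q = Suc (r!q)"
      have "0 < r!q"
      proof (rule ccontr)
        assume "\<not> 0 < r!q"
        then have z: "r!q = 0" "r!v = 0" "y = 0" "r!p = 1" using mq yc ce[OF h(1)] h by auto
        then have "Suc p = v" using yk' pv by (cases "Suc p = v") auto
        then have "below_next r S q (r!p)" using hm z by auto
        then show False using h z unfolding below_next_def by auto
      qed
      moreover have "r!i + 2 \<le> r!p" if "p < i" "i < v" for i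
        using yk' D[of "Suc p" i] yc that by (cases "i = Suc p") auto
      ultimately show "0 < r!q \<and> (\<forall>i. p < i \<and> i < v \<longrightarrow> r!i + 2 \<le> r!p)" by blast
    qed
    then show ?thesis using ab by simp
  next
    case True
    then have y: "y = r!Suc p" by auto
    show ?thesis
    proof (cases "Suc p < q \<and> Suc p = v")
      case T: True
      then have g: "r!v < r!q" using lo2[of v] by auto
      then have "r!Suc p + 2 \<le> r!p" using ac T by auto
      moreover have "W (r @ [r!q]) z = W r z" by (rule row_absorbs) (use g T in auto)
      ultimately show ?thesis using naive_absorb y by simp
    next
      case F: False
      show ?thesis
      proof (cases "r!p = r!Suc q \<and> Suc q < length r")
        case T: True
        show ?thesis
        proof (cases "Suc p < v")
          case True then show ?thesis using corner_braid T y by simp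
        next
          case False
          then have "Suc p = q" using F pv vq by auto
          then show ?thesis using corner_braid4 T y by simp
        qed
      next
        case nc: False
        then have gt: "Suc q < length r \<longrightarrow> r!p < r!Suc q" using fin by blast
        have q1: "q \<le> length S \<and> S!(q - 1) < r!p"
        proof (cases "below_next r S q (r!p)")
          case True then show ?thesis using nG by auto
        next
          case False
          then have "q < length S" "S!q \<le> r!p" using gt oL unfolding below_next_def by auto
          then show ?thesis using S_adj by fastforce
        qed
        show ?thesis
        proof (cases "r!Suc p + 2 \<le> r!p")
          case True then show ?thesis using naive_absorb y ra[OF gt] by simp
        next
          case False
          then have cy: "r!p = Suc y" using yc y by simp
          then have Sy: "S!(q - 1) = y" using q1 yq by auto
          have q0: "0 < q" "q - 1 < length S" "q - 1 < q" using q1 pv vq by auto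
          have "W (S @ y # r) z = W (S @ r) z"
          proof (cases "below_next r S q (r!p)")
            case lt: True
            have "far y (S!j)" if j: "q - 1 < j" "j < length S" for j
            proof -
              have "q \<le> j" using j by linarith
              moreover have "r!p < S!q" using lt j calculation unfolding below_next_def by auto
              ultimately show ?thesis using S_asc[of q j] vq j cy by (cases "j = q") auto
            qed
            then have "W (S @ [y]) u = W S u" for u using W_absorb[of "q - 1" S y] Sy q0 by blast
            then have "W (S @ [y]) (W r z) = W S (W r z)" by blast
            then show ?thesis by simp
          next
            case lt: False
            show ?thesis
            proof (rule tie_absorb[OF lt _ y cy Sy])
              show "Suc q < length r \<Longrightarrow> r!p < r!Suc q" using gt by simp
              assume y0: "y = 0"
              then have pv': "Suc p = v" using D[of "Suc p" v] y pv by (cases "Suc p = v") auto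
              then have qp: "q = Suc p" using F vq by auto
              have ql: "q < length S" "S!q \<le> r!p" using lt gt oL unfolding below_next_def by auto
              have "S!q = 1" using S_hi[of q] ql cy y0 by auto
              then have Q: "1 \<le> p \<and> (p < length S \<and> S!p < S!(p - 1) \<longrightarrow> S!(p - 1) \<le> S!q)"
                using qby ql pv pv' y0 unfolding lower_cond_def by (metis zero_less_one)
              obtain w where w: "vee S w" using vs ql by force
              have P1: "p - 1 < p" "p < length S" using Q ql qp by auto
              have "S!p \<noteq> S!(p - 1)"
              proof (cases "p \<le> w")
                case True then show ?thesis using veeD(2)[OF w, of "p - 1" p] P1 by auto
              next
                case False
                then have "w \<le> p - 1" by auto
                then show ?thesis using veeD(3)[OF w, of "p - 1" p] P1 by auto
              qed
              then have "S!(p - 1) = 1" using Q P1 Sy y0 qp \<open>S!q = 1\<close> by auto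
              then show "2 \<le> q \<and> S!(q - 2) = 1" using Q qp by auto
            qed
          qed
          then show ?thesis using ra[OF gt] by simp
        qed
      qed
    qed
  qed
qed

end

lemma step_hecke:
  assumes "step S R a y r"
  shows "W (S @ R @ [a]) z = W (S @ y # r) z"
proof -
  obtain v p q where f: "bump_frame r S v p q" "y < r!p" "Suc p < v \<longrightarrow> r!Suc p \<le> y" "upper_cond r v S y" "lower_cond r v S y" "a = r!q"
    "R = uninsert r S v p q y" using assms unfolding step_def by blast
  interpret bump_frame r S v p q by (rule f(1))
  have yk: "Suc p < v \<Longrightarrow> r!Suc p \<le> y" using f by auto
  show ?thesis
  proof (cases "strict r v S p (corner r S v p q) y")
    case st: True
    show ?thesis
    proof (cases "below_next r S q (r!p)")
      case True
      have "Suc p < v \<Longrightarrow> r!Suc p < y" using st by (auto simp: strict_def)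
      then show ?thesis using replace_both_hecke[OF f(2) True] st f(6,7) True unfolding uninsert_def by auto
    next
      case False
      then have "strict r v S p (r!v) y" using st by (simp add: corner_def)
      then show ?thesis using replace_left_hecke[OF f(2) False _ f(4)] st f(6,7) False unfolding uninsert_def by auto
    qed
  next
    case ns: False
    then show ?thesis using replace_right_hecke[OF f(2) yk f(4,5) ns] replace_none_hecke[OF f(2) yk f(4,5) ns] f(6,7) unfolding uninsert_def by auto
  qed
qed

section \<open>Inserting a letter into a tableau\<close>

definition top_row :: "nat list list \<Rightarrow> nat list" where
  "top_row P = (case P of [] \<Rightarrow> [] | R # _ \<Rightarrow> R)"

lemma top_row_simps [simp]: "top_row [] = []" "top_row (R # P) = R" by (simp_all add: top_row_def)

fun sdt :: "nat list list \<Rightarrow> bool" where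
  "sdt [] \<longleftrightarrow> True"
| "sdt (R # P) \<longleftrightarrow> (\<exists>v. vee R v) \<and> ok R (top_row P) \<and> sdt P"

abbreviation shape :: "nat list list \<Rightarrow> nat list" where "shape \<equiv> map length"

definition word :: "nat list list \<Rightarrow> nat list" where "word P = concat (rev P)"

lemma word_simps [simp]: "word [] = []" "word (R # P) = word P @ R" by (simp_all add: word_def)

fun inc :: "nat list \<Rightarrow> nat \<Rightarrow> nat list" where
  "inc [] k = [1]"
| "inc (m # \<mu>) 0 = Suc m # \<mu>"
| "inc (m # \<mu>) (Suc k) = m # inc \<mu> k"

fun removable :: "nat list \<Rightarrow> nat \<Rightarrow> bool" where
  "removable [] k \<longleftrightarrow> False"
| "removable (m # \<mu>) 0 \<longleftrightarrow> \<mu> = [] \<or> Suc (hd \<mu>) < m"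
| "removable (m # \<mu>) (Suc k) \<longleftrightarrow> removable \<mu> k"

lemma sum_inc: "sum_list (inc \<mu> k) = Suc (sum_list \<mu>)"
  by (induction \<mu> k rule: inc.induct) auto

text \<open>
  \<open>ins P x P' k\<close>: inserting \<open>x\<close> into the top row of \<open>P\<close> gives \<open>P'\<close> and ends in row \<open>k\<close> (counted
  from 0), either with a new cell there or, in case \<open>abs\<close>, without changing the shape.
\<close>

inductive ins :: "nat list list \<Rightarrow> nat \<Rightarrow> nat list list \<Rightarrow> nat \<Rightarrow> bool" where
  new: "ins [] x [[x]] 0"
| ext: "vee R w \<Longrightarrow> last R < x \<or> x < last R \<and> Suc w = length R \<Longrightarrow> ins (R # P) x ((R @ [x]) # P) 0"
| abs: "P = [] \<or> Suc (length (top_row P)) < length R \<Longrightarrow> ins (R # P) (last R) (R # P) 0"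
| down: "step (top_row P) R x y r \<Longrightarrow> ins P y P' k \<Longrightarrow> ins (R # P) x (r # P') (Suc k)"

lemma ins_Nil_iff: "ins [] x P' k \<longleftrightarrow> P' = [[x]] \<and> k = 0"
  by (auto elim: ins.cases intro: ins.intros)

lemma ins_Cons_iff:
  "ins (R # P) x P' k \<longleftrightarrow>
     (\<exists>w. vee R w \<and> (last R < x \<or> x < last R \<and> Suc w = length R) \<and> P' = (R @ [x]) # P \<and> k = 0) \<or>
     x = last R \<and> (P = [] \<or> Suc (length (top_row P)) < length R) \<and> P' = R # P \<and> k = 0 \<or>
     (\<exists>y r P'' k'. P' = r # P'' \<and> k = Suc k' \<and> step (top_row P) R x y r \<and> ins P y P'' k')"
  by (rule iffI, erule ins.cases) (auto intro: ins.intros)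

lemma sdt_top_row: "sdt P \<Longrightarrow> top_row P = [] \<or> (\<exists>w. vee (top_row P) w)" by (cases P) auto

lemma sdt_top_row_Nil: "sdt P \<Longrightarrow> top_row P = [] \<longleftrightarrow> P = []" by (cases P) (auto simp: vee_def)

lemma step_length: "step S R a y r \<Longrightarrow> length R = length r"
  by (auto simp: step_def uninsert_def)

lemma vee_snoc:
  assumes "vee R w" "last R < x \<or> x < last R \<and> Suc w = length R"
  shows "\<exists>v. vee (R @ [x]) v"
proof -
  define l where "l = length R"
  have w: "w < l" using veeD(1)[OF assms(1)] by (simp add: l_def)
  have "R \<noteq> []" using w unfolding l_def by auto
  then have last: "last R = R!(l - 1)" by (simp add: l_def last_conv_nth)
  have nx: "(R @ [x])!i = (if i < l then R!i else x)" if "i \<le> l" for i using that by (auto simp: nth_append l_def)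
  show ?thesis
  proof (cases "x < last R \<and> Suc w = length R")
    case True
    then have "Suc w = l" by (simp add: l_def)
    have "vee (R @ [x]) l"
    proof (rule veeI)
      show "l < length (R @ [x])" by (simp add: l_def)
      fix i assume "i < l"
      moreover have "Suc i = l \<Longrightarrow> last R = R!i" using last by auto
      ultimately show "(R @ [x])!Suc i < (R @ [x])!i"
        using veeD(2)[OF assms(1), of i "Suc i"] w \<open>Suc w = l\<close> True last nx[of i] nx[of "Suc i"] by (cases "Suc i = l") auto
    qed (simp add: l_def)
    then show ?thesis ..
  next
    case False
    then have x: "last R < x" using assms by auto
    have "vee (R @ [x]) w"
    proof (rule veeI)
      show "w < length (R @ [x])" using w by (simp add: l_def)
      fix i
      { assume "i < w" then show "(R @ [x])!Suc i < (R @ [x])!i"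
          using veeD(2)[OF assms(1), of i "Suc i"] w nx[of i] nx[of "Suc i"] by auto }
      assume "w \<le> i" "Suc i < length (R @ [x])"
      then have "Suc i \<le> l" by (simp add: l_def)
      moreover have "Suc i = l \<Longrightarrow> last R = R!i" using last by auto
      ultimately show "(R @ [x])!i < (R @ [x])!Suc i"
        using veeD(3)[OF assms(1), of i "Suc i"] \<open>w \<le> i\<close> w x last nx[of i] nx[of "Suc i"] l_def by (cases "Suc i = l") auto
    qed
    then show ?thesis ..
  qed
qed

lemma vee_butlast:
  assumes "vee (R @ [x]) v" "R \<noteq> []"
  shows "\<exists>w. vee R w \<and> (last R < x \<or> x < last R \<and> Suc w = length R)"
proof -
  have l: "last R = R!(length R - 1)" "0 < length R" using assms by (auto simp: last_conv_nth)
  then have s: "Suc (length R - 1) = length R" by auto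
  have nx: "(R @ [x])!i = (if i < length R then R!i else x)" if "i \<le> length R" for i using that by (auto simp: nth_append)
  note D = veeD(2)[OF assms(1)] and U = veeD(3)[OF assms(1)]
  have v: "v \<le> length R" using veeD(1)[OF assms(1)] by simp
  show ?thesis
  proof (cases "v = length R")
    case True
    have "vee R (length R - 1)"
    proof (rule veeI)
      fix i assume "i < length R - 1"
      then have "Suc i < length R" by linarith
      then show "R!Suc i < R!i" using D[of i "Suc i"] True nx[of i] nx[of "Suc i"] by auto
    qed (use l in auto)
    moreover have "x < last R" using D[of "length R - 1" "length R"] l nx[of "length R"] nx[of "length R - 1"] True by auto
    ultimately show ?thesis using s by blast
  next
    case False
    then have v: "v < length R" using v by simp
    have "vee R v"
    proof (rule veeI)
      fix i
      { assume "i < v" then show "R!Suc i < R!i" using D[of i "Suc i"] v nx[of i] nx[of "Suc i"] by auto }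
      assume "v \<le> i" "Suc i < length R"
      then show "R!i < R!Suc i" using U[of i "Suc i"] nx[of i] nx[of "Suc i"] by auto
    qed (use v in auto)
    moreover have "last R < x" using U[of "length R - 1" "length R"] l v nx[of "length R"] nx[of "length R - 1"] by auto
    ultimately show ?thesis by blast
  qed
qed

lemma ok_snoc_upper:
  assumes "length S < length R" shows "ok (R @ [x]) S \<longleftrightarrow> ok R S"
proof -
  have "(R @ [x])!i = R!i" if "i \<le> length S" for i using that assms by (simp add: nth_append)
  then show ?thesis using assms unfolding ok_def by (auto simp: Suc_le_eq)
qed

lemma ins_W:
  assumes "ins P x P' k" "sdt P" shows "W (word P @ [x]) z = W (word P') z"
  using assms
proof (induction arbitrary: z)
  case (abs P R)
  then have "R \<noteq> []" by (auto simp: vee_def)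
  then obtain R' a where "R = R' @ [a]" by (metis rev_exhaust)
  then show ?case by simp
next
  case (down P R x y r P' k)
  obtain A where A: "word P = A @ top_row P" by (cases P) auto
  have "W (word (R # P) @ [x]) z = W A (W (top_row P @ R @ [x]) z)" using A by simp
  also have "\<dots> = W A (W (top_row P @ y # r) z)" using step_hecke[OF down(1)] by simp
  also have "\<dots> = W (word P @ [y]) (W r z)" using A by simp
  also have "\<dots> = W (word P') (W r z)" using down by simp
  finally show ?case by simp
qed simp_all

lemma ins_shape:
  assumes "ins P x P' k" "sdt P"
  shows "shape P' = shape P \<and> removable (shape P) k \<or> k \<le> length P \<and> shape P' = inc (shape P) k"
  using assms
proof (induction)
  case (abs P R)
  then show ?case by (cases P) auto
next
  case (down P R x y r P' k)
  then show ?case using step_length[OF down(1)] by auto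
qed auto

lemma admissible_Nil:
  assumes "vee Q t" "0 < t" shows "admissible Q [] x \<longleftrightarrow> ok Q [x]"
proof -
  have "Q!Suc 0 < Q!0" "Suc 0 < length Q" using veeD(1,2)[OF assms(1)] assms(2) by (auto simp: less_eq_Suc_le)
  then show ?thesis unfolding admissible_iff[OF assms(1)] using assms(2) by (auto simp: ok_def upper_cond_def lower_cond_def)
qed

text \<open>The recursion over rows rests on this: compatibility with the row above can be tested
  before the insertion below is carried out. It is used forwards in \<open>ins_sdt\<close> and
  backwards in \<open>ins_surj\<close>.\<close>

lemma ins_admissible:
  assumes "ins P x P' k" "sdt P" "vee Q t" "0 < t"
  shows "admissible Q (top_row P) x \<longleftrightarrow> ok Q (top_row P')"
  using assms
proof (cases rule: ins.cases)
  case new then show ?thesis using admissible_Nil assms by simp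
next
  case ext then show ?thesis using admissible_ext assms by simp
next
  case abs then show ?thesis using admissible_last assms by auto
next
  case down then show ?thesis using step_admissible assms by auto
qed

lemma ins_sdt:
  assumes "ins P x P' k" "sdt P" shows "sdt P'"
  using assms
proof (induction)
  case (ext R w x P)
  then show ?case using vee_snoc[of R w x] ok_snoc_upper[of "top_row P" R x] okD(1) by auto
next
  case (new x)
  have "vee [x] 0" by (simp add: vee_def)
  then show ?case by (auto simp: ok_def)
next
  case (down P R x y r P' k)
  have "is_target (top_row P) y r" using step_target[OF down(1)] .
  then obtain v where v: "vee r v" "0 < v" "admissible r (top_row P) y" by (auto simp: is_target_def)
  then show ?case using ins_admissible[OF down(2) _ v(1,2)] down by auto
qed auto

lemma ins_total:
  assumes "sdt P" shows "\<exists>P' k. ins P x P' k"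
  using assms
proof (induction P arbitrary: x)
  case Nil then show ?case using new by blast
next
  case (Cons R P)
  obtain u where u: "vee R u" and okR: "ok R (top_row P)" "sdt P" using Cons by auto
  have su: "Suc u \<le> length R" using veeD(1)[OF u] by simp
  show ?case
  proof (cases "last R < x \<or> x < last R \<and> Suc u = length R")
    case True then show ?thesis using ext[OF u] by blast
  next
    case F: False
    show ?thesis
    proof (cases "x = last R \<and> (P = [] \<or> Suc (length (top_row P)) < length R)")
      case True then show ?thesis using abs by blast
    next
      case False
      have "length (top_row P) < length R" using okD(1)[OF okR(1)] .
      then have "is_source (top_row P) R x"
        unfolding is_source_def using u okR F False su sdt_top_row_Nil[OF okR(2)]
        by (intro exI[of _ u]) (auto simp: not_less)
      then obtain y r where "step (top_row P) R x y r" using source_step[OF sdt_top_row[OF okR(2)]] by blast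
      moreover obtain P' k where "ins P y P' k" using Cons.IH okR by blast
      ultimately show ?thesis using down by blast
    qed
  qed
qed

lemma step_not_terminal:
  assumes "step (top_row P) R x y r" "sdt P"
  shows "vee R w \<Longrightarrow> \<not> (last R < x \<or> x < last R \<and> Suc w = length R)"
    "\<not> (x = last R \<and> (P = [] \<or> Suc (length (top_row P)) < length R))"
proof -
  obtain u where u: "vee R u" "ok R (top_row P)"
     "Suc u < length R \<and> x < last R \<or> top_row P \<noteq> [] \<and> length R = Suc (length (top_row P)) \<and> x = last R"
    using step_source[OF sdt_top_row[OF assms(2)] assms(1)] unfolding is_source_def by blast
  show "vee R w \<Longrightarrow> \<not> (last R < x \<or> x < last R \<and> Suc w = length R)" using u vee_unique[OF u(1), of w] by auto
  show "\<not> (x = last R \<and> (P = [] \<or> Suc (length (top_row P)) < length R))" using u by auto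
qed

lemma ins_fun:
  assumes "ins P x P' k" "ins P x P'' k'" "sdt P"
  shows "P' = P'' \<and> k = k'"
  using assms
proof (induction P arbitrary: x P' k P'' k')
  case Nil then show ?case by (simp add: ins_Nil_iff)
next
  case (Cons R P)
  have s: "sdt P" using Cons.prems by simp
  note t = step_not_terminal[OF _ s]
  show ?case
  proof (cases "\<exists>y r. step (top_row P) R x y r")
    case True
    then obtain y r where st: "step (top_row P) R x y r" by blast
    have nt: "\<And>w. vee R w \<Longrightarrow> \<not> (last R < x \<or> x < last R \<and> Suc w = length R)"
      "\<not> (x = last R \<and> (P = [] \<or> Suc (length (top_row P)) < length R))" using t[OF st] by auto
    obtain P1 k1 where 1: "P' = r # P1" "k = Suc k1" "ins P y P1 k1"
      using Cons.prems(1)[unfolded ins_Cons_iff] nt step_unique_target[OF st] by blast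
    obtain P2 k2 where 2: "P'' = r # P2" "k' = Suc k2" "ins P y P2 k2"
      using Cons.prems(2)[unfolded ins_Cons_iff] nt step_unique_target[OF st] by blast
    show ?thesis using Cons.IH[OF 1(3) 2(3) s] 1 2 by simp
  next
    case False
    then show ?thesis using Cons.prems unfolding ins_Cons_iff by auto
  qed
qed

text \<open>Equality of the old shapes separates the two ways of ending in row \<open>k\<close>, by
  a new cell and by absorption.\<close>

lemma ins_inj:
  assumes "ins P x P' k" "ins P2 x2 P' k" "shape P = shape P2" "sdt P" "sdt P2"
  shows "P = P2 \<and> x = x2"
  using assms
proof (induction P arbitrary: x P' k P2 x2)
  case Nil then show ?case by (auto simp: ins_Nil_iff)
next
  case (Cons R P)
  then obtain R2 Q2 where P2: "P2 = R2 # Q2" by (cases P2) auto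
  have s: "sdt P" "sdt Q2" "length R = length R2" using Cons.prems P2 by auto
  show ?case
  proof (cases k)
    case 0
    then show ?thesis using Cons.prems(1,2) s unfolding P2 ins_Cons_iff by auto
  next
    case (Suc j)
    obtain y r P1 where 1: "P' = r # P1" "step (top_row P) R x y r" "ins P y P1 j"
      using Cons.prems(1) Suc unfolding ins_Cons_iff by auto
    obtain y2 where 2: "step (top_row Q2) R2 x2 y2 r" "ins Q2 y2 P1 j"
      using Cons.prems(2) Suc 1 unfolding P2 ins_Cons_iff by auto
    have "P = Q2 \<and> y = y2" using Cons.IH[OF 1(3) 2(2)] s Cons.prems(3) P2 by simp
    then show ?thesis using step_unique_source[OF 1(2)] 2 P2 by auto
  qed
qed

text \<open>The lower rows are undone first; \<open>ins_admissible\<close> then turns the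
  compatibility of \<open>P'\<close> into a target for the top row, and \<open>step_ex\<close>
  undoes its step. The hypothesis on shapes is the conclusion of \<open>ins_shape\<close>.\<close>

lemma ins_surj:
  assumes "sdt P'" "shape P' = \<mu> \<and> removable \<mu> k \<or> k \<le> length \<mu> \<and> shape P' = inc \<mu> k"
    "\<forall>m\<in>set \<mu>. 0 < m" "sorted_wrt (>) \<mu>"
  shows "\<exists>P x. ins P x P' k \<and> sdt P \<and> shape P = \<mu>"
  using assms
proof (induction \<mu> arbitrary: P' k)
  case Nil
  then obtain x where "P' = [[x]]" "k = 0" by (auto simp: length_Suc_conv)
  then show ?case by (auto simp: ins_Nil_iff intro!: exI[of _ "[]"])
next
  case (Cons m \<mu>)
  obtain R P where P': "P' = R # P" using Cons.prems(2) by (cases P'; cases k) auto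
  show ?case
  proof (cases k)
    case 0
    show ?thesis
    proof (cases "shape P' = m # \<mu> \<and> removable (m # \<mu>) k")
      case True
      then have "P = [] \<or> Suc (length (top_row P)) < length R" using P' 0 by (cases P) auto
      then have "ins P' (last R) P' k" using ins.abs[of P R] P' 0 by simp
      then show ?thesis using True Cons.prems(1) by (intro exI[of _ P'] exI[of _ "last R"]) auto
    next
      case False
      then have s: "length R = Suc m" "shape P = \<mu>" using Cons.prems(2) 0 P' by auto
      obtain R0 x where R: "R = R0 @ [x]" using s(1) by (metis length_0_conv nat.distinct(1) rev_exhaust)
      then have R0: "length R0 = m" using s by simp
      then have ne: "R0 \<noteq> []" using Cons.prems(3) by auto
      obtain v where "vee (R0 @ [x]) v" using Cons.prems(1) P' R by auto
      then obtain w where w: "vee R0 w" "last R0 < x \<or> x < last R0 \<and> Suc w = length R0" using vee_butlast ne by blast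
      have l: "length (top_row P) < length R0" using s(2) R0 ne Cons.prems(4) by (cases P) auto
      have "ok R0 (top_row P)" using Cons.prems(1) ok_snoc_upper[OF l] P' R by auto
      then have "sdt (R0 # P)" using w Cons.prems(1) P' by auto
      moreover have "ins (R0 # P) x P' k" using ins.ext[OF w] P' R 0 by simp
      ultimately show ?thesis using s R0 by fastforce
    qed
  next
    case (Suc j)
    have sP: "sdt P" "length R = m" using Cons.prems P' Suc by auto
    have c: "shape P = \<mu> \<and> removable \<mu> j \<or> j \<le> length \<mu> \<and> shape P = inc \<mu> j" using Cons.prems P' Suc by auto
    then have "P \<noteq> []" by (cases \<mu>; cases j) auto
    then have ne: "top_row P \<noteq> []" using sdt_top_row_Nil sP by blast
    obtain v where v: "vee R v" "ok R (top_row P)" using Cons.prems P' by auto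
    have v0: "0 < v" using ok_valley_pos v ne by blast
    obtain P0 y where I: "ins P0 y P j" "sdt P0" "shape P0 = \<mu>"
      using Cons.IH[OF sP(1) c] Cons.prems by auto
    have "admissible R (top_row P0) y" using ins_admissible[OF I(1,2) v(1) v0] v by simp
    then have "is_target (top_row P0) y R" using v v0 unfolding is_target_def by blast
    then obtain R0 a where st: "step (top_row P0) R0 a y R" using step_ex[OF sdt_top_row[OF I(2)]] by blast
    have "is_source (top_row P0) R0 a" using step_source[OF sdt_top_row[OF I(2)] st] .
    then have "sdt (R0 # P0)" using I unfolding is_source_def by auto
    moreover have "ins (R0 # P0) a P' k" using ins.down[OF st I(1)] P' Suc by simp
    moreover have "shape (R0 # P0) = m # \<mu>" using step_length[OF st] sP I by simp
    ultimately show ?thesis by (intro exI[of _ "R0 # P0"] exI[of _ a]) simp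
  qed
qed

lemma sdt_strict: "sdt P \<Longrightarrow> sorted_wrt (>) (shape P) \<and> (\<forall>m\<in>set (shape P). 0 < m)"
proof (induction P)
  case (Cons R P)
  have R: "0 < length R" using Cons.prems by (auto simp: vee_def)
  show ?case
  proof (cases P)
    case (Cons S P')
    then have "length S < length R" using \<open>sdt (R # P)\<close> okD(1) by auto
    then show ?thesis using Cons.IH Cons.prems R Cons by auto
  qed (use R in auto)
qed simp

section \<open>0-Hecke expressions and Demazure operators\<close>

lemma cox_gen_eq:
  "cox_gen j k = (if j = 0 then (if \<bar>k\<bar> = 1 then - k else k)
     else if k = int j then int j + 1 else if k = int j + 1 then int j
     else if k = - int j then - int j - 1 else if k = - int j - 1 then - int j else k)"
  by (auto simp: cox_gen_def Transposition.transpose_def abs_if)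

lemma cox_gen_invol [simp]: "cox_gen j (cox_gen j k) = k"
  by (auto simp: cox_gen_eq)

lemma cox_gen_odd: "cox_gen j (- k) = - cox_gen j k"
  by (auto simp: cox_gen_eq)

lemma cox_gen_eq_iff: "cox_gen j k = l \<longleftrightarrow> k = cox_gen j l"
  by (metis cox_gen_invol)

lemma cox_gen_neq_0: "cox_gen j k = 0 \<longleftrightarrow> k = 0"
  by (auto simp: cox_gen_eq)

lemma cox_gen_moves: "cox_gen i (int i + 1) \<noteq> int i + 1"
  by (auto simp: cox_gen_eq)

lemma cox_gen_inj: "cox_gen i = cox_gen j \<Longrightarrow> i = j"
proof -
  have *: False if "cox_gen i = cox_gen j" "i < j" for i j
  proof -
    have "cox_gen i (int j + 1) = int j + 1" using that(2) by (auto simp: cox_gen_eq)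
    then show False using that(1) cox_gen_moves[of j] by simp
  qed
  show "cox_gen i = cox_gen j \<Longrightarrow> i = j" using *[of i j] *[of j i] by (metis linorder_neqE_nat)
qed

text \<open>The general reflection of the group of signed permutations; \<open>y = - x\<close> gives
  the sign changes.\<close>

definition reflection :: "int \<Rightarrow> int \<Rightarrow> int \<Rightarrow> int" where
  "reflection x y k = (if k = x then y else if k = y then x else if k = - x then - y else if k = - y then - x else k)"

lemma reflection_conj: "reflection x y (cox_gen j k) = cox_gen j (reflection (cox_gen j x) (cox_gen j y) k)"
proof -
  have "cox_gen j k = - l \<longleftrightarrow> k = - cox_gen j l" for l by (metis cox_gen_invol cox_gen_odd)
  then show ?thesis by (simp add: reflection_def cox_gen_eq_iff[of j k] cox_gen_odd)
qed

text \<open>A generator only exchanges neighbouring nonzero values, so a pair whose order it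
  reverses is one of the pairs it exchanges.\<close>

lemma reflection_cox_gen:
  assumes "x < y" "x \<noteq> 0" "y \<noteq> 0" "cox_gen j y < cox_gen j x"
  shows "reflection x y = cox_gen j"
proof -
  have "(j = 0 \<and> x = -1 \<and> y = 1) \<or> (0 < j \<and> (x = int j \<and> y = int j + 1 \<or> x = - int j - 1 \<and> y = - int j))"
  proof -
    let ?P = "\<lambda>x c. (j = 0 \<and> (x = 1 \<and> c = -1 \<or> x = -1 \<and> c = 1)) \<or> (0 < j \<and> (x = int j \<and> c = int j + 1
      \<or> x = int j + 1 \<and> c = int j \<or> x = - int j \<and> c = - int j - 1 \<or> x = - int j - 1 \<and> c = - int j))
      \<or> c = x \<and> (j = 0 \<longrightarrow> x \<noteq> 1 \<and> x \<noteq> -1) \<and> (0 < j \<longrightarrow> x \<noteq> int j \<and> x \<noteq> int j + 1 \<and> x \<noteq> - int j \<and> x \<noteq> - int j - 1)"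
    have "?P x (cox_gen j x)" "?P y (cox_gen j y)" by (auto simp: cox_gen_eq)
    then show ?thesis using assms by (smt (verit) of_nat_0_less_iff)
  qed
  then consider "j = 0" "x = -1" "y = 1" | "0 < j" "x = int j" "y = int j + 1"
    | "0 < j" "x = - int j - 1" "y = - int j" by blast
  then show ?thesis
  proof cases
    case 1 then show ?thesis by (simp add: fun_eq_iff reflection_def cox_gen_eq abs_if)
  next
    case 2 then show ?thesis by (simp add: fun_eq_iff reflection_def cox_gen_eq)
  next
    case 3
    show ?thesis
    proof
      fix k
      consider "k = int j" | "k = int j + 1" | "k = - int j" | "k = - int j - 1"
        | "k \<noteq> int j" "k \<noteq> int j + 1" "k \<noteq> - int j" "k \<noteq> - int j - 1" by blast
      then show "reflection x y k = cox_gen j k"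
        by cases (use 3 in \<open>simp_all add: reflection_def cox_gen_eq\<close>)
    qed
  qed
qed

lemma group_word_simps [simp]: "group_word [] = id" "group_word (i # a) = cox_gen i \<circ> group_word a"
  by (simp_all add: group_word_def)

lemma group_word_append: "group_word (a @ b) = group_word a \<circ> group_word b"
  by (induction a) (auto simp: comp_assoc)

lemma group_word_rev: "group_word (rev a) (group_word a k) = k"
  by (induction a arbitrary: k) (auto simp: group_word_append)

lemma bij_group_word: "bij (group_word a)"
proof (rule o_bij)
  show "group_word (rev a) \<circ> group_word a = id" using group_word_rev[of a] by (auto simp: fun_eq_iff)
  show "group_word a \<circ> group_word (rev a) = id" using group_word_rev[of "rev a"] by (auto simp: fun_eq_iff)
qed

lemma inv_group_word: "inv (group_word a) = group_word (rev a)"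
  by (rule inv_unique_comp) (use group_word_rev[of a] group_word_rev[of "rev a"] in \<open>auto simp: fun_eq_iff\<close>)

lemma group_word_odd: "group_word a (- k) = - group_word a k"
  by (induction a) (auto simp: cox_gen_odd)

text \<open>Stated for arbitrary reflections so that the induction goes through.\<close>

lemma exchange:
  assumes "x < y" "x \<noteq> 0" "y \<noteq> 0" "group_word (rev b) y < group_word (rev b) x"
  shows "\<exists>b'. length b = Suc (length b') \<and> reflection x y \<circ> group_word b = group_word b'"
  using assms
proof (induction b arbitrary: x y)
  case (Cons j b)
  show ?case
  proof (cases "cox_gen j y < cox_gen j x")
    case True
    then have "reflection x y \<circ> group_word (j # b) = group_word b" using reflection_cox_gen[OF Cons.prems(1-3)] by (auto simp: fun_eq_iff)
    then show ?thesis by (metis length_Cons)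
  next
    case False
    moreover have "cox_gen j x \<noteq> cox_gen j y" using Cons.prems(1) by (metis cox_gen_invol less_irrefl)
    ultimately have lt: "cox_gen j x < cox_gen j y" by simp
    have "\<exists>b'. length b = Suc (length b') \<and> reflection (cox_gen j x) (cox_gen j y) \<circ> group_word b = group_word b'"
      by (rule Cons.IH[OF lt]) (use Cons.prems in \<open>auto simp: cox_gen_neq_0 group_word_append\<close>)
    then obtain b' where b': "length b = Suc (length b')" "reflection (cox_gen j x) (cox_gen j y) \<circ> group_word b = group_word b'" by blast
    have "reflection x y \<circ> group_word (j # b) = group_word (j # b')"
      using reflection_conj[of x y j] by (auto simp: fun_eq_iff b'(2)[symmetric])
    then show ?thesis using b'(1) by (metis length_Cons)
  qed
qed simp

section \<open>Left descents and windows\<close>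

definition lower :: "nat \<Rightarrow> int" where "lower i = (if i = 0 then -1 else int i)"

text \<open>Left descents: \<open>lower i\<close> and \<open>i + 1\<close> are the values exchanged
  by \<open>cox_gen i\<close>, with \<open>-1\<close> as the neighbour of \<open>1\<close> for
  \<open>i = 0\<close>.\<close>

definition descent :: "nat \<Rightarrow> (int \<Rightarrow> int) \<Rightarrow> bool" where
  "descent i u \<longleftrightarrow> inv u (int i + 1) < inv u (lower i)"

lemma reflection_lower: "reflection (lower i) (int i + 1) = cox_gen i"
  by (auto simp: reflection_def lower_def cox_gen_eq fun_eq_iff)

lemma cox_gen_lower: "cox_gen i (int i + 1) = lower i" "cox_gen i (lower i) = int i + 1"
  by (auto simp: cox_gen_eq lower_def)

lemma descent_exchange:
  assumes "descent i (group_word b)"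
  shows "\<exists>b'. length b = Suc (length b') \<and> cox_gen i \<circ> group_word b = group_word b'"
  using exchange[of "lower i" "int i + 1" b] assms reflection_lower
  by (auto simp: descent_def inv_group_word lower_def)

lemma descent_cox_gen: "descent i (cox_gen i \<circ> group_word b) \<longleftrightarrow> \<not> descent i (group_word b)"
proof -
  have "inv (cox_gen i \<circ> group_word b) = group_word (rev b) \<circ> cox_gen i"
    using inv_group_word[of "i # b"] by (simp add: group_word_append fun_eq_iff)
  moreover have "group_word (rev b) (int i + 1) \<noteq> group_word (rev b) (lower i)"
    using bij_group_word[of "rev b"] by (auto simp: bij_def inj_eq lower_def)
  ultimately show ?thesis by (auto simp: descent_def inv_group_word cox_gen_lower)
qed

text \<open>The inverse is used so that left multiplication by a generator acts on positions, as
  \<open>dem\<close> does.\<close>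

definition window :: "(int \<Rightarrow> int) \<Rightarrow> nat \<Rightarrow> int" where "window u i = inv u (int i)"

lemma dem_window:
  "dem i (window (group_word b)) = window (if descent i (group_word b) then group_word b else cox_gen i \<circ> group_word b)"
proof -
  have 1: "inv (cox_gen i \<circ> group_word b) = group_word (rev b) \<circ> cox_gen i"
    using inv_group_word[of "i # b"] by (simp add: group_word_append fun_eq_iff)
  show ?thesis
  proof (cases "i = 0")
    case True
    then show ?thesis using group_word_odd[of "rev b" 1] 1
      by (auto simp: fun_eq_iff dem_def window_def descent_def lower_def inv_group_word cox_gen_eq)
  next
    case False
    then show ?thesis
      by (auto simp: fun_eq_iff dem_def window_def descent_def lower_def 1 inv_group_word cox_gen_eq max_def min_def add.commute)
  qed
qed

lemma window_inj:
  assumes "window (group_word a) = window (group_word b)" shows "group_word a = group_word b"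
proof -
  have "group_word (rev a) k = group_word (rev b) k" for k
  proof (cases "0 \<le> k")
    case True
    then show ?thesis using fun_cong[OF assms, of "nat k"] by (simp add: window_def inv_group_word)
  next
    case False
    then have "group_word (rev a) (- k) = group_word (rev b) (- k)"
      using fun_cong[OF assms, of "nat (- k)"] by (simp add: window_def inv_group_word)
    then show ?thesis by (simp add: group_word_odd)
  qed
  then have "group_word (rev a) = group_word (rev b)" by auto
  then show ?thesis by (metis inv_group_word rev_rev_ident)
qed

lemma reduced_tl: "reduced_word (i # c) u \<Longrightarrow> reduced_word c (group_word c)"
  unfolding reduced_word_def by (metis Suc_le_mono group_word_simps(2) length_Cons)

lemma reduced_ex: "\<exists>c. reduced_word c (group_word b)"
  using ex_has_least_nat[of "\<lambda>c. group_word c = group_word b" b length] unfolding reduced_word_def by auto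

text \<open>In a reduced word no letter is a left descent of the remaining product, because
  \<open>descent_exchange\<close> would shorten the word. Each operator therefore performs an actual
  multiplication.\<close>

lemma W_reduced: "reduced_word c u \<Longrightarrow> W c int = window u"
proof (induction c arbitrary: u)
  case Nil
  then show ?case by (auto simp: reduced_word_def window_def fun_eq_iff)
next
  case (Cons i c)
  have u: "u = cox_gen i \<circ> group_word c" using Cons.prems by (auto simp: reduced_word_def)
  have IH: "W c int = window (group_word c)" using Cons.IH[OF reduced_tl[OF Cons.prems]] .
  have "\<not> descent i (group_word c)"
  proof
    assume "descent i (group_word c)"
    then obtain b' where "length c = Suc (length b')" "cox_gen i \<circ> group_word c = group_word b'"
      using descent_exchange by blast
    then show False using Cons.prems u unfolding reduced_word_def by (metis Suc_n_not_le_n le_SucI length_Cons not_less_eq_eq)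
  qed
  then have "dem i (window (group_word c)) = window u" using dem_window[of i c] u by metis
  then show ?case using IH by simp
qed

lemma hecke_cong_W: "hecke_cong a b \<Longrightarrow> W a z = W b z"
proof (induction arbitrary: z rule: hecke_cong.induct)
  case (comm i j a b)
  then show ?case using dem_comm[of i j] by simp
next
  case (braid i a b)
  then show ?case using dem_braid[of i] by simp
next
  case (braid0 a b)
  then show ?case using dem_braid0 by simp
qed simp_all

lemma reduced_cox_gen: "reduced_word a (cox_gen i) \<Longrightarrow> a = [i]"
proof -
  assume r: "reduced_word a (cox_gen i)"
  then have "length a \<le> length [i]" unfolding reduced_word_def by (metis comp_id group_word_simps)
  moreover have "a \<noteq> []"
  proof
    assume "a = []"
    then have "cox_gen i (int i + 1) = int i + 1" using r by (auto simp: reduced_word_def)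
    then show False using cox_gen_moves by simp
  qed
  ultimately obtain j where "a = [j]" by (cases a) auto
  then show ?thesis using r cox_gen_inj by (auto simp: reduced_word_def)
qed

lemma reduced_singleton: "reduced_word [i] (cox_gen i)"
proof -
  have "cox_gen i \<noteq> group_word []"
  proof
    assume "cox_gen i = group_word []"
    then have "cox_gen i (int i + 1) = int i + 1" by simp
    then show False using cox_gen_moves by simp
  qed
  then have "length [i] \<le> length b" if "group_word b = cox_gen i" for b using that by (cases b) auto
  then show ?thesis unfolding reduced_word_def by auto
qed

text \<open>For a descent, exchange supplies a reduced word beginning with \<open>i\<close>, and
  idempotence removes the extra letter; otherwise prefixing \<open>i\<close> keeps a word reduced.
  The result is unique since \<open>W\<close> is invariant under \<open>hecke_cong\<close> and the
  window determines the element.\<close>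

lemma hecke_prod_cox_gen:
  "hecke_prod (cox_gen i) (group_word b) =
     (if descent i (group_word b) then group_word b else cox_gen i \<circ> group_word b)" (is "_ = ?w")
  unfolding hecke_prod_def
proof (rule the_equality)
  obtain c where c: "reduced_word c (group_word b)" using reduced_ex by blast
  have gc: "group_word c = group_word b" using c by (simp add: reduced_word_def)
  show "\<exists>a c' d. reduced_word a (cox_gen i) \<and> reduced_word c' (group_word b) \<and> reduced_word d ?w \<and> hecke_cong (a @ c') d"
  proof (cases "descent i (group_word b)")
    case True
    then obtain b' where b': "length c = Suc (length b')" "cox_gen i \<circ> group_word c = group_word b'"
      using descent_exchange[of i c] gc by auto
    have "group_word (i # b') = group_word b" using b'(2)[symmetric] gc by (auto simp: fun_eq_iff)
    then have r: "reduced_word (i # b') (group_word b)" using c b'(1) unfolding reduced_word_def by auto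
    have "hecke_cong ([i] @ i # b') (i # b')" using hecke_cong.idem[of "[]" i b'] by simp
    then have "reduced_word [i] (cox_gen i) \<and> reduced_word (i # b') (group_word b) \<and> reduced_word (i # b') ?w \<and> hecke_cong ([i] @ i # b') (i # b')"
      using reduced_singleton r True by simp
    then show ?thesis by blast
  next
    case False
    have "length (i # c) \<le> length d" if d: "group_word d = cox_gen i \<circ> group_word b" for d
    proof -
      have "descent i (group_word d)" using False descent_cox_gen d by simp
      then obtain d' where d': "length d = Suc (length d')" "cox_gen i \<circ> group_word d = group_word d'"
        using descent_exchange by blast
      have "group_word d' = group_word b" using d'(2)[symmetric] d by (auto simp: fun_eq_iff)
      then show ?thesis using c d'(1) unfolding reduced_word_def by auto
    qed
    moreover have "group_word (i # c) = cox_gen i \<circ> group_word b" using gc by simp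
    ultimately have "reduced_word (i # c) (cox_gen i \<circ> group_word b)" unfolding reduced_word_def by blast
    then have "reduced_word [i] (cox_gen i) \<and> reduced_word c (group_word b) \<and> reduced_word (i # c) ?w \<and> hecke_cong ([i] @ c) (i # c)"
      using reduced_singleton c False hecke_cong.refl[of "i # c"] by simp
    then show ?thesis by blast
  qed
next
  fix w assume "\<exists>a c d. reduced_word a (cox_gen i) \<and> reduced_word c (group_word b) \<and> reduced_word d w \<and> hecke_cong (a @ c) d"
  then obtain a c d where h: "reduced_word a (cox_gen i)" "reduced_word c (group_word b)" "reduced_word d w" "hecke_cong (a @ c) d" by blast
  have a: "a = [i]" using reduced_cox_gen h(1) by blast
  have "window w = W d int" using W_reduced[OF h(3)] by simp
  also have "\<dots> = dem i (W c int)" using hecke_cong_W[OF h(4)] a by (metis append_Cons append_Nil comp_apply foldr.simps(2))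
  also have "\<dots> = window ?w" using W_reduced[OF h(2)] dem_window by simp
  finally have "window (group_word d) = window ?w" using h(3) by (simp add: reduced_word_def)
  moreover have "\<exists>e. ?w = group_word e" by (metis group_word_simps(2))
  ultimately have "group_word d = ?w" using window_inj by metis
  then show "w = ?w" using h(3) by (simp add: reduced_word_def)
qed

lemma hecke_expr_window:
  "\<exists>b. foldr hecke_prod (map cox_gen a) id = group_word b \<and> window (group_word b) = W a int"
proof (induction a)
  case Nil
  show ?case by (rule exI[of _ "[]"]) (auto simp: window_def fun_eq_iff)
next
  case (Cons i a)
  then obtain b where b: "foldr hecke_prod (map cox_gen a) id = group_word b" "window (group_word b) = W a int" by blast
  have "\<exists>c. group_word c = (if descent i (group_word b) then group_word b else cox_gen i \<circ> group_word b)"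
    by (metis group_word_simps(2))
  then obtain c where c: "group_word c = (if descent i (group_word b) then group_word b else cox_gen i \<circ> group_word b)" by blast
  have "foldr hecke_prod (map cox_gen (i # a)) id = hecke_prod (cox_gen i) (group_word b)"
    unfolding b(1)[symmetric] by simp
  then have 1: "foldr hecke_prod (map cox_gen (i # a)) id = group_word c" using hecke_prod_cox_gen[of i b] c by metis
  have "W (i # a) int = dem i (window (group_word b))" using b(2) by simp
  then have "window (group_word c) = W (i # a) int" using dem_window[of i b] c by metis
  then show ?case using 1 by blast
qed

lemma hecke_expr_iff:
  assumes "hecke_expr a w" shows "hecke_expr b w \<longleftrightarrow> W b int = W a int"
proof -
  obtain a' where a': "foldr hecke_prod (map cox_gen a) id = group_word a'" "window (group_word a') = W a int"
    using hecke_expr_window by blast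
  obtain b' where b': "foldr hecke_prod (map cox_gen b) id = group_word b'" "window (group_word b') = W b int"
    using hecke_expr_window by blast
  show ?thesis using assms a' b' window_inj unfolding hecke_expr_def by metis
qed

text \<open>Only \<open>dem i\<close> mixes positions up to \<open>i\<close> with positions beyond
  \<open>i\<close>, and it moves the smaller value to the right. A value at most \<open>i\<close>
  can thus get beyond \<open>i\<close> only by this letter, and no later letter undoes that.\<close>

lemma letter_iff:
  assumes "0 < i"
  shows "i \<in> set a \<longleftrightarrow> (\<exists>x>i. W a int x \<le> int i)"
proof -
  have "(i \<notin> set a \<longrightarrow> (\<forall>x>i. int i < W a int x) \<and> (\<forall>x\<le>i. W a int x \<le> int i))
    \<and> (i \<in> set a \<longrightarrow> (\<exists>x>i. W a int x \<le> int i))"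
  proof (induction a)
    case (Cons j a)
    let ?z = "W a int"
    consider (eq) "j = i" | (gt) "i < j" | (lt) "j < i" by linarith
    then show ?case
    proof cases
      case eq
      have "\<exists>x>i. dem i ?z x \<le> int i"
      proof (cases "\<exists>x>Suc i. ?z x \<le> int i")
        case True
        then obtain x where "Suc i < x" "?z x \<le> int i" by blast
        then show ?thesis using assms by (intro exI[of _ x]) (auto simp: dem_def)
      next
        case False
        then have "min (?z i) (?z (Suc i)) \<le> int i" using Cons by (metis Suc_lessI le_refl min.coboundedI1 min.coboundedI2)
        then show ?thesis using assms by (intro exI[of _ "Suc i"]) (auto simp: dem_def)
      qed
      then show ?thesis using eq by simp
    next
      case gt
      have e: "(\<exists>x>i. dem j ?z x \<le> int i) \<longleftrightarrow> (\<exists>x>i. ?z x \<le> int i)"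
      proof
        assume "\<exists>x>i. dem j ?z x \<le> int i"
        then obtain x where x: "x > i" "dem j ?z x \<le> int i" by blast
        then have "dem j ?z x \<in> {?z x, ?z j, ?z (Suc j)}" using gt assms by (auto simp: dem_def max_def min_def)
        then show "\<exists>x>i. ?z x \<le> int i" using x gt by (metis insertE less_SucI singletonD)
      next
        assume "\<exists>x>i. ?z x \<le> int i"
        then obtain x where x: "x > i" "?z x \<le> int i" by blast
        show "\<exists>x>i. dem j ?z x \<le> int i"
        proof (cases "x = j \<or> x = Suc j")
          case True
          then show ?thesis using x gt by (intro exI[of _ "Suc j"]) (auto simp: dem_def)
        next
          case False
          then show ?thesis using x gt by (intro exI[of _ x]) (auto simp: dem_def)
        qed
      qed
      have "dem j ?z x = ?z x" if "x \<le> i" for x using that gt by (auto simp: dem_def)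
      then show ?thesis using Cons e gt by (auto simp: not_le)
    next
      case lt
      have 1: "dem j ?z x = ?z x" if "x > i" for x using that lt assms by (auto simp: dem_def)
      have "dem j ?z x \<le> int i" if "\<forall>x\<le>i. ?z x \<le> int i" "x \<le> i" for x
        using that lt by (auto simp: dem_def)
      then show ?thesis using Cons 1 lt by auto
    qed
  qed auto
  then show ?thesis by (auto simp: not_le)
qed

text \<open>All words for \<open>w\<close> have the same positive letters by
  \<open>letter_iff\<close>; together with \<open>0\<close> they form a finite alphabet.\<close>

lemma finite_hecke_words: "finite (hecke_words n w)"
proof (cases "hecke_words n w = {}")
  case False
  then obtain a where a: "hecke_expr a w" by (auto simp: hecke_words_def)
  have "hecke_words n w \<subseteq> {b. set b \<subseteq> insert 0 (set a) \<and> length b = n}"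
  proof
    fix b assume "b \<in> hecke_words n w"
    then have b: "length b = n" "W b int = W a int" using hecke_expr_iff[OF a] by (auto simp: hecke_words_def)
    have "i \<in> set a" if "i \<in> set b" "i \<noteq> 0" for i using that letter_iff[of i a] letter_iff[of i b] b(2) by simp
    then show "b \<in> {b. set b \<subseteq> insert 0 (set a) \<and> length b = n}" using b(1) by auto
  qed
  then show ?thesis using finite_lists_length_eq[of "insert 0 (set a)" n] finite_subset by auto
qed simp

section \<open>Shifted set-valued tableaux\<close>

lemma inc_nth: "k \<le> length \<mu> \<Longrightarrow> inc \<mu> k = (if k < length \<mu> then \<mu>[k := Suc (\<mu>!k)] else \<mu> @ [1])"
  by (induction \<mu> k rule: inc.induct) auto

lemma removable_nth: "removable \<mu> k \<longleftrightarrow> k < length \<mu> \<and> (Suc k < length \<mu> \<longrightarrow> Suc (\<mu>!Suc k) < \<mu>!k)"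
proof (induction \<mu> k rule: removable.induct)
  case (2 m \<mu>) then show ?case by (cases \<mu>) auto
qed auto

text \<open>The last cell of row \<open>k\<close> counted from 0, in the coordinates of the diagram,
  which start at 1.\<close>

definition cell :: "nat list \<Rightarrow> nat \<Rightarrow> nat \<times> nat" where "cell lam k = (Suc k, lam!k + k)"

lemma cell_in: "strict_partition lam \<Longrightarrow> k < length lam \<Longrightarrow> cell lam k \<in> shifted_diagram lam"
  unfolding strict_partition_def shifted_diagram_def cell_def using nth_mem[of k lam] by fastforce

lemma strict_nth: "strict_partition lam \<Longrightarrow> i < j \<Longrightarrow> j < length lam \<Longrightarrow> lam!j < lam!i"
  unfolding strict_partition_def using sorted_wrt_nth_less[of "(>)" lam i j] by auto

lemma inc_diagram:
  assumes "k \<le> length \<mu>"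
  shows "shifted_diagram (inc \<mu> k) = insert (cell (inc \<mu> k) k) (shifted_diagram \<mu>)"
    "cell (inc \<mu> k) k \<notin> shifted_diagram \<mu>"
proof -
  have len: "length (inc \<mu> k) = (if k < length \<mu> then length \<mu> else Suc (length \<mu>))"
    using inc_nth[OF assms] by simp
  have nth: "inc \<mu> k ! i = (if i = k then (if k < length \<mu> then Suc (\<mu>!k) else 1) else \<mu>!i)" if "i < length (inc \<mu> k)" for i
    using that assms unfolding inc_nth[OF assms] by (auto simp: nth_append)
  have kk: "k < length (inc \<mu> k)" using len assms by auto
  show "shifted_diagram (inc \<mu> k) = insert (cell (inc \<mu> k) k) (shifted_diagram \<mu>)"
  proof (rule set_eqI)
    fix c :: "nat \<times> nat"
    obtain i j where c: "c = (i, j)" by (cases c)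
    show "c \<in> shifted_diagram (inc \<mu> k) \<longleftrightarrow> c \<in> insert (cell (inc \<mu> k) k) (shifted_diagram \<mu>)"
    proof (cases i)
      case 0 then show ?thesis using c by (auto simp: shifted_diagram_def cell_def)
    next
      case (Suc i')
      show ?thesis
      proof (cases "i' < length (inc \<mu> k)")
        case True
        then show ?thesis using c Suc nth[OF True] nth[OF kk] len assms
          by (auto simp: shifted_diagram_def cell_def split: if_splits)
      next
        case False
        then show ?thesis using c Suc len assms kk by (auto simp: shifted_diagram_def cell_def split: if_splits)
      qed
    qed
  qed
  show "cell (inc \<mu> k) k \<notin> shifted_diagram \<mu>" using nth[OF kk] by (auto simp: shifted_diagram_def cell_def)
qed

section \<open>Corners and the removal of a cell\<close>

definition is_corner :: "(nat \<times> nat) set \<Rightarrow> nat \<times> nat \<Rightarrow> bool" where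
  "is_corner D c \<longleftrightarrow> c \<in> D \<and> (fst c + 1, snd c) \<notin> D \<and> (fst c, snd c + 1) \<notin> D"

text \<open>In a shifted diagram there is a cell below the end of row \<open>k\<close> precisely if
  the next part is smaller by one, whence the gap of at least two in
  \<open>removable\<close>.\<close>

lemma corner_cell:
  assumes "strict_partition lam"
  shows "is_corner (shifted_diagram lam) c \<longleftrightarrow> (\<exists>k. removable lam k \<and> c = cell lam k)"
proof
  assume h: "is_corner (shifted_diagram lam) c"
  obtain i j where c: "c = (i, j)" by (cases c)
  obtain k where k: "i = Suc k" using h c by (cases i) (auto simp: is_corner_def shifted_diagram_def)
  have kl: "k < length lam" "j = lam!k + k" using h c k by (auto simp: is_corner_def shifted_diagram_def)
  have "Suc (lam!Suc k) < lam!k" if s: "Suc k < length lam"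
  proof (rule ccontr)
    assume "\<not> ?thesis"
    moreover have "lam!Suc k < lam!k" using strict_nth[OF assms, of k "Suc k"] s by simp
    moreover have "0 < lam!Suc k" using assms s unfolding strict_partition_def by auto
    ultimately show False using h c k kl s by (auto simp: is_corner_def shifted_diagram_def)
  qed
  then show "\<exists>k. removable lam k \<and> c = cell lam k" using kl c k by (auto simp: removable_nth cell_def)
next
  assume "\<exists>k. removable lam k \<and> c = cell lam k"
  then obtain k where k: "removable lam k" "c = cell lam k" by blast
  then show "is_corner (shifted_diagram lam) c"
    using cell_in[OF assms, of k] by (auto simp: removable_nth is_corner_def cell_def shifted_diagram_def)
qed

lemma strict_inc_removable:
  assumes "strict_partition \<mu>" "k \<le> length \<mu>"
  shows "removable (inc \<mu> k) k"
  using assms strict_nth[OF assms(1), of k "Suc k"] unfolding removable_nth inc_nth[OF assms(2)] by auto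

lemma dec_ex:
  assumes "strict_partition lam" "removable lam k"
  shows "\<exists>\<mu>. strict_partition \<mu> \<and> k \<le> length \<mu> \<and> lam = inc \<mu> k"
  using assms
proof (induction lam k rule: removable.induct)
  case (2 m \<mu>)
  \<comment> \<open>If \<open>m = 1\<close>, the row disappears together with its cell.\<close>
  show ?case
  proof (cases "m = 1")
    case True
    then have "\<mu> = []" using 2 by (cases \<mu>) (auto simp: strict_partition_def)
    then show ?thesis using True by (intro exI[of _ "[]"]) (auto simp: strict_partition_def)
  next
    case False
    then have "0 < m - 1" "Suc (m - 1) = m" using 2 by (auto simp: strict_partition_def)
    moreover have "\<forall>x\<in>set \<mu>. x < m - 1"
    proof (cases \<mu>)
      case (Cons a l)
      then have "a < m - 1" "\<forall>x\<in>set l. x < a" using 2 by (auto simp: strict_partition_def)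
      then show ?thesis using Cons by auto
    qed simp
    ultimately show ?thesis using 2 by (intro exI[of _ "(m - 1) # \<mu>"]) (auto simp: strict_partition_def)
  qed
next
  case (3 m \<mu> k)
  have s: "strict_partition \<mu>" "\<forall>x\<in>set \<mu>. x < m" "0 < m" using 3 by (auto simp: strict_partition_def)
  then obtain \<nu> where n: "strict_partition \<nu>" "k \<le> length \<nu>" "\<mu> = inc \<nu> k" using 3 by auto
  have "\<forall>x\<in>set \<nu>. x < m"
  proof
    fix x assume "x \<in> set \<nu>"
    then obtain i where i: "i < length \<nu>" "x = \<nu>!i" by (auto simp: in_set_conv_nth)
    then have "inc \<nu> k ! i \<in> set \<mu>" using n inc_nth[OF n(2)] by (metis nth_mem length_list_update length_append_singleton less_SucI)
    moreover have "x \<le> inc \<nu> k ! i" using i n(2) inc_nth[OF n(2)] by (auto simp: nth_append nth_list_update)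
    ultimately show "x < m" using s by auto
  qed
  then show ?case using n s by (intro exI[of _ "m # \<nu>"]) (auto simp: strict_partition_def)
qed simp

text \<open>Positivity of the parts matters: \<open>inc [] 0\<close> and \<open>inc [0] 0\<close>
  coincide.\<close>

lemma inc_inj:
  assumes "inc \<mu> k = inc \<nu> k" "k \<le> length \<mu>" "k \<le> length \<nu>" "strict_partition \<mu>" "strict_partition \<nu>"
  shows "\<mu> = \<nu>"
  using assms
proof (induction \<mu> k arbitrary: \<nu> rule: inc.induct)
  case (1 k)
  then show ?case by (cases \<nu>) (auto simp: strict_partition_def)
next
  case (2 m \<mu>)
  then show ?case by (cases \<nu>) (auto simp: strict_partition_def)
next
  case (3 m \<mu> k)
  then obtain a l where l: "\<nu> = a # l" by (cases \<nu>) auto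
  have "strict_partition \<mu>" "strict_partition l" using 3 l by (auto simp: strict_partition_def)
  then show ?case using 3 l by auto
qed

text \<open>Formulated for an arbitrary set of cells, so that a cell can be removed without naming
  the new partition, and with elementwise inequalities in place of \<open>Max\<close> and
  \<open>Min\<close>.\<close>

definition set_valued :: "nat \<Rightarrow> (nat \<times> nat) set \<Rightarrow> (nat \<times> nat \<Rightarrow> nat set) set" where
  "set_valued n D = {T \<in> extensional D. (\<forall>c\<in>D. T c \<noteq> {}) \<and> (\<forall>c\<in>D. \<forall>d\<in>D. c \<noteq> d \<longrightarrow> T c \<inter> T d = {}) \<and>
     (\<Union>c\<in>D. T c) = {1..n} \<and>
     (\<forall>c\<in>D. \<forall>d\<in>D. d = (fst c + 1, snd c) \<or> d = (fst c, snd c + 1) \<longrightarrow> (\<forall>x\<in>T c. \<forall>y\<in>T d. x < y))}"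

lemma ShSet_eq_set_valued: "ShSet n lam = set_valued n (shifted_diagram lam)"
proof -
  let ?D = "shifted_diagram lam"
  have mm: "Max (T c) < Min (T d) \<longleftrightarrow> (\<forall>x\<in>T c. \<forall>y\<in>T d. x < y)"
    if "\<forall>c\<in>?D. T c \<noteq> {}" "(\<Union>c\<in>?D. T c) = {1..n}" "c \<in> ?D" "d \<in> ?D" for T :: "nat \<times> nat \<Rightarrow> nat set" and c d
  proof -
    have "finite (T c)" "finite (T d)" using that by (metis UN_upper finite_atLeastAtMost finite_subset)+
    then show ?thesis using that by (auto simp: Max_less_iff Min_gr_iff)
  qed
  have "T \<in> ShSet n lam \<longleftrightarrow> T \<in> set_valued n ?D" for T
  proof (cases "T \<in> extensional ?D \<and> (\<forall>c\<in>?D. T c \<noteq> {}) \<and> (\<Union>c\<in>?D. T c) = {1..n}")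
    case True
    note m = mm[of T, OF conjunct1[OF conjunct2[OF True]] conjunct2[OF conjunct2[OF True]]]
    have 1: "disjoint_family_on T ?D \<longleftrightarrow> (\<forall>c\<in>?D. \<forall>d\<in>?D. c \<noteq> d \<longrightarrow> T c \<inter> T d = {})"
      by (simp add: disjoint_family_on_def)
    have 2: "(\<forall>i j. (i, j) \<in> ?D \<longrightarrow> (i + 1, j) \<in> ?D \<longrightarrow> Max (T (i, j)) < Min (T (i + 1, j))) \<and>
        (\<forall>i j. (i, j) \<in> ?D \<longrightarrow> (i, j + 1) \<in> ?D \<longrightarrow> Max (T (i, j)) < Min (T (i, j + 1)))
       \<longleftrightarrow> (\<forall>c\<in>?D. \<forall>d\<in>?D. d = (fst c + 1, snd c) \<or> d = (fst c, snd c + 1) \<longrightarrow> Max (T c) < Min (T d))" (is "?L \<longleftrightarrow> ?R")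
    proof
      assume L: ?L
      show ?R
      proof (intro ballI impI)
        fix c d assume h: "c \<in> ?D" "d \<in> ?D" "d = (fst c + 1, snd c) \<or> d = (fst c, snd c + 1)"
        obtain i j where "c = (i, j)" by (cases c)
        then show "Max (T c) < Min (T d)" using L h by (metis fst_conv snd_conv)
      qed
    next
      assume R: ?R
      then have "Max (T (i, j)) < Min (T d)" if "(i, j) \<in> ?D" "d \<in> ?D" "d = (i + 1, j) \<or> d = (i, j + 1)" for i j d
        using that by (metis fst_conv snd_conv)
      then show ?L by blast
    qed
    have 3: "(\<forall>c\<in>?D. \<forall>d\<in>?D. d = (fst c + 1, snd c) \<or> d = (fst c, snd c + 1) \<longrightarrow> Max (T c) < Min (T d))
       \<longleftrightarrow> (\<forall>c\<in>?D. \<forall>d\<in>?D. d = (fst c + 1, snd c) \<or> d = (fst c, snd c + 1) \<longrightarrow> (\<forall>x\<in>T c. \<forall>y\<in>T d. x < y))"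
      by (intro ball_cong imp_cong) (simp_all add: m)
    show ?thesis using True 1 2 3 unfolding ShSet_def set_valued_def mem_Collect_eq by argo
  next
    case False
    then show ?thesis unfolding ShSet_def set_valued_def by blast
  qed
  then show ?thesis by blast
qed

lemma set_valuedD:
  assumes "T \<in> set_valued n D"
  shows "T \<in> extensional D" "\<And>c. c \<in> D \<Longrightarrow> T c \<noteq> {}" "\<And>c d. c \<in> D \<Longrightarrow> d \<in> D \<Longrightarrow> c \<noteq> d \<Longrightarrow> T c \<inter> T d = {}"
    "(\<Union>c\<in>D. T c) = {1..n}"
    "\<And>c d x y. c \<in> D \<Longrightarrow> d \<in> D \<Longrightarrow> d = (fst c + 1, snd c) \<or> d = (fst c, snd c + 1) \<Longrightarrow> x \<in> T c \<Longrightarrow> y \<in> T d \<Longrightarrow> x < y"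
proof -
  have h: "\<forall>c\<in>D. T c \<noteq> {}" "\<forall>c\<in>D. \<forall>d\<in>D. c \<noteq> d \<longrightarrow> T c \<inter> T d = {}"
    "\<forall>c\<in>D. \<forall>d\<in>D. d = (fst c + 1, snd c) \<or> d = (fst c, snd c + 1) \<longrightarrow> (\<forall>x\<in>T c. \<forall>y\<in>T d. x < y)"
    using assms unfolding set_valued_def by simp_all
  show "T \<in> extensional D" "(\<Union>c\<in>D. T c) = {1..n}" using assms unfolding set_valued_def by simp_all
  show "\<And>c. c \<in> D \<Longrightarrow> T c \<noteq> {}" using h(1) by (rule bspec)
  show "\<And>c d. c \<in> D \<Longrightarrow> d \<in> D \<Longrightarrow> c \<noteq> d \<Longrightarrow> T c \<inter> T d = {}" using h(2) by simp
  show "x < y" if "c \<in> D" "d \<in> D" "d = (fst c + 1, snd c) \<or> d = (fst c, snd c + 1)" "x \<in> T c" "y \<in> T d" for c d x y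
    using h(3)[rule_format, OF that] .
qed

lemma set_valuedI:
  assumes "T \<in> extensional D" "\<And>c. c \<in> D \<Longrightarrow> T c \<noteq> {}" "\<And>c d. c \<in> D \<Longrightarrow> d \<in> D \<Longrightarrow> c \<noteq> d \<Longrightarrow> T c \<inter> T d = {}"
    "(\<Union>c\<in>D. T c) = {1..n}"
    "\<And>c d x y. c \<in> D \<Longrightarrow> d \<in> D \<Longrightarrow> d = (fst c + 1, snd c) \<or> d = (fst c, snd c + 1) \<Longrightarrow> x \<in> T c \<Longrightarrow> y \<in> T d \<Longrightarrow> x < y"
  shows "T \<in> set_valued n D"
  unfolding set_valued_def mem_Collect_eq by (intro conjI ballI impI) (fact assms)+

text \<open>The two choices of \<open>E\<close> are the two fates of the new largest entry: joining
  the set of a corner or occupying a new cell alone.\<close>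

lemma set_valued_add:
  assumes c: "is_corner D c" and E: "E = D \<or> E = D - {c}" and T: "T \<in> set_valued n E"
  shows "T(c := insert (Suc n) (if c \<in> E then T c else {})) \<in> set_valued (Suc n) D"
proof -
  let ?B = "if c \<in> E then T c else {}"
  let ?T = "T(c := insert (Suc n) ?B)"
  note t = set_valuedD[OF T]
  have cD: "c \<in> D" using c by (simp add: is_corner_def)
  have sub: "T d \<subseteq> {1..n}" if "d \<in> E" for d using that t(4) by blast
  have De: "d \<in> E" if "d \<in> D" "d \<noteq> c" for d using that E by auto
  show ?thesis
  proof (rule set_valuedI)
    show "?T \<in> extensional D" using t(1) E cD by (auto simp: extensional_def)
    show "?T d \<noteq> {}" if "d \<in> D" for d using that De[of d] t(2)[of d] by auto
    show "?T d \<inter> ?T e = {}" if "d \<in> D" "e \<in> D" "d \<noteq> e" for d e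
    proof -
      have *: "insert (Suc n) ?B \<inter> T d = {}" if "d \<in> E" "d \<noteq> c" for d
        using sub[OF that(1)] t(3)[of c d] that by auto
      show ?thesis using that * De[of d] De[of e] t(3)[of d e] by (auto simp: Int_commute)
    qed
    have "(\<Union>d\<in>D. ?T d) = insert (Suc n) (\<Union>d\<in>E. T d)"
    proof -
      have "(\<Union>d\<in>D. ?T d) = (\<Union>d\<in>D - {c}. T d) \<union> insert (Suc n) ?B" using cD by auto
      moreover have "(\<Union>d\<in>D - {c}. T d) \<union> ?B = (\<Union>d\<in>E. T d)" using E cD by auto
      ultimately show ?thesis by auto
    qed
    then show "(\<Union>d\<in>D. ?T d) = {1..Suc n}" using t(4) by auto
    show "x < y" if h: "d \<in> D" "e \<in> D" "e = (fst d + 1, snd d) \<or> e = (fst d, snd d + 1)" "x \<in> ?T d" "y \<in> ?T e" for d e x y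
    proof -
      have dc: "d \<noteq> c" using h c unfolding is_corner_def by auto
      then have d: "d \<in> E" "x \<in> T d" using De h by auto
      show ?thesis
      proof (cases "e = c")
        case True
        then have "y = Suc n \<or> y \<in> ?B" using h by simp
        then show ?thesis using sub[OF d(1)] d(2) t(5)[of d c x y] d h True by (auto split: if_splits)
      next
        case False
        then show ?thesis using t(5)[of d e x y] d h De by auto
      qed
    qed
  qed
qed

text \<open>The largest entry lies in a corner, since a cell to the right or below would have to
  contain larger entries.\<close>

lemma set_valued_remove:
  assumes T: "T \<in> set_valued (Suc n) D"
  shows "\<exists>c E T0. is_corner D c \<and> (E = D \<or> E = D - {c}) \<and> T0 \<in> set_valued n E \<and>
    T = T0(c := insert (Suc n) (if c \<in> E then T0 c else {}))"
proof -
  note t = set_valuedD[OF T]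
  have "Suc n \<in> (\<Union>c\<in>D. T c)" using t(4) by auto
  then obtain c where c: "c \<in> D" "Suc n \<in> T c" by blast
  have sub: "T d \<subseteq> {1..Suc n}" if "d \<in> D" for d using that t(4) by blast
  have nn: "Suc n \<notin> T d" if "d \<in> D" "d \<noteq> c" for d using t(3)[of c d] that c by auto
  have no: "d \<notin> D" if "d = (fst c + 1, snd c) \<or> d = (fst c, snd c + 1)" for d
  proof
    assume d: "d \<in> D"
    then obtain y where "y \<in> T d" using t(2) by blast
    then have "Suc n < y" "y \<le> Suc n" using t(5)[OF c(1) d that c(2)] sub[OF d] by auto
    then show False by simp
  qed
  have ii: "A = {1..n}" if "insert (Suc n) A = {1..Suc n}" "Suc n \<notin> A" for A
  proof -
    have "{1..Suc n} = insert (Suc n) {1..n}" by auto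
    then show ?thesis using that insert_ident[of "Suc n" A "{1..n}"] by simp
  qed
  have cor: "is_corner D c" using c no unfolding is_corner_def by blast
  show ?thesis
  proof (cases "T c = {Suc n}")
    case True
    \<comment> \<open>The value \<open>undefined\<close> keeps the function extensional on the
      smaller set of cells.\<close>
    let ?E = "D - {c}" and ?T = "T(c := undefined)"
    have "?T \<in> set_valued n ?E"
    proof (rule set_valuedI)
      show "?T \<in> extensional ?E" using t(1) by (auto simp: extensional_def)
      have "(\<Union>d\<in>D. T d) = insert (Suc n) (\<Union>d\<in>?E. ?T d)" using c True by auto
      then have "insert (Suc n) (\<Union>d\<in>?E. ?T d) = {1..Suc n}" using t(4) by simp
      moreover have "Suc n \<notin> (\<Union>d\<in>?E. ?T d)" using nn by auto
      ultimately show "(\<Union>d\<in>?E. ?T d) = {1..n}" by (rule ii)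
    qed (use t in \<open>auto\<close>)
    moreover have "T = ?T(c := insert (Suc n) (if c \<in> ?E then ?T c else {}))" using True by (auto simp: fun_eq_iff)
    ultimately show ?thesis using cor by blast
  next
    case False
    let ?T = "T(c := T c - {Suc n})"
    have "?T \<in> set_valued n D"
    proof (rule set_valuedI)
      show "?T \<in> extensional D" using t(1) c by (auto simp: extensional_def)
      show "?T d \<noteq> {}" if "d \<in> D" for d using t(2)[OF that] False c by auto
      show "?T d \<inter> ?T e = {}" if "d \<in> D" "e \<in> D" "d \<noteq> e" for d e using t(3)[OF that] by auto
      have "(\<Union>d\<in>D. T d) = insert (Suc n) (\<Union>d\<in>D. ?T d)" using c by auto
      then have "insert (Suc n) (\<Union>d\<in>D. ?T d) = {1..Suc n}" using t(4) by simp
      moreover have "Suc n \<notin> (\<Union>d\<in>D. ?T d)" using nn by auto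
      ultimately show "(\<Union>d\<in>D. ?T d) = {1..n}" by (rule ii)
      show "x < y" if "d \<in> D" "e \<in> D" "e = (fst d + 1, snd d) \<or> e = (fst d, snd d + 1)" "x \<in> ?T d" "y \<in> ?T e" for d e x y
        using t(5)[OF that(1-3), of x y] that(4,5) by (auto split: if_splits)
    qed
    moreover have "T = ?T(c := insert (Suc n) (if c \<in> D then ?T c else {}))" using c by (auto simp: fun_eq_iff)
    ultimately show ?thesis using cor by blast
  qed
qed

text \<open>The cell is recovered as the one containing the largest entry, and \<open>E\<close> from
  whether that cell contains anything else.\<close>

lemma set_valued_cancel:
  assumes 1: "E1 = D \<or> E1 = D - {c1}" "is_corner D c1" "T1 \<in> set_valued n E1"
    and 2: "E2 = D \<or> E2 = D - {c2}" "is_corner D c2" "T2 \<in> set_valued n E2"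
    and eq: "T1(c1 := insert (Suc n) (if c1 \<in> E1 then T1 c1 else {})) = T2(c2 := insert (Suc n) (if c2 \<in> E2 then T2 c2 else {}))"
  shows "c1 = c2 \<and> E1 = E2 \<and> T1 = T2"
proof -
  have nn: "Suc n \<notin> T d" if "T \<in> set_valued n E" "d \<in> E" for T E d
  proof -
    have "T d \<subseteq> {1..n}" using set_valuedD(4)[OF that(1)] that(2) by blast
    then show ?thesis by auto
  qed
  have cD: "c1 \<in> D" "c2 \<in> D" using 1 2 by (auto simp: is_corner_def)
  have cc: "c1 = c2"
  proof (rule ccontr)
    assume "c1 \<noteq> c2"
    then have "insert (Suc n) (if c1 \<in> E1 then T1 c1 else {}) = T2 c1" using fun_cong[OF eq, of c1] by simp
    then have "Suc n \<in> T2 c1" by blast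
    moreover have "c1 \<in> E2" using \<open>c1 \<noteq> c2\<close> cD 2(1) by blast
    ultimately show False using nn[OF 2(3)] by blast
  qed
  have at: "insert (Suc n) (if c1 \<in> E1 then T1 c1 else {}) = insert (Suc n) (if c1 \<in> E2 then T2 c1 else {})"
    using fun_cong[OF eq, of c1] cc by simp
  have n1: "Suc n \<notin> (if c1 \<in> E1 then T1 c1 else {})" "Suc n \<notin> (if c1 \<in> E2 then T2 c1 else {})" using nn 1 2 by auto
  have at': "(if c1 \<in> E1 then T1 c1 else {}) = (if c1 \<in> E2 then T2 c1 else {})"
    using insert_ident[OF n1] at by simp
  have mem: "c1 \<in> E1 \<longleftrightarrow> c1 \<in> E2"
    using at' set_valuedD(2)[OF 1(3), of c1] set_valuedD(2)[OF 2(3), of c1] by (auto split: if_splits)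
  then have E: "E1 = E2" using 1 2 cc cD by auto
  have "T1 d = T2 d" for d
  proof (cases "d = c1")
    case True
    then show ?thesis using at' E extensional_arb[OF set_valuedD(1)[OF 1(3)], of c1] extensional_arb[OF set_valuedD(1)[OF 2(3)], of c1] by metis
  next
    case False
    then show ?thesis using fun_cong[OF eq, of d] cc by simp
  qed
  then show ?thesis using cc E by auto
qed

section \<open>Growth of shapes, parallel to the insertion\<close>

definition grows :: "nat list \<Rightarrow> nat \<Rightarrow> nat list \<Rightarrow> bool" where
  "grows \<mu> k lam \<longleftrightarrow> lam = \<mu> \<and> removable \<mu> k \<or> k \<le> length \<mu> \<and> lam = inc \<mu> k"

text \<open>At a new cell \<open>T\<close> is \<open>undefined\<close>, so the empty set has to be
  supplied explicitly.\<close>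

definition put :: "nat \<Rightarrow> nat list \<Rightarrow> nat \<Rightarrow> nat list \<Rightarrow> (nat \<times> nat \<Rightarrow> nat set) \<Rightarrow> nat \<times> nat \<Rightarrow> nat set" where
  "put n \<mu> k lam T = T(cell lam k := insert (Suc n) (if cell lam k \<in> shifted_diagram \<mu> then T (cell lam k) else {}))"

lemma grows_diagram:
  assumes "strict_partition \<mu>" "strict_partition lam" "grows \<mu> k lam"
  shows "is_corner (shifted_diagram lam) (cell lam k)"
    "shifted_diagram \<mu> = shifted_diagram lam \<or> shifted_diagram \<mu> = shifted_diagram lam - {cell lam k}"
  using assms corner_cell[OF assms(2)] strict_inc_removable[OF assms(1)] inc_diagram[of k \<mu>]
  unfolding grows_def by blast+

lemma ShSet_put:
  assumes "strict_partition \<mu>" "strict_partition lam" "grows \<mu> k lam" "T \<in> ShSet n \<mu>"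
  shows "put n \<mu> k lam T \<in> ShSet (Suc n) lam"
  using set_valued_add[OF grows_diagram[OF assms(1-3)]] assms(4) unfolding ShSet_eq_set_valued put_def by blast

lemma ShSet_put_surj:
  assumes "strict_partition lam" "T' \<in> ShSet (Suc n) lam"
  shows "\<exists>\<mu> k T. strict_partition \<mu> \<and> grows \<mu> k lam \<and> T \<in> ShSet n \<mu> \<and> T' = put n \<mu> k lam T"
proof -
  obtain c E T where h: "is_corner (shifted_diagram lam) c" "E = shifted_diagram lam \<or> E = shifted_diagram lam - {c}" "T \<in> set_valued n E"
    "T' = T(c := insert (Suc n) (if c \<in> E then T c else {}))"
    using set_valued_remove assms unfolding ShSet_eq_set_valued by metis
  obtain k where k: "removable lam k" "c = cell lam k" using corner_cell[OF assms(1)] h(1) by blast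
  show ?thesis
  proof (cases "E = shifted_diagram lam")
    case True
    then show ?thesis using h k assms(1) unfolding ShSet_eq_set_valued put_def grows_def by blast
  next
    case False
    then have E: "E = shifted_diagram lam - {c}" using h by blast
    obtain \<mu> where m: "strict_partition \<mu>" "k \<le> length \<mu>" "lam = inc \<mu> k" using dec_ex[OF assms(1) k(1)] by blast
    have "shifted_diagram \<mu> = E" using inc_diagram[OF m(2)] E k m by auto
    then show ?thesis using h k m unfolding ShSet_eq_set_valued put_def grows_def by blast
  qed
qed

lemma ShSet_put_inj:
  assumes "strict_partition lam" "strict_partition \<mu>1" "grows \<mu>1 k1 lam" "T1 \<in> ShSet n \<mu>1"
    "strict_partition \<mu>2" "grows \<mu>2 k2 lam" "T2 \<in> ShSet n \<mu>2" "put n \<mu>1 k1 lam T1 = put n \<mu>2 k2 lam T2"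
  shows "\<mu>1 = \<mu>2 \<and> k1 = k2 \<and> T1 = T2"
proof -
  note g1 = grows_diagram[OF assms(2,1,3)] and g2 = grows_diagram[OF assms(5,1,6)]
  have c: "cell lam k1 = cell lam k2 \<and> shifted_diagram \<mu>1 = shifted_diagram \<mu>2 \<and> T1 = T2"
    using set_valued_cancel[OF g1(2,1) _ g2(2,1)] assms(4,7,8) unfolding ShSet_eq_set_valued put_def by blast
  then have k: "k1 = k2" by (simp add: cell_def)
  have "\<mu>1 = \<mu>2"
  proof (cases "cell lam k1 \<in> shifted_diagram \<mu>1")
    case True
    then have "lam = \<mu>1" "lam = \<mu>2" using assms(3,6) inc_diagram(2) c k unfolding grows_def by metis+
    then show ?thesis by simp
  next
    case False
    have "cell lam k1 \<in> shifted_diagram lam" using g1(1) by (simp add: is_corner_def)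
    then have "\<mu>1 \<noteq> lam" "\<mu>2 \<noteq> lam" using False c k by auto
    then show ?thesis using assms inc_inj k unfolding grows_def by metis
  qed
  then show ?thesis using c k by simp
qed

lemma finite_ShSet: "finite (ShSet n lam)"
proof -
  have "finite (shifted_diagram lam)"
  proof (rule finite_subset)
    let ?m = "Max (insert 0 (set lam)) + length lam"
    show "shifted_diagram lam \<subseteq> {..length lam} \<times> {..?m}"
    proof
      fix c assume "c \<in> shifted_diagram lam"
      then obtain i j where c: "c = (i, j)" "1 \<le> i" "i \<le> length lam" "j \<le> lam!(i - 1) + i - 1" by (auto simp: shifted_diagram_def)
      then have "lam!(i - 1) \<le> Max (insert 0 (set lam))" by (intro Max_ge) auto
      then have "j \<le> ?m" using c by linarith
      then show "c \<in> {..length lam} \<times> {..?m}" using c by simp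
    qed
  qed auto
  then have "finite (PiE (shifted_diagram lam) (\<lambda>_. Pow {1..n}))" by (intro finite_PiE) auto
  moreover have "ShSet n lam \<subseteq> PiE (shifted_diagram lam) (\<lambda>_. Pow {1..n})"
    unfolding ShSet_eq_set_valued set_valued_def PiE_def by blast
  ultimately show ?thesis by (rule rev_finite_subset)
qed

lemma ShSet_0_Nil: "ShSet 0 [] = {\<lambda>_. undefined}"
proof -
  have "shifted_diagram [] = {}" by (auto simp: shifted_diagram_def)
  then show ?thesis by (simp add: ShSet_def disjoint_family_on_def)
qed

lemma ShSet_0_empty:
  assumes "strict_partition lam" "lam \<noteq> []" shows "ShSet 0 lam = {}"
proof -
  have "cell lam 0 \<in> shifted_diagram lam" using cell_in[OF assms(1)] assms(2) by simp
  moreover have "T c = {}" if "T \<in> set_valued 0 (shifted_diagram lam)" "c \<in> shifted_diagram lam" for T c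
    using set_valuedD(4)[OF that(1)] that(2) by auto
  ultimately show ?thesis unfolding ShSet_eq_set_valued using set_valuedD(2) by blast
qed

section \<open>Counting 0-Hecke expressions\<close>

lemma sdt_nth: "sdt P \<longleftrightarrow> (\<forall>k<length P. \<exists>v. vee (P!k) v) \<and> (\<forall>k. Suc k < length P \<longrightarrow> ok (P!k) (P!Suc k))"
proof (induction P)
  case (Cons R P)
  show ?case
  proof (cases P)
    case Nil
    have "ok R []" if "vee R v" for v using veeD(1)[OF that] by (auto simp: ok_def)
    then show ?thesis using Nil by auto
  next
    case P: (Cons S P')
    have 1: "(\<forall>k<length (R # P). \<exists>v. vee ((R # P)!k) v) \<longleftrightarrow> (\<exists>v. vee R v) \<and> (\<forall>k<length P. \<exists>v. vee (P!k) v)"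
      by (simp add: All_less_Suc2)
    have 2: "(\<forall>k. Suc k < length (R # P) \<longrightarrow> ok ((R # P)!k) ((R # P)!Suc k)) \<longleftrightarrow> ok R S \<and> (\<forall>k. Suc k < length P \<longrightarrow> ok (P!k) (P!Suc k))"
      (is "?L \<longleftrightarrow> ?R")
    proof
      assume L: ?L
      have "ok R S" using L[rule_format, of 0] P by simp
      moreover have "ok (P!k) (P!Suc k)" if "Suc k < length P" for k using L[rule_format, of "Suc k"] that by simp
      ultimately show ?R by blast
    next
      assume ?R
      then show ?L using P by (auto simp: less_Suc_eq_0_disj)
    qed
    show ?thesis unfolding 1 2 using Cons.IH P by auto
  qed
qed simp

lemma unimodal_iff: "unimodal R \<longleftrightarrow> (\<exists>v. vee R v)"
proof -
  have "sorted_wrt (>) (take (v + 1) R) \<and> sorted_wrt (<) (drop v R) \<longleftrightarrow> vee R v" if v: "v < length R" for v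
  proof -
    have 1: "sorted_wrt (>) (take (v + 1) R) \<longleftrightarrow> (\<forall>i j. i < j \<and> j \<le> v \<longrightarrow> R!j < R!i)"
      using v by (auto simp: sorted_wrt_iff_nth_less less_Suc_eq_le)
    have 2: "sorted_wrt (<) (drop v R) \<longleftrightarrow> (\<forall>i j. v \<le> i \<and> i < j \<and> j < length R \<longrightarrow> R!i < R!j)" (is "?L \<longleftrightarrow> ?R")
    proof
      assume L: ?L
      show ?R
      proof (intro allI impI)
        fix i j assume h: "v \<le> i \<and> i < j \<and> j < length R"
        then have "drop v R ! (i - v) < drop v R ! (j - v)"
          using sorted_wrt_nth_less[OF L, of "i - v" "j - v"] by auto
        then show "R!i < R!j" using h by simp
      qed
    next
      assume ?R then show ?L by (auto simp: sorted_wrt_iff_nth_less)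
    qed
    show ?thesis unfolding 1 2 vee_def using v by simp
  qed
  then show ?thesis unfolding unimodal_def by (metis veeD(1))
qed

section \<open>Tableaux as lists of rows\<close>

lemma tab_row_length [simp]: "length (tab_row lam T (Suc k)) = lam!k"
  by (simp add: tab_row_def)

lemma tab_row_nth: "j < lam!k \<Longrightarrow> tab_row lam T (Suc k) ! j = T (Suc k, Suc k + j)"
  by (simp add: tab_row_def del: upt_Suc)

lemma diagram_iff:
  "k < length lam \<Longrightarrow> (Suc k, j) \<in> shifted_diagram lam \<longleftrightarrow> (\<exists>a<lam!k. j = Suc k + a)"
proof -
  assume k: "k < length lam"
  have "(Suc k, j) \<in> shifted_diagram lam \<longleftrightarrow> Suc k \<le> j \<and> j < Suc k + lam!k"
    using k by (auto simp: shifted_diagram_def)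
  also have "\<dots> \<longleftrightarrow> (\<exists>a<lam!k. j = Suc k + a)"
    by (metis le_add1 le_add_diff_inverse nat_add_left_cancel_less)
  finally show ?thesis .
qed

lemma forbidden_pattern_iff:
  assumes lam: "strict_partition lam" and k: "Suc k < length lam"
    and R: "R = tab_row lam T (Suc k)" "vee R v" and S: "S = tab_row lam T (Suc (Suc k))"
  shows "forbidden_pattern lam T (Suc k) \<longleftrightarrow> \<not> ok R S"
proof -
  have len: "length R = lam!k" "length S = lam!Suc k" "length S < length R"
    using R S strict_nth[OF lam, of k "Suc k"] k by auto
  let ?r = "\<lambda>j. T (Suc k, j)" and ?s = "\<lambda>j. T (Suc k + 1, j)"
  have r: "?r (Suc k + a) = R!a" if "a < length R" for a using that R len tab_row_nth by metis
  have s: "?s (Suc (Suc k) + a) = S!a" if "a < length S" for a using that S len tab_row_nth[of a lam "Suc k" T] by simp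
  have Dr: "(Suc k, j) \<in> shifted_diagram lam \<longleftrightarrow> (\<exists>a<length R. j = Suc k + a)" for j
    using diagram_iff[of k lam j] k len by simp
  have Ds: "(Suc k + 1, j) \<in> shifted_diagram lam \<longleftrightarrow> (\<exists>a<length S. j = Suc (Suc k) + a)" for j
    using diagram_iff[of "Suc k" lam j] k len by simp
  have r0: "?r (Suc k) = R!0" using r[of 0] len(3) by (cases R) auto
  have in_r: "(Suc k, Suc (Suc k) + a) \<in> shifted_diagram lam" "?r (Suc (Suc k) + a) = R!Suc a"
    "(Suc k, Suc (Suc k) + a - 1) \<in> shifted_diagram lam" "?r (Suc (Suc k) + a - 1) = R!a"
    if "a < length S" for a
    using that len(3) r[of "Suc a"] r[of a] unfolding Dr by (auto intro: exI[of _ "Suc a"] exI[of _ a])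
  have in_s: "(Suc k + 1, Suc (Suc k) + a) \<in> shifted_diagram lam" if "a < length S" for a
    using that unfolding Ds by blast
  show ?thesis
  proof
    assume f: "forbidden_pattern lam T (Suc k)"
    show "\<not> ok R S"
    proof
      assume ok: "ok R S"
      consider (a) j where "(Suc k + 1, j) \<in> shifted_diagram lam" "?r (Suc k) \<le> ?s j"
        | (b) j j' where "j < j'" "(Suc k + 1, j) \<in> shifted_diagram lam" "(Suc k + 1, j') \<in> shifted_diagram lam"
           "?r j \<le> ?s j'" "?s j' < ?s j"
        | (c) j j' where "j < j'" "(Suc k + 1, j) \<in> shifted_diagram lam" "(Suc k + 1, j') \<in> shifted_diagram lam"
           "?r (j - 1) < ?r j" "?s j < ?s j'" "?s j' \<le> ?r j"
        | (d) j j' where "j' < j" "(Suc k, j') \<in> shifted_diagram lam" "(Suc k + 1, j) \<in> shifted_diagram lam"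
           "?s j < ?r j'" "?r j' \<le> ?r j"
        | (e) j where "(Suc k + 1, j) \<in> shifted_diagram lam" "?s j \<le> ?r (j - 1)" "?r (j - 1) < ?r j"
        using f unfolding forbidden_pattern_def Let_def by blast
      then show False
      proof cases
        case a
        then obtain i where "i < length S" "j = Suc (Suc k) + i" unfolding Ds by blast
        then show False using a okD(2)[OF ok, of i] s[of i] r0 by simp
      next
        case b
        then obtain i i' where i: "i < length S" "j = Suc (Suc k) + i" "i' < length S" "j' = Suc (Suc k) + i'" unfolding Ds by blast
        then show False using b okD(3)[OF ok, of i i'] in_r(2)[of i] s[of i] s[of i'] by simp
      next
        case c
        then obtain i i' where i: "i < length S" "j = Suc (Suc k) + i" "i' < length S" "j' = Suc (Suc k) + i'" unfolding Ds by blast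
        then have h: "R!i < R!Suc i" "S!i < S!i'" "S!i' \<le> R!Suc i" "i < i'"
          using c in_r[of i] s[of i] s[of i'] by simp_all
        \<comment> \<open>This is pattern (iii): from \<open>i\<close> on the row increases, so (v)
          at \<open>i'\<close> gives \<open>R!Suc i <= R!i' < S!i'\<close>, a contradiction.\<close>
        have vi: "v \<le> i"
        proof (rule ccontr)
          assume "\<not> v \<le> i"
          then show False using veeD(2)[OF R(2), of i "Suc i"] h by simp
        qed
        have l: "Suc i' < length R" using i len by simp
        have "R!i' < S!i'" using okD(4)[OF ok i(3)] veeD(3)[OF R(2), of i' "Suc i'"] vi h l by simp
        moreover have "R!Suc i \<le> R!i'" using veeD(3)[OF R(2), of "Suc i" i'] vi h l by (cases "i' = Suc i") auto
        ultimately show False using h by simp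
      next
        case d
        then obtain i i' where i: "i < length S" "j = Suc (Suc k) + i" "i' < length R" "j' = Suc k + i'" unfolding Ds Dr by blast
        then show False using d okD(5)[OF ok, of i' i] in_r[of i] s[of i] r[of i'] by simp
      next
        case e
        then obtain i where i: "i < length S" "j = Suc (Suc k) + i" unfolding Ds by blast
        then show False using e okD(4)[OF ok, of i] in_r[of i] s[of i] by simp
      qed
    qed
  next
    assume nok: "\<not> ok R S"
    show "forbidden_pattern lam T (Suc k)"
    proof (rule ccontr)
      assume nf: "\<not> forbidden_pattern lam T (Suc k)"
      have n1: "\<not> ((Suc k + 1, j) \<in> shifted_diagram lam \<and> ?r (Suc k) \<le> ?s j)" for j
        using nf unfolding forbidden_pattern_def Let_def by blast
      have n2: "\<not> (j < j' \<and> (Suc k, j) \<in> shifted_diagram lam \<and> (Suc k + 1, j) \<in> shifted_diagram lam \<and>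
          (Suc k + 1, j') \<in> shifted_diagram lam \<and> ?r j \<le> ?s j' \<and> ?s j' < ?s j)" for j j'
        using nf unfolding forbidden_pattern_def Let_def by blast
      have n4: "\<not> (j' < j \<and> (Suc k, j') \<in> shifted_diagram lam \<and> (Suc k, j) \<in> shifted_diagram lam \<and>
          (Suc k + 1, j) \<in> shifted_diagram lam \<and> ?s j < ?r j' \<and> ?r j' \<le> ?r j)" for j j'
        using nf unfolding forbidden_pattern_def Let_def by blast
      have n5: "\<not> ((Suc k, j - 1) \<in> shifted_diagram lam \<and> (Suc k, j) \<in> shifted_diagram lam \<and>
          (Suc k + 1, j) \<in> shifted_diagram lam \<and> ?s j \<le> ?r (j - 1) \<and> ?r (j - 1) < ?r j)" for j
        using nf unfolding forbidden_pattern_def Let_def by blast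
      have "ok R S"
      proof (rule okI[OF len(3)])
        fix j assume j: "j < length S"
        have "\<not> ?r (Suc k) \<le> ?s (Suc (Suc k) + j)" using n1[of "Suc (Suc k) + j"] in_s[OF j] by blast
        then show "S!j < R!0" unfolding s[OF j] r0 by simp
      next
        fix i j assume h: "i < j" "j < length S" "R!Suc i \<le> S!j" "S!j < S!i"
        then have i: "i < length S" by simp
        show False using n2[of "Suc (Suc k) + i" "Suc (Suc k) + j"] in_s[OF i] in_s[OF h(2)] in_r[OF i] s[OF i] s[OF h(2)] h by simp
      next
        fix j assume j: "j < length S" "R!j < R!Suc j"
        show "R!j < S!j"
          using n5[of "Suc (Suc k) + j"] in_s[OF j(1)] in_r[OF j(1)] s[OF j(1)] j(2) by (simp add: not_le)
      next
        fix i j assume h: "i \<le> j" "j < length S" "R!i \<le> R!Suc j"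
        then have i: "i < length R" using len by simp
        have iD: "(Suc k, Suc k + i) \<in> shifted_diagram lam" unfolding Dr using i by blast
        show "R!i \<le> S!j"
          using n4[of "Suc k + i" "Suc (Suc k) + j"] in_s[OF h(2)] in_r[OF h(2)] iD r[OF i] s[OF h(2)] h by (simp add: not_less)
      qed
      then show False using nok by blast
    qed
  qed
qed

definition rows :: "nat list \<Rightarrow> (nat \<times> nat \<Rightarrow> nat) \<Rightarrow> nat list list" where
  "rows lam T = map (tab_row lam T) [1..<length lam + 1]"

lemma rows_length [simp]: "length (rows lam T) = length lam" by (simp add: rows_def del: upt_Suc)

lemma rows_nth: "k < length lam \<Longrightarrow> rows lam T ! k = tab_row lam T (Suc k)" by (simp add: rows_def del: upt_Suc)

lemma shape_rows: "shape (rows lam T) = lam"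
  by (rule nth_equalityI) (simp_all add: rows_nth)

lemma reading_word_rows: "reading_word lam T = word (rows lam T)"
  by (simp add: reading_word_def word_def rows_def rev_map)

lemma strict_decomp_rows:
  assumes "strict_partition lam"
  shows "T \<in> strict_decomp_tableaux lam \<longleftrightarrow> T \<in> extensional (shifted_diagram lam) \<and> sdt (rows lam T)"
proof -
  have 1: "(\<forall>i\<in>{1..length lam}. unimodal (tab_row lam T i)) \<longleftrightarrow> (\<forall>k<length lam. \<exists>v. vee (rows lam T ! k) v)" (is "?L \<longleftrightarrow> ?R")
  proof
    assume ?L
    then show ?R by (auto simp: rows_nth unimodal_iff[symmetric])
  next
    assume R: ?R
    show ?L
    proof
      fix i assume "i \<in> {1..length lam}"
      then obtain k where k: "i = Suc k" "k < length lam" by (cases i) auto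
      then show "unimodal (tab_row lam T i)" using R rows_nth[of k lam T] unimodal_iff by metis
    qed
  qed
  have 2: "(\<forall>i. 1 \<le> i \<and> i + 1 \<le> length lam \<longrightarrow> \<not> forbidden_pattern lam T i)
     \<longleftrightarrow> (\<forall>k. Suc k < length lam \<longrightarrow> ok (rows lam T ! k) (rows lam T ! Suc k))" (is "?L \<longleftrightarrow> ?R")
    if v: "\<forall>k<length lam. \<exists>v. vee (rows lam T ! k) v"
  proof -
    have *: "forbidden_pattern lam T (Suc k) \<longleftrightarrow> \<not> ok (rows lam T ! k) (rows lam T ! Suc k)" if k: "Suc k < length lam" for k
    proof -
      obtain u where "vee (rows lam T ! k) u" using v k Suc_lessD by blast
      then show ?thesis using forbidden_pattern_iff[OF assms k, of _ T u] rows_nth[of k lam T] rows_nth[of "Suc k" lam T] k by simp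
    qed
    show ?thesis
    proof
      assume ?L then show ?R using * by (auto simp: Suc_le_eq)
    next
      assume R: ?R
      show ?L
      proof (intro allI impI)
        fix i assume "1 \<le> i \<and> i + 1 \<le> length lam"
        then obtain k where "i = Suc k" "Suc k < length lam" by (cases i) auto
        then show "\<not> forbidden_pattern lam T i" using R * by blast
      qed
    qed
  qed
  show ?thesis unfolding strict_decomp_tableaux_def mem_Collect_eq sdt_nth rows_length 1 using 2 by blast
qed

lemma rows_inj:
  assumes "T \<in> extensional (shifted_diagram lam)" "T' \<in> extensional (shifted_diagram lam)" "rows lam T = rows lam T'"
  shows "T = T'"
proof (rule extensionalityI[OF assms(1,2)])
  fix c assume c: "c \<in> shifted_diagram lam"
  obtain i j where ij: "c = (i, j)" by (cases c)
  then obtain k where k: "i = Suc k" "k < length lam" using c by (cases i) (auto simp: shifted_diagram_def)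
  then obtain a where a: "a < lam!k" "j = Suc k + a" using diagram_iff[OF k(2)] c ij by auto
  have "tab_row lam T (Suc k) = tab_row lam T' (Suc k)" using assms(3) rows_nth[OF k(2)] by metis
  then show "T c = T' c" using tab_row_nth[OF a(1)] a ij k by metis
qed

lemma rows_surj:
  assumes "shape P = lam"
  shows "\<exists>T. T \<in> extensional (shifted_diagram lam) \<and> rows lam T = P"
proof -
  define T where "T = restrict (\<lambda>(i, j). P!(i - 1)!(j - i)) (shifted_diagram lam)"
  have len: "length P = length lam" "\<And>k. k < length lam \<Longrightarrow> length (P!k) = lam!k" using assms by auto
  have "rows lam T = P"
  proof (rule nth_equalityI)
    fix k assume "k < length (rows lam T)"
    then have k: "k < length lam" by simp
    have "tab_row lam T (Suc k) = P!k"
    proof (rule nth_equalityI)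
      show "length (tab_row lam T (Suc k)) = length (P!k)" using len k by simp
      fix a assume "a < length (tab_row lam T (Suc k))"
      then have a: "a < lam!k" by simp
      then have "(Suc k, Suc k + a) \<in> shifted_diagram lam" using diagram_iff[OF k] by blast
      then show "tab_row lam T (Suc k) ! a = P!k!a" using tab_row_nth[OF a] by (simp add: T_def)
    qed
    then show "rows lam T ! k = P!k" using rows_nth[OF k] by simp
  qed (use len in simp)
  then show ?thesis by (auto simp: T_def)
qed

lemma aC_eq:
  assumes "strict_partition lam"
  shows "aC w lam = card {P. sdt P \<and> shape P = lam \<and> hecke_expr (word P) w}"
proof -
  have "bij_betw (rows lam) {T \<in> strict_decomp_tableaux lam. hecke_expr (reading_word lam T) w}
     {P. sdt P \<and> shape P = lam \<and> hecke_expr (word P) w}"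
    unfolding bij_betw_def
  proof
    show "inj_on (rows lam) {T \<in> strict_decomp_tableaux lam. hecke_expr (reading_word lam T) w}"
      by (rule inj_onI) (use rows_inj strict_decomp_rows[OF assms] in blast)
    show "rows lam ` {T \<in> strict_decomp_tableaux lam. hecke_expr (reading_word lam T) w} = {P. sdt P \<and> shape P = lam \<and> hecke_expr (word P) w}"
    proof
      show "{P. sdt P \<and> shape P = lam \<and> hecke_expr (word P) w} \<subseteq> rows lam ` {T \<in> strict_decomp_tableaux lam. hecke_expr (reading_word lam T) w}"
      proof
        fix P assume "P \<in> {P. sdt P \<and> shape P = lam \<and> hecke_expr (word P) w}"
        then have P: "sdt P" "shape P = lam" "hecke_expr (word P) w" by auto
        then obtain T where T: "T \<in> extensional (shifted_diagram lam)" "rows lam T = P" using rows_surj by blast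
        then have "T \<in> {T \<in> strict_decomp_tableaux lam. hecke_expr (reading_word lam T) w}"
          using P strict_decomp_rows[OF assms] reading_word_rows by auto
        then show "P \<in> rows lam ` {T \<in> strict_decomp_tableaux lam. hecke_expr (reading_word lam T) w}" using T(2) by blast
      qed
    qed (auto simp: strict_decomp_rows[OF assms] reading_word_rows shape_rows)
  qed
  then show ?thesis unfolding aC_def by (rule bij_betw_same_card)
qed

lemma sdt_strict_partition: "sdt P \<Longrightarrow> strict_partition (shape P)"
  using sdt_strict unfolding strict_partition_def by blast

section \<open>The bijection between words and pairs of tableaux\<close>

definition pairs :: "nat \<Rightarrow> (nat list list \<times> (nat \<times> nat \<Rightarrow> nat set)) set" where
  "pairs n = {(P, T). sdt P \<and> T \<in> ShSet n (shape P)}"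

text \<open>The row in which the insertion ends tells where \<open>Suc n\<close> is recorded: in the
  last cell of that row, alone if the cell is new and together with the earlier entries if the shape
  is unchanged.\<close>

lemma pairs_Suc:
  "\<exists>g. bij_betw g (pairs n \<times> UNIV) (pairs (Suc n)) \<and>
     (\<forall>P T x. (P, T) \<in> pairs n \<longrightarrow> W (word (fst (g ((P, T), x)))) = W (word P @ [x]))"
proof -
  obtain f where f: "\<And>P x. sdt P \<Longrightarrow> ins P x (fst (f P x)) (snd (f P x))"
  proof -
    have "\<exists>f. \<forall>P x. sdt P \<longrightarrow> ins P x (fst (f P x)) (snd (f P x))"
    proof -
      have "\<forall>P x. \<exists>c. sdt P \<longrightarrow> ins P x (fst c) (snd c)" using ins_total by (metis fst_conv snd_conv)
      then show ?thesis by metis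
    qed
    then show thesis using that by blast
  qed
  define g where "g = (\<lambda>((P, T), x). (fst (f P x), put n (shape P) (snd (f P x)) (shape (fst (f P x))) T))"
  have grow: "grows (shape P) k (shape P')" if "ins P x P' k" "sdt P" for P x P' k
    using ins_shape[OF that] unfolding grows_def by auto
  have "bij_betw g (pairs n \<times> UNIV) (pairs (Suc n))"
    unfolding bij_betw_def
  proof
    show "inj_on g (pairs n \<times> UNIV)"
    proof (rule inj_onI)
      fix a b assume h: "a \<in> pairs n \<times> UNIV" "b \<in> pairs n \<times> UNIV" "g a = g b"
      obtain P T x where a: "a = ((P, T), x)" by (metis surj_pair)
      obtain Q U y where b: "b = ((Q, U), y)" by (metis surj_pair)
      have s: "sdt P" "sdt Q" "T \<in> ShSet n (shape P)" "U \<in> ShSet n (shape Q)" using h a b by (auto simp: pairs_def)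
      define P' where "P' = fst (f P x)" define k where "k = snd (f P x)" define l where "l = snd (f Q y)"
      have i1: "ins P x P' k" using f[OF s(1)] by (simp add: P'_def k_def)
      have e: "fst (f Q y) = P'" "put n (shape P) k (shape P') T = put n (shape Q) l (shape P') U"
        using h(3) unfolding a b g_def P'_def k_def l_def by auto
      have i2: "ins Q y P' l" using f[OF s(2), of y] e by (simp add: l_def)
      \<comment> \<open>The recording tableau determines the row and the shape before the insertion,
        which is what \<open>ins_inj\<close> requires.\<close>
      have "shape P = shape Q \<and> k = l \<and> T = U"
        using ShSet_put_inj[OF sdt_strict_partition[OF ins_sdt[OF i1 s(1)]] sdt_strict_partition[OF s(1)] grow[OF i1 s(1)] s(3)
          sdt_strict_partition[OF s(2)] grow[OF i2 s(2)] s(4) e(2)] .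
      then show "a = b" using ins_inj[OF i1 _ _ s(1,2)] i2 a b by auto
    qed
    show "g ` (pairs n \<times> UNIV) = pairs (Suc n)"
    proof
      show "g ` (pairs n \<times> UNIV) \<subseteq> pairs (Suc n)"
      proof
        fix c assume "c \<in> g ` (pairs n \<times> UNIV)"
        then obtain P T x where c: "c = g ((P, T), x)" "sdt P" "T \<in> ShSet n (shape P)" by (auto simp: pairs_def)
        have i: "ins P x (fst (f P x)) (snd (f P x))" using f c by blast
        then show "c \<in> pairs (Suc n)"
          using ShSet_put[OF sdt_strict_partition[OF c(2)] sdt_strict_partition[OF ins_sdt[OF i c(2)]] grow[OF i c(2)] c(3)] ins_sdt[OF i c(2)]
          unfolding c(1) g_def pairs_def by simp
      qed
      show "pairs (Suc n) \<subseteq> g ` (pairs n \<times> UNIV)"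
      proof
        fix c assume "c \<in> pairs (Suc n)"
        then obtain P' T' where c: "c = (P', T')" "sdt P'" "T' \<in> ShSet (Suc n) (shape P')" by (auto simp: pairs_def)
        obtain \<mu> k T where m: "strict_partition \<mu>" "grows \<mu> k (shape P')" "T \<in> ShSet n \<mu>" "T' = put n \<mu> k (shape P') T"
          using ShSet_put_surj[OF sdt_strict_partition[OF c(2)] c(3)] by blast
        have "\<exists>P x. ins P x P' k \<and> sdt P \<and> shape P = \<mu>"
          by (rule ins_surj) (use c(2) m(1,2) in \<open>auto simp: grows_def strict_partition_def\<close>)
        then obtain P x where P: "ins P x P' k" "sdt P" "shape P = \<mu>" by blast
        have "fst (f P x) = P' \<and> snd (f P x) = k" using ins_fun[OF f[OF P(2)] P(1) P(2)] by blast
        then have "g ((P, T), x) = c" using c m P by (simp add: g_def)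
        moreover have "(P, T) \<in> pairs n" using P m by (simp add: pairs_def)
        ultimately show "c \<in> g ` (pairs n \<times> UNIV)" by (metis SigmaI UNIV_I image_eqI)
      qed
    qed
  qed
  moreover have "W (word (fst (g ((P, T), x)))) = W (word P @ [x])" if "(P, T) \<in> pairs n" for P T x
  proof
    fix z
    have s: "sdt P" using that by (simp add: pairs_def)
    show "W (word (fst (g ((P, T), x)))) z = W (word P @ [x]) z" using ins_W[OF f[OF s] s] by (simp add: g_def)
  qed
  ultimately show ?thesis by blast
qed

text \<open>One bijection for all words of length \<open>n\<close>; the element \<open>w\<close>
  enters only later, through the equality of Demazure operators.\<close>

lemma word_bijection:
  "\<exists>f. bij_betw f {a. length a = n} (pairs n) \<and> (\<forall>a. length a = n \<longrightarrow> W (word (fst (f a))) = W a)"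
proof (induction n)
  case 0
  have "(P, T) \<in> pairs 0 \<longleftrightarrow> P = [] \<and> T = (\<lambda>_. undefined)" for P T
  proof (cases "P = []")
    case True then show ?thesis by (simp add: pairs_def ShSet_0_Nil)
  next
    case False
    then show ?thesis using ShSet_0_empty[OF sdt_strict_partition[of P]] by (auto simp: pairs_def)
  qed
  then have "pairs 0 = {([], \<lambda>_. undefined)}" by auto
  then show ?case by (intro exI[of _ "\<lambda>_. ([], \<lambda>_. undefined)"]) (auto simp: bij_betw_def)
next
  case (Suc n)
  then obtain f where f: "bij_betw f {a. length a = n} (pairs n)" "\<And>a. length a = n \<Longrightarrow> W (word (fst (f a))) = W a" by blast
  obtain g where g: "bij_betw g (pairs n \<times> UNIV) (pairs (Suc n))"
    "\<And>P T x. (P, T) \<in> pairs n \<Longrightarrow> W (word (fst (g ((P, T), x)))) = W (word P @ [x])"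
    using pairs_Suc[of n] by blast
  let ?h = "\<lambda>a::nat list. (f (butlast a), last a)"
  have h: "bij_betw ?h {a. length a = Suc n} (pairs n \<times> UNIV)"
    unfolding bij_betw_def
  proof
    show "inj_on ?h {a. length a = Suc n}"
    proof (rule inj_onI)
      fix a b assume "a \<in> {a. length a = Suc n}" "b \<in> {a. length a = Suc n}" "?h a = ?h b"
      then have l: "length a = Suc n" "length b = Suc n" "f (butlast a) = f (butlast b)" "last a = last b" by auto
      then have "butlast a = butlast b" using inj_onD[OF bij_betw_imp_inj_on[OF f(1)], of "butlast a" "butlast b"] by simp
      then show "a = b" using l append_butlast_last_id by (metis length_0_conv nat.distinct(1))
    qed
    show "?h ` {a. length a = Suc n} = pairs n \<times> UNIV"
    proof
      show "?h ` {a. length a = Suc n} \<subseteq> pairs n \<times> UNIV" using bij_betw_imp_surj_on[OF f(1)] by auto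
      show "pairs n \<times> UNIV \<subseteq> ?h ` {a. length a = Suc n}"
      proof
        fix c assume "c \<in> pairs n \<times> (UNIV :: nat set)"
        then obtain p x where c: "c = (p, x)" "p \<in> pairs n" by blast
        then have "p \<in> f ` {a. length a = n}" using bij_betw_imp_surj_on[OF f(1)] by simp
        then obtain a where "length a = n" "f a = p" by auto
        then show "c \<in> ?h ` {a. length a = Suc n}" using c by (intro image_eqI[of _ _ "a @ [x]"]) auto
      qed
    qed
  qed
  have "bij_betw (g \<circ> ?h) {a. length a = Suc n} (pairs (Suc n))" by (rule bij_betw_trans[OF h g(1)])
  moreover have "W (word (fst ((g \<circ> ?h) a))) = W a" if a: "length a = Suc n" for a
  proof -
    obtain P T where P: "f (butlast a) = (P, T)" by (metis surj_pair)
    have b: "length (butlast a) = n" using a by simp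
    then have "(P, T) \<in> pairs n" using bij_betwE[OF f(1)] P by (metis mem_Collect_eq)
    then have "W (word (fst ((g \<circ> ?h) a))) = W (word P @ [last a])" using g(2) P by simp
    also have "\<dots> = W (butlast a @ [last a])" using f(2)[OF b] P by (simp add: fun_eq_iff)
    also have "\<dots> = W a" using a by (metis append_butlast_last_id length_0_conv nat.distinct(1))
    finally show ?thesis .
  qed
  ultimately show ?case by blast
qed

text \<open>Follows the growth of the shape: each entry adds at most one cell.\<close>

lemma ShSet_sum:
  assumes "strict_partition lam" "T \<in> ShSet n lam" shows "sum_list lam \<le> n"
  using assms
proof (induction n arbitrary: lam T)
  case 0
  then show ?case using ShSet_0_empty[of lam] by (cases "lam = []") auto
next
  case (Suc n)
  obtain \<mu> k T0 where m: "strict_partition \<mu>" "grows \<mu> k lam" "T0 \<in> ShSet n \<mu>"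
    using ShSet_put_surj[OF Suc.prems] by blast
  have "sum_list \<mu> \<le> n" using Suc.IH m by blast
  then show ?case using m(2) sum_inc[of \<mu> k] unfolding grows_def by auto
qed

lemma word_inj: "shape P = shape P' \<Longrightarrow> word P = word P' \<Longrightarrow> P = P'"
proof (induction P arbitrary: P')
  case (Cons R P)
  then obtain R' Q where "P' = R' # Q" by (cases P') auto
  then show ?case using Cons by auto
qed simp

lemma length_word: "length (word P) = sum_list (shape P)"
  by (induction P) auto

lemma finite_sdt_word: "finite {P. sdt P \<and> shape P = lam \<and> hecke_expr (word P) w}"
proof (rule finite_imageD)
  have "word ` {P. sdt P \<and> shape P = lam \<and> hecke_expr (word P) w} \<subseteq> hecke_words (sum_list lam) w"
    by (auto simp: hecke_words_def length_word)
  then show "finite (word ` {P. sdt P \<and> shape P = lam \<and> hecke_expr (word P) w})" using finite_hecke_words finite_subset by blast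
  show "inj_on word {P. sdt P \<and> shape P = lam \<and> hecke_expr (word P) w}" by (rule inj_onI) (use word_inj in auto)
qed

lemma finite_strict_partitions: "finite {lam. strict_partition lam \<and> sum_list lam \<le> n}"
proof (rule finite_subset)
  show "{lam. strict_partition lam \<and> sum_list lam \<le> n} \<subseteq> {lam. set lam \<subseteq> {..n} \<and> length lam \<le> n}"
  proof clarify
    fix lam :: "nat list" assume h: "strict_partition lam" "sum_list lam \<le> n"
    have "length lam \<le> sum_list lam" if "\<forall>x\<in>set lam. 0 < x" using that by (induction lam) auto
    then have "length lam \<le> n" using h unfolding strict_partition_def by auto
    moreover have "x \<le> n" if "x \<in> set lam" for x using member_le_sum_list[OF that] h by simp
    ultimately show "set lam \<subseteq> {..n} \<and> length lam \<le> n" by auto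
  qed
  show "finite {lam. set lam \<subseteq> {..n} \<and> length lam \<le> n}" by (rule finite_lists_length_le) simp
qed

lemma hecke_expr_cong: "W a = W b \<Longrightarrow> hecke_expr a w \<longleftrightarrow> hecke_expr b w"
  using hecke_expr_iff by metis

theorem corollary1p2:
  fixes m n :: nat and w :: "int \<Rightarrow> int"
  assumes "w \<in> signed_perms m"
  shows "card (hecke_words n w) =
    (\<Sum>lam | strict_partition lam \<and> sum_list lam \<le> n. aC w lam * card (ShSet n lam))"
proof -
  define A where "A = (\<lambda>lam. {P. sdt P \<and> shape P = lam \<and> hecke_expr (word P) w})"
  define L where "L = {lam. strict_partition lam \<and> sum_list lam \<le> n}"
  obtain f where f: "bij_betw f {a. length a = n} (pairs n)" "\<And>a. length a = n \<Longrightarrow> W (word (fst (f a))) = W a"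
    using word_bijection[of n] by blast
  \<comment> \<open>Restricting the bijection to the words for \<open>w\<close> sorts the pairs by
    their common shape, and for a fixed shape the two tableaux are independent.\<close>
  have img: "f ` hecke_words n w = (\<Union>lam\<in>L. A lam \<times> ShSet n lam)"
  proof
    show "f ` hecke_words n w \<subseteq> (\<Union>lam\<in>L. A lam \<times> ShSet n lam)"
    proof
      fix c assume "c \<in> f ` hecke_words n w"
      then obtain a where a: "length a = n" "hecke_expr a w" "c = f a" by (auto simp: hecke_words_def)
      obtain P T where c: "c = (P, T)" by (cases c)
      have "(P, T) \<in> pairs n" using bij_betwE[OF f(1)] a c by auto
      then have P: "sdt P" "T \<in> ShSet n (shape P)" by (auto simp: pairs_def)
      have "hecke_expr (word P) w" using f(2)[OF a(1)] a c hecke_expr_cong by (metis fst_conv)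
      then show "c \<in> (\<Union>lam\<in>L. A lam \<times> ShSet n lam)"
        using P c ShSet_sum[OF sdt_strict_partition[OF P(1)] P(2)] sdt_strict_partition[OF P(1)] by (auto simp: A_def L_def)
    qed
    show "(\<Union>lam\<in>L. A lam \<times> ShSet n lam) \<subseteq> f ` hecke_words n w"
    proof
      fix c assume "c \<in> (\<Union>lam\<in>L. A lam \<times> ShSet n lam)"
      then obtain P T where c: "c = (P, T)" "sdt P" "hecke_expr (word P) w" "T \<in> ShSet n (shape P)" by (auto simp: A_def)
      then have "c \<in> pairs n" by (simp add: pairs_def)
      then have "c \<in> f ` {a. length a = n}" using bij_betw_imp_surj_on[OF f(1)] by simp
      then obtain a where a: "length a = n" "f a = c" by auto
      then have "hecke_expr a w" using f(2)[OF a(1)] c hecke_expr_cong by (metis fst_conv)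
      then show "c \<in> f ` hecke_words n w" using a by (auto simp: hecke_words_def)
    qed
  qed
  have "inj_on f (hecke_words n w)"
    by (rule inj_on_subset[OF bij_betw_imp_inj_on[OF f(1)]]) (auto simp: hecke_words_def)
  then have "card (hecke_words n w) = card (\<Union>lam\<in>L. A lam \<times> ShSet n lam)" using card_image img by metis
  also have "\<dots> = (\<Sum>lam\<in>L. card (A lam \<times> ShSet n lam))"
  proof (rule card_UN_disjoint)
    show "finite L" unfolding L_def by (rule finite_strict_partitions)
    show "\<forall>lam\<in>L. finite (A lam \<times> ShSet n lam)" using finite_sdt_word finite_ShSet by (simp add: A_def)
    show "\<forall>i\<in>L. \<forall>j\<in>L. i \<noteq> j \<longrightarrow> A i \<times> ShSet n i \<inter> A j \<times> ShSet n j = {}" by (auto simp: A_def)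
  qed
  also have "\<dots> = (\<Sum>lam\<in>L. aC w lam * card (ShSet n lam))"
    by (rule sum.cong) (auto simp: card_cartesian_product aC_eq L_def A_def)
  finally show ?thesis by (simp add: L_def)
qed

end
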